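(* Let $n,m\in\mathbb N$, let $\Omega\subset\mathbb R^n$ be open, let $A$ be a Young function satisfying conditions (C1), (C2), (C3), let $\varphi$ be a gauge function and let $\psi$ be the associated gauge function defined below. (i) Let $u\in V^{1,A}(\Omega,\mathbb R^m)$. For every $\varepsilon>0$ there exists $\delta>0$ such that, for every set $E\subset\Omega$, if $\mathscr H^{\varphi}(E)<\delta$ then $\mathscr H^{\psi}(u(E))<\varepsilon$. (ii) Let $u\in V^{1,A}(\mathbb R^n,\mathbb R^m)$. For every $\varepsilon>0$ there exists $\delta>0$ such that, for every set $E\subset\mathbb R^n$, if $\mathscr H^{\varphi}_\infty(E)<\delta$ then $\mathscr H^{\psi}_\infty(u(E))<\varepsilon$.
   Context: A gauge function is a function $\varphi\colon[0,\infty)\to[0,\infty)$ that is increasing, continuous and vanishes only at $0$; throughout, gauge functions are additionally assumed to be such that $r\mapsto\varphi(r)/r^n$ is non-increasing on $(0,\infty)$. For a gauge function $\varphi$, $\sigma\in(0,\infty]$ and $E\subset\mathbb R^k$, $\mathscr H^\varphi_\sigma(E)=\inf\{\sum_{i}\varphi(d(E_i)): d(E_i)\le\sigma,\ E\subset\bigcup_i E_i\}$ ($d$ = diameter); the Hausdorff measure is $\mathscr H^\varphi(E)=\lim_{\sigma\to0^+}\mathscr H^\varphi_\sigma(E)$ and the Hausdorff content is $\mathscr H^\varphi_\infty$. A Young function is a non-trivial convex function $A\colon[0,\infty)\to[0,\infty]$ with $A(0)=0$; its Young conjugate is $\widetilde A(t)=\sup_{\tau\ge0}(\tau t-A(\tau))$.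 The Orlicz space $L^A(\Omega)$ consists of measurable $f$ with finite Luxemburg norm $\|f\|_{L^A(\Omega)}=\inf\{\lambda>0:\int_\Omega A(|f|/\lambda)\,dx\le1\}$. $V^{1,A}(\Omega,\mathbb R^m)=\{u\in L^1_{\rm loc}(\Omega,\mathbb R^m): u$ weakly differentiable, $|\nabla u|\in L^A(\Omega)\}$, and $V^{1,A}_{\rm loc}$ is its local version. Conditions: (C1) if $n=1$, $\lim_{t\to\infty}t/A(t)=0$; if $n\ge2$, $\int^\infty (t/A(t))^{1/(n-1)}dt<\infty$. (C2) $0<A(t)<\infty$ for $t>0$. (C3) if $n=1$, $\lim_{t\to0^+}t/A(t)=\infty$; if $n\ge2$, $\int_0(t/A(t))^{1/(n-1)}dt=\infty$. Under (C1), every map in $V^{1,A}_{\rm loc}$ has a continuous representative, which is always the one used. Define $B=A$ if $n=1$, and for $n\ge2$ let $B$ be the Young conjugate of $t\mapsto t^{n'}\int_t^\infty \widetilde A(s)s^{-1-n'}ds$, with $n'=n/(n-1)$. Define $J(0)=0$, $J(s)=s\,B^{-1}(\varphi(s)/s^n)$ for $s>0$ (bijective increasing), and $\psi(r)=\varphi(J^{-1}(r))$. *)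

theory Defs
  imports "HOL-Analysis.Analysis"
begin

definition gauge_fun :: "nat \<Rightarrow> (real \<Rightarrow> real) \<Rightarrow> bool" where
  "gauge_fun n \<phi> \<longleftrightarrow>
     mono_on {0..} \<phi> \<and> continuous_on {0..} \<phi> \<and> \<phi> 0 = 0 \<and> (\<forall>r>0. \<phi> r > 0) \<and>
     (\<forall>r s. 0 < r \<longrightarrow> r \<le> s \<longrightarrow> \<phi> s / s ^ n \<le> \<phi> r / r ^ n)"

text \<open>H^phi_sigma(E), sigma in (0, infinity]; covering sets are countable families of sets of
  finite diameter (phi is only defined on [0,infinity)).\<close>
definition hausdorff_content ::
  "(real \<Rightarrow> real) \<Rightarrow> ennreal \<Rightarrow> 'a::metric_space set \<Rightarrow> ennreal" where
  "hausdorff_content \<phi> \<sigma> E =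
     (INF C \<in> {C :: nat \<Rightarrow> 'a set. E \<subseteq> (\<Union>i. C i) \<and>
                   (\<forall>i. bounded (C i) \<and> ennreal (diameter (C i)) \<le> \<sigma>)}.
        (\<Sum>i. ennreal (\<phi> (diameter (C i)))))"

text \<open>H^phi(E) = lim_{sigma -> 0+} H^phi_sigma(E) (a monotone limit, hence a supremum).\<close>
definition hausdorff_measure :: "(real \<Rightarrow> real) \<Rightarrow> 'a::metric_space set \<Rightarrow> ennreal" where
  "hausdorff_measure \<phi> E = (SUP \<sigma> \<in> {0<..}. hausdorff_content \<phi> (ennreal \<sigma>) E)"

text \<open>A Young function satisfying (C2) is finite on [0,infinity), so it is represented by a
  real-valued function (only its values on [0,infinity) matter).\<close>
definition young_fun :: "(real \<Rightarrow> real) \<Rightarrow> bool" where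
  "young_fun A \<longleftrightarrow> convex_on {0..} A \<and> A 0 = 0 \<and> (\<forall>t\<ge>0. A t \<ge> 0) \<and> (\<exists>t>0. A t \<noteq> 0)"

text \<open>Young conjugate of a [0,infinity]-valued function: sup_{tau>=0} (tau t - E tau);
  terms with E tau = infinity equal -infinity and are dropped (tau = 0 gives 0).\<close>
definition young_conj :: "(real \<Rightarrow> ennreal) \<Rightarrow> real \<Rightarrow> ennreal" where
  "young_conj E t = (SUP \<tau> \<in> {0..}. (if E \<tau> = \<infinity> then 0 else ennreal (\<tau> * t - enn2real (E \<tau>))))"

definition cond_C1 :: "nat \<Rightarrow> (real \<Rightarrow> real) \<Rightarrow> bool" where
  "cond_C1 n A \<longleftrightarrow>
     (if n = 1 then ((\<lambda>t. t / A t) \<longlongrightarrow> 0) at_top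
      else (\<exists>a>0. (\<integral>\<^sup>+ t\<in>{a..}. ennreal ((t / A t) powr (1 / (real n - 1))) \<partial>lborel) < \<infinity>))"

definition cond_C2 :: "(real \<Rightarrow> real) \<Rightarrow> bool" where
  "cond_C2 A \<longleftrightarrow> (\<forall>t>0. 0 < A t)"

definition cond_C3 :: "nat \<Rightarrow> (real \<Rightarrow> real) \<Rightarrow> bool" where
  "cond_C3 n A \<longleftrightarrow>
     (if n = 1 then filterlim (\<lambda>t. t / A t) at_top (at_right 0)
      else (\<forall>a>0. (\<integral>\<^sup>+ t\<in>{0<..a}. ennreal ((t / A t) powr (1 / (real n - 1))) \<partial>lborel) = \<infinity>))"

definition young_B :: "nat \<Rightarrow> (real \<Rightarrow> real) \<Rightarrow> real \<Rightarrow> ennreal" where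
  "young_B n A =
     (if n = 1 then (\<lambda>t. ennreal (A t))
      else (let n' = real n / (real n - 1);
                At = young_conj (\<lambda>t. ennreal (A t))
            in young_conj (\<lambda>t. ennreal (t powr n') *
                  (\<integral>\<^sup>+ s\<in>{t..}. At s * ennreal (s powr (- 1 - n')) \<partial>lborel))))"

definition young_inv :: "(real \<Rightarrow> ennreal) \<Rightarrow> real \<Rightarrow> real" where
  "young_inv B r = Sup {t. 0 \<le> t \<and> B t \<le> ennreal r}"

definition gauge_J :: "nat \<Rightarrow> (real \<Rightarrow> real) \<Rightarrow> (real \<Rightarrow> real) \<Rightarrow> real \<Rightarrow> real" where
  "gauge_J n A \<phi> s = (if s = 0 then 0 else s * young_inv (young_B n A) (\<phi> s / s ^ n))"

definition gauge_psi :: "nat \<Rightarrow> (real \<Rightarrow> real) \<Rightarrow> (real \<Rightarrow> real) \<Rightarrow> real \<Rightarrow> real" where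
  "gauge_psi n A \<phi> r = \<phi> (the_inv_into {0..} (gauge_J n A \<phi>) r)"

text \<open>Smooth (C^infinity) real functions on R^n: belong to a family of continuous functions
  closed under taking (existing) partial derivatives.\<close>
definition smooth_fun :: "(real^'n \<Rightarrow> real) \<Rightarrow> bool" where
  "smooth_fun f \<longleftrightarrow> (\<exists>F. f \<in> F \<and> (\<forall>g\<in>F. continuous_on UNIV g \<and>
       (\<forall>i. \<exists>h\<in>F. \<forall>x. ((\<lambda>t. g (x + t *\<^sub>R axis i 1)) has_real_derivative h x) (at 0))))"

definition partial_deriv :: "'n \<Rightarrow> (real^'n \<Rightarrow> real) \<Rightarrow> real^'n \<Rightarrow> real" where
  "partial_deriv i f x = deriv (\<lambda>t. f (x + t *\<^sub>R axis i 1)) 0"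

definition test_fun :: "(real^'n) set \<Rightarrow> (real^'n \<Rightarrow> real) \<Rightarrow> bool" where
  "test_fun \<Omega> \<phi> \<longleftrightarrow> smooth_fun \<phi> \<and> compact (closure {x. \<phi> x \<noteq> 0}) \<and>
                     closure {x. \<phi> x \<noteq> 0} \<subseteq> \<Omega>"

definition locally_integrable_on :: "(real^'n) set \<Rightarrow> (real^'n \<Rightarrow> 'b::euclidean_space) \<Rightarrow> bool" where
  "locally_integrable_on \<Omega> f \<longleftrightarrow> (\<forall>K. compact K \<and> K \<subseteq> \<Omega> \<longrightarrow> set_integrable lebesgue K f)"

text \<open>G is the weak gradient of u on Omega: (G x) $ j $ i = d_i u_j.\<close>
definition weak_gradient ::
  "(real^'n) set \<Rightarrow> (real^'n \<Rightarrow> real^'m) \<Rightarrow> (real^'n \<Rightarrow> real^'n^'m) \<Rightarrow> bool" where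
  "weak_gradient \<Omega> u G \<longleftrightarrow> locally_integrable_on \<Omega> u \<and> locally_integrable_on \<Omega> G \<and>
     (\<forall>\<phi> i j. test_fun \<Omega> \<phi> \<longrightarrow>
        (\<integral>x\<in>\<Omega>. partial_deriv i \<phi> x * u x $ j \<partial>lebesgue) =
        - (\<integral>x\<in>\<Omega>. \<phi> x * G x $ j $ i \<partial>lebesgue))"

definition orlicz_space :: "(real \<Rightarrow> real) \<Rightarrow> (real^'n) set \<Rightarrow> (real^'n \<Rightarrow> real) \<Rightarrow> bool" where
  "orlicz_space A \<Omega> f \<longleftrightarrow> f \<in> borel_measurable (restrict_space lebesgue \<Omega>) \<and>
     (\<exists>l>0. (\<integral>\<^sup>+ x\<in>\<Omega>. ennreal (A (\<bar>f x\<bar> / l)) \<partial>lebesgue) \<le> 1)"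

definition V1A :: "(real \<Rightarrow> real) \<Rightarrow> (real^'n) set \<Rightarrow> (real^'n \<Rightarrow> real^'m) \<Rightarrow> bool" where
  "V1A A \<Omega> u \<longleftrightarrow> (\<exists>G. weak_gradient \<Omega> u G \<and> orlicz_space A \<Omega> (\<lambda>x. norm (G x)))"

end

theory Submission
  imports Defs
begin

text \<open>Write \<open>n\<close> for the dimension, \<open>b\<close> for the inverse of \<open>B\<close> and \<open>m(Q)\<close> for the integral of
  \<open>A (|\<nabla>u| / l)\<close> over a cube \<open>Q\<close>. Testing the weak gradient with products of one-dimensional bump
  functions, one coordinate being replaced at a time, compares the averages of \<open>u\<close> over two
  concentric scales and yields a dyadic Riesz potential bound for the oscillation of \<open>u\<close>. With
  Young's inequality this becomes \<open>osc u \<le> C r b (m(Q) / r ^ n)\<close> on every cube \<open>Q \<subseteq> \<Omega>\<close> of side \<open>r\<close>,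
  because \<open>b M\<close> is the infimum over \<open>l > 0\<close> of \<open>(M + E l) / l\<close>, where \<open>B\<close> is the conjugate of \<open>E\<close>.

  The quantity \<open>r b (m / r ^ n)\<close> is increasing in \<open>m\<close> and strictly increasing in \<open>r\<close>. Hence if
  \<open>\<phi> R = max ((2 C) ^ n m(Q)) (\<phi> (2 C r))\<close>, then \<open>u(Q)\<close> lies in a ball of diameter \<open>J R\<close>, and
  \<open>\<psi> (J R) = \<phi> R\<close> is at most a constant times \<open>m(Q) + \<phi> r\<close>. A cover of \<open>E\<close> can be replaced by one with
  pairwise disjoint dyadic cubes. Summing over them leaves the integral of \<open>A (|\<nabla>u| / l)\<close> over a set of
  small measure, which is small by absolute continuity of the integral.\<close>

section \<open>Young functions and their conjugates\<close>

text \<open>The quantifier that shapes the proof: \<open>\<delta>\<close> may depend on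
  \<open>\<epsilon>\<close>, but not on the mesh at which the image is measured. Absolute continuity
  is therefore used twice: for the union of all cubes, whose volume is controlled by the
  \<open>\<phi>\<close>-sum because \<open>\<phi> 1 * r ^ n \<le> \<phi> r\<close> for
  \<open>r \<le> 1\<close>, and for each single cube, where a deep enough dyadic level suffices and
  may depend on the mesh. The inverse \<open>b\<close> is handled through the equivalence of
  \<open>t \<le> b M\<close> with \<open>B t \<le> M\<close>. For \<open>n \<ge> 2\<close> the
  latter is a family of affine conditions on \<open>t\<close>, so an inequality for \<open>b\<close>
  is checked for one parameter at a time. (C1) makes these conditions finite. (C3) gives strictness
  in \<open>r\<close>, hence the injectivity of \<open>J\<close> on which the meaning of
  \<open>\<psi>\<close> rests. In (ii) a small content bounds the diameters of an almost optimal
  cover. In (i) the cubes must stay inside \<open>\<Omega>\<close>, so the mesh has to shrink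
  towards the boundary. Summing contents of infinitely many layers against one Hausdorff measure
  then needs separated layers, which costs a factor 2.\<close>

lemma young_fun_scale:
  assumes "young_fun A" "0 \<le> \<theta>" "\<theta> \<le> 1" "0 \<le> t"
  shows "A (\<theta> * t) \<le> \<theta> * A t"
  using convex_onD[of "{0..}" A "\<theta>" 0 t] assms by (auto simp: young_fun_def)

lemma young_fun_nonneg: "young_fun A \<Longrightarrow> 0 \<le> t \<Longrightarrow> 0 \<le> A t"
  by (simp add: young_fun_def)

lemma young_fun_mono:
  assumes "young_fun A" "0 \<le> s" "s \<le> t"
  shows "A s \<le> A t"
proof (cases "t = 0")
  case False
  then have "A s \<le> (s / t) * A t"
    using young_fun_scale[of A "s / t" t] assms by auto
  also have "\<dots> \<le> 1 * A t"
    using assms False young_fun_nonneg[of A t] by (intro mult_right_mono) auto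
  finally show ?thesis by simp
qed (use assms in auto)

lemma young_fun_ratio_mono:
  assumes "young_fun A" "0 < s" "s \<le> t"
  shows "A s / s \<le> A t / t"
  using young_fun_scale[of A "s / t" t] assms by (auto simp: field_simps)

lemma young_conj_mono:
  assumes "s \<le> t"
  shows "young_conj E s \<le> young_conj E t"
  unfolding young_conj_def
  by (rule SUP_mono) (use assms in \<open>auto intro!: bexI ennreal_leI mult_left_mono\<close>)

abbreviation young_dual :: "(real \<Rightarrow> real) \<Rightarrow> real \<Rightarrow> ennreal" where
  "young_dual A \<equiv> young_conj (\<lambda>t. ennreal (A t))"

lemma young_ineq:
  assumes "0 \<le> a" "0 \<le> A a"
  shows "ennreal (a * k) \<le> ennreal (A a) + young_dual A k"
proof -
  have "ennreal (a * k - A a) \<le> young_dual A k"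
    unfolding young_conj_def using assms by (intro SUP_upper2[of a]) auto
  then have "ennreal (A a) + ennreal (a * k - A a) \<le> ennreal (A a) + young_dual A k"
    by (rule add_left_mono)
  moreover have "ennreal (a * k) \<le> ennreal (A a) + ennreal (a * k - A a)"
    using assms by (cases "a * k \<ge> A a") (auto simp flip: ennreal_plus simp: ennreal_neg ennreal_leI)
  ultimately show ?thesis by (rule order_trans[rotated])
qed

text \<open>Superlevel sets of a monotone function are intervals. Young conjugates are monotone but
  may take the value infinity, hence the target \<open>ennreal\<close>.\<close>

lemma borel_measurable_mono_ennreal:
  fixes f :: "real \<Rightarrow> ennreal"
  assumes "\<And>x y. x \<le> y \<Longrightarrow> f x \<le> f y"
  shows "f \<in> borel_measurable borel"
proof (rule borel_measurableI_greater)
  fix y :: ennreal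
  have "is_interval {x. y < f x}"
    unfolding is_interval_1 using assms less_le_trans by blast
  then show "{x \<in> space borel. y < f x} \<in> sets borel"
    by (simp add: real_interval_borel_measurable)
qed

lemma young_conj_measurable [measurable]: "young_conj E \<in> borel_measurable borel"
  by (intro borel_measurable_mono_ennreal young_conj_mono)

text \<open>Since \<open>A t / t\<close> is nondecreasing, \<open>A \<tau> < \<tau> * s\<close> puts
  all of \<open>{0<..\<tau>}\<close> into the sublevel set, so its length is at least
  \<open>\<tau>\<close>, while \<open>\<tau> * s - A \<tau> \<le> s * \<tau>\<close>. Writing the
  bound as an integral over \<open>t\<close> prepares the exchange of integrals in
  \<open>young_tail_finite\<close>.\<close>

lemma young_conj_le_sublevel:
  assumes A: "young_fun A" and "0 < s"
  shows "young_dual A s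
    \<le> ennreal s * (\<integral>\<^sup>+ t. indicator {t. 0 < t \<and> A t / t < s} t \<partial>lborel)"
  unfolding young_conj_def
proof (rule SUP_least)
  fix \<tau> :: real assume \<tau>: "\<tau> \<in> {0..}"
  show "(if ennreal (A \<tau>) = \<infinity> then 0 else ennreal (\<tau> * s - enn2real (ennreal (A \<tau>))))
     \<le> ennreal s * (\<integral>\<^sup>+ t. indicator {t. 0 < t \<and> A t / t < s} t \<partial>lborel)"
  proof (cases "\<tau> > 0 \<and> A \<tau> < \<tau> * s")
    case True
    have "ennreal \<tau> = (\<integral>\<^sup>+ t. indicator {0<..\<tau>} t \<partial>lborel)" using True by simp
    also have "\<dots> \<le> (\<integral>\<^sup>+ t. indicator {t. 0 < t \<and> A t / t < s} t \<partial>lborel)"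
    proof (intro nn_integral_mono)
      fix t
      have "A t / t < s" if "0 < t" "t \<le> \<tau>"
        proof -
        have "A t / t \<le> A \<tau> / \<tau>" by (rule young_fun_ratio_mono[OF A that])
        also have "\<dots> < s" using True by (simp add: pos_divide_less_eq mult.commute)
        finally show ?thesis .
      qed
      then show "indicator {0<..\<tau>} t \<le> (indicator {t. 0 < t \<and> A t / t < s} t :: ennreal)"
        by (auto split: split_indicator)
    qed
    finally have "ennreal s * ennreal \<tau> \<le> ennreal s * (\<integral>\<^sup>+ t. indicator {t. 0 < t \<and> A t / t < s} t \<partial>lborel)"
      by (rule mult_left_mono) simp
    moreover have "ennreal (\<tau> * s - A \<tau>) \<le> ennreal s * ennreal \<tau>"
      using True young_fun_nonneg[OF A, of \<tau>] \<open>0 < s\<close>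
      by (simp add: ennreal_mult[symmetric] mult.commute)
    ultimately show ?thesis
      using young_fun_nonneg[OF A, of \<tau>] True by simp
  next
    case False
    then have "\<tau> * s - A \<tau> \<le> 0"
      using \<tau> young_fun_nonneg[OF A, of \<tau>] by (cases "\<tau> = 0") auto
    then show ?thesis using \<tau> young_fun_nonneg[OF A, of \<tau>] by (simp add: ennreal_neg)
  qed
qed

text \<open>The integral factor in the definition of \<open>B\<close>, with
  \<open>n' = n / (n - 1)\<close>. It is separated from the power of \<open>t\<close> because the
  scaling arguments treat the two differently.\<close>

definition young_tail :: "nat \<Rightarrow> (real \<Rightarrow> real) \<Rightarrow> real \<Rightarrow> ennreal" where
  "young_tail n A t = (\<integral>\<^sup>+ s\<in>{t..}. young_dual A s *
     ennreal (s powr (- 1 - real n / (real n - 1))) \<partial>lborel)"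

lemma young_B_ge2:
  assumes "2 \<le> n"
  shows "young_B n A =
    young_conj (\<lambda>t. ennreal (t powr (real n / (real n - 1))) * young_tail n A t)"
  using assms by (simp add: young_B_def young_tail_def Let_def)

lemma young_ratio_measurable:
  assumes A: "young_fun A"
  shows "(\<lambda>t. if 0 < t then A t / t else 0) \<in> borel_measurable borel"
proof (rule borel_measurable_mono)
  show "mono (\<lambda>t. if 0 < t then A t / t else 0)"
    unfolding mono_def using young_fun_ratio_mono[OF A] young_fun_nonneg[OF A] by auto
qed

lemma nn_integral_powr_tail:
  fixes a p :: real
  assumes "0 < a" "1 < p"
  shows "(\<integral>\<^sup>+ s. ennreal (s powr - p) * indicator {a..} s \<partial>lborel) = ennreal (a powr (1 - p) / (p - 1))"
proof -
  have "(\<integral>\<^sup>+ s. ennreal (s powr - p) * indicator {a..} s \<partial>lborel)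
     = ennreal (0 - (- (a powr (1 - p)) / (p - 1)))"
  proof (rule nn_integral_FTC_atLeast[where F = "\<lambda>s. - (s powr (1 - p)) / (p - 1)"])
    show "((\<lambda>s. - (s powr (1 - p)) / (p - 1)) \<longlongrightarrow> 0) at_top"
    proof -
      have "((\<lambda>s. s powr (1 - p)) \<longlongrightarrow> 0) at_top"
        using assms by (intro tendsto_neg_powr filterlim_ident) auto
      from tendsto_divide[OF tendsto_minus[OF this] tendsto_const[of "p - 1"]] show ?thesis
        using assms by simp
    qed
    fix x assume "a \<le> x"
    then show "((\<lambda>s. - (s powr (1 - p)) / (p - 1)) has_real_derivative x powr - p) (at x)"
    proof -
      have "((\<lambda>s. s powr (1 - p)) has_real_derivative (1 - p) * x powr (1 - p - 1)) (at x)"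
        using assms \<open>a \<le> x\<close> by (intro has_real_derivative_powr) auto
      moreover have "- ((1 - p) * x powr (1 - p - 1)) / (p - 1) = x powr - p"
      proof -
        have "- ((1 - p) * x powr (1 - p - 1)) = (p - 1) * x powr - p" by (simp add: algebra_simps)
        then show ?thesis using assms by simp
      qed
      ultimately show ?thesis
        using DERIV_cdivide[OF DERIV_minus, of "\<lambda>s. s powr (1 - p)" _ x UNIV "p - 1"] by metis
    qed
  qed auto
  then show ?thesis by simp
qed

text \<open>After bounding the conjugate by the length of a sublevel set, Fubini turns the tail into
  the integral over \<open>t\<close> of \<open>max l (A t / t) powr (1 - q) / (q - 1)\<close>. As
  \<open>q - 1 = 1 / (n - 1)\<close>, the integrand for large \<open>t\<close> is at most a multiple
  of the one in (C1).\<close>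

lemma young_tail_finite:
  assumes n: "2 \<le> n" and A: "young_fun A" and C1: "cond_C1 n A" and C2: "cond_C2 A" and l: "0 < l"
  shows "young_tail n A l < \<infinity>"
proof -
  define q where "q = real n / (real n - 1)"
  define \<alpha> where "\<alpha> t = (if 0 < t then A t / t else 0)" for t
  have n'1: "1 / (real n - 1) = q - 1" "1 < q" using n by (auto simp: q_def field_simps)
  have [measurable]: "\<alpha> \<in> borel_measurable borel"
    unfolding \<alpha>_def by (rule young_ratio_measurable[OF A])
  let ?f = "\<lambda>s t. ennreal (s powr - q) * indicator {l..} s * (indicator {0<..} t * (if \<alpha> t \<le> s then 1 else 0))"
  have Apos: "0 < A t" if "0 < t" for t using C2 that by (simp add: cond_C2_def)
  have "young_tail n A l \<le> (\<integral>\<^sup>+ s. (\<integral>\<^sup>+ t. ?f s t \<partial>lborel) \<partial>lborel)"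
    unfolding young_tail_def q_def[symmetric]
  proof (intro nn_integral_mono)
    fix s
    show "young_dual A s * ennreal (s powr (- 1 - q)) * indicator {l..} s
      \<le> (\<integral>\<^sup>+ t. ?f s t \<partial>lborel)"
    proof (cases "l \<le> s")
      case True
      then have s: "0 < s" using l by simp
      have "young_dual A s * ennreal (s powr (- 1 - q))
        \<le> ennreal s * (\<integral>\<^sup>+ t. indicator {t. 0 < t \<and> A t / t < s} t \<partial>lborel) * ennreal (s powr (- 1 - q))"
        by (intro mult_right_mono young_conj_le_sublevel A s) simp
      also have "\<dots> = ennreal (s * s powr (- 1 - q)) * (\<integral>\<^sup>+ t. indicator {t. 0 < t \<and> A t / t < s} t \<partial>lborel)"
        using s by (simp add: ennreal_mult mult_ac)
      also have "s * s powr (- 1 - q) = s powr - q"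
        using s powr_add[of s 1 "- 1 - q"] by simp
      also have "ennreal (s powr - q) * (\<integral>\<^sup>+ t. indicator {t. 0 < t \<and> A t / t < s} t \<partial>lborel)
         \<le> ennreal (s powr - q) * (\<integral>\<^sup>+ t. (indicator {0<..} t * (if \<alpha> t \<le> s then 1 else 0)) \<partial>lborel)"
        by (intro mult_left_mono nn_integral_mono) (auto simp: \<alpha>_def split: split_indicator)
      also have "\<dots> = (\<integral>\<^sup>+ t. ?f s t \<partial>lborel)"
        using True by (subst nn_integral_cmult[symmetric]) auto
      finally show ?thesis using True by simp
    qed auto
  qed
  also have "\<dots> = (\<integral>\<^sup>+ t. (\<integral>\<^sup>+ s. ?f s t \<partial>lborel) \<partial>lborel)"
    by (rule lborel_pair.Fubini') measurable
  also have "\<dots> \<le> (\<integral>\<^sup>+ t. indicator {0<..} t * ennreal (max l (\<alpha> t) powr (1 - q) / (q - 1)) \<partial>lborel)"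
  proof (intro nn_integral_mono)
    fix t
    have "(\<integral>\<^sup>+ s. ?f s t \<partial>lborel) = indicator {0<..} t * (\<integral>\<^sup>+ s. ennreal (s powr - q) * indicator {max l (\<alpha> t)..} s \<partial>lborel)"
      by (subst nn_integral_cmult[symmetric]) (auto intro!: nn_integral_cong split: split_indicator)
    also have "\<dots> = indicator {0<..} t * ennreal (max l (\<alpha> t) powr (1 - q) / (q - 1))"
      using l n'1(2) by (subst nn_integral_powr_tail) auto
    finally show "(\<integral>\<^sup>+ s. ?f s t \<partial>lborel) \<le> indicator {0<..} t * ennreal (max l (\<alpha> t) powr (1 - q) / (q - 1))" by simp
  qed
  also have "\<dots> < \<infinity>"
  proof -
    obtain a where a: "a > 0" and fin: "(\<integral>\<^sup>+ t\<in>{a..}. ennreal ((t / A t) powr (q - 1)) \<partial>lborel) < \<infinity>"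
      using C1 n by (auto simp: cond_C1_def n'1)
    \<comment> \<open>The integral is split at the point \<open>a\<close> from (C1): up to
      \<open>a\<close> the maximum is bounded below by \<open>l\<close>, beyond \<open>a\<close> by
      \<open>A t / t\<close>.\<close>
    let ?c = "1 / (q - 1)"
    have c: "0 \<le> ?c" using n'1(2) by simp
    have "(\<integral>\<^sup>+ t. indicator {0<..} t * ennreal (max l (\<alpha> t) powr (1 - q) / (q - 1)) \<partial>lborel)
      \<le> (\<integral>\<^sup>+ t. ennreal (l powr (1 - q) * ?c) * indicator {0..a} t
           + ennreal ?c * (ennreal ((t / A t) powr (q - 1)) * indicator {a..} t) \<partial>lborel)"
    proof (intro nn_integral_mono)
      fix t
      have 1: "max l (\<alpha> t) powr (1 - q) \<le> l powr (1 - q)"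
        using l n'1(2) by (intro powr_mono2') auto
      have 2: "max l (A t / t) powr (1 - q) \<le> (t / A t) powr (q - 1)" if "0 < t"
      proof -
        have "max l (A t / t) powr (1 - q) \<le> (A t / t) powr (1 - q)"
          using l n'1(2) that Apos[OF that] by (intro powr_mono2') auto
        also have "\<dots> = (t / A t) powr (q - 1)"
          using that Apos[OF that] powr_minus_divide[of "A t / t" "q - 1"] powr_divide[of t "A t" "q - 1"] powr_divide[of "A t" t "q - 1"]
          by simp
        finally show ?thesis by simp
      qed
      show "indicator {0<..} t * ennreal (max l (\<alpha> t) powr (1 - q) / (q - 1))
        \<le> ennreal (l powr (1 - q) * ?c) * indicator {0..a} t
           + ennreal ?c * (ennreal ((t / A t) powr (q - 1)) * indicator {a..} t)"
      proof (cases "t \<le> a")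
        case True
        have "indicator {0<..} t * ennreal (max l (\<alpha> t) powr (1 - q) / (q - 1))
          \<le> ennreal (l powr (1 - q) * ?c) * indicator {0..a} t"
          using True mult_right_mono[OF 1 c] by (auto split: split_indicator intro!: ennreal_leI)
        then show ?thesis by (rule order_trans) simp
      next
        case False
        then have "t > 0" using a by simp
        have "ennreal (max l (\<alpha> t) powr (1 - q) / (q - 1)) \<le> ennreal ?c * ennreal ((t / A t) powr (q - 1))"
          using mult_right_mono[OF 2[OF \<open>t > 0\<close>] c] c \<open>t > 0\<close>
          by (subst ennreal_mult[symmetric]) (auto intro!: ennreal_leI simp: mult.commute \<alpha>_def)
        then show ?thesis using False \<open>t > 0\<close> by simp
      qed
    qed
    also have "\<dots> = (\<integral>\<^sup>+ t. ennreal (l powr (1 - q) * ?c) * indicator {0..a} t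
           + ennreal ?c * (ennreal ((1 / \<alpha> t) powr (q - 1)) * indicator {a..} t) \<partial>lborel)"
      using a by (auto simp: \<alpha>_def intro!: nn_integral_cong split: split_indicator)
    also have "\<dots> = ennreal (l powr (1 - q) * ?c) * ennreal a
        + ennreal ?c * (\<integral>\<^sup>+ t. ennreal ((1 / \<alpha> t) powr (q - 1)) * indicator {a..} t \<partial>lborel)"
      using a by (subst nn_integral_add) (auto simp: nn_integral_cmult)
    also have "(\<integral>\<^sup>+ t. ennreal ((1 / \<alpha> t) powr (q - 1)) * indicator {a..} t \<partial>lborel)
       = (\<integral>\<^sup>+ t\<in>{a..}. ennreal ((t / A t) powr (q - 1)) \<partial>lborel)"
      using a by (auto simp: \<alpha>_def intro!: nn_integral_cong split: split_indicator)
    also have "ennreal (l powr (1 - q) * ?c) * ennreal a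
        + ennreal ?c * (\<integral>\<^sup>+ t\<in>{a..}. ennreal ((t / A t) powr (q - 1)) \<partial>lborel) < \<infinity>"
      using fin by (simp add: ennreal_mult_less_top)
    finally show ?thesis .
  qed
  finally show ?thesis .
qed

lemma young_tail_split:
  assumes "x \<le> y"
  shows "young_tail n A x = (\<integral>\<^sup>+ s\<in>{x..<y}. young_dual A s *
     ennreal (s powr (- 1 - real n / (real n - 1))) \<partial>lborel) + young_tail n A y"
  unfolding young_tail_def
  using assms by (subst nn_integral_add[symmetric]) (auto intro!: nn_integral_cong split: split_indicator)

text \<open>The conjugate is smallest at the left end and the negative power is smallest at the
  right end. This single lower bound serves both the strict growth of the scaled inverse and the
  comparison of dyadic shells with the tail.\<close>

lemma young_tail_piece_ge:
  assumes "0 < x" "x \<le> y" "2 \<le> n"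
  shows "young_dual A x * ennreal ((y - x) * y powr (- 1 - real n / (real n - 1)))
    \<le> (\<integral>\<^sup>+ s\<in>{x..<y}. young_dual A s *
     ennreal (s powr (- 1 - real n / (real n - 1))) \<partial>lborel)"
proof -
  let ?q = "- 1 - real n / (real n - 1)"
  have "0 \<le> real n / (real n - 1)" using assms by simp
  then have q: "?q \<le> 0" by linarith
  have "young_dual A x * ennreal ((y - x) * y powr ?q)
     = (\<integral>\<^sup>+ s\<in>{x..<y}. young_dual A x * ennreal (y powr ?q) \<partial>lborel)"
    using assms by (subst nn_integral_cmult_indicator) (auto simp: ennreal_mult mult_ac)
  also have "\<dots> \<le> (\<integral>\<^sup>+ s\<in>{x..<y}. young_dual A s * ennreal (s powr ?q) \<partial>lborel)"
  proof (intro nn_integral_mono)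
    fix s
    show "young_dual A x * ennreal (y powr ?q) * indicator {x..<y} s
      \<le> young_dual A s * ennreal (s powr ?q) * indicator {x..<y} s"
    proof (cases "s \<in> {x..<y}")
      case True
      then show ?thesis
        using assms q by (intro mult_mono young_conj_mono ennreal_leI powr_mono2') auto
    qed simp
  qed
  finally show ?thesis .
qed

text \<open>If all slopes exceeded \<open>e\<close>, then \<open>t / A t\<close> would stay below
  \<open>1 / e\<close>, which contradicts divergence of either form of (C3). Thus \<open>A\<close>
  has slope 0 at the origin; only this consequence of (C3) is used afterwards.\<close>

lemma cond_C3_small_slope:
  fixes A :: "real \<Rightarrow> real" and e :: real
  assumes A: "young_fun A" and C3: "cond_C3 n A" and n: "1 \<le> n" and e: "0 < e"
  shows "\<exists>\<tau>>0. A \<tau> \<le> e * \<tau>"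
proof (rule ccontr)
  assume "\<not> (\<exists>\<tau>>0. A \<tau> \<le> e * \<tau>)"
  then have big: "e * t < A t" if "0 < t" for t using that by force
  have small: "t / A t \<le> 1 / e" if "0 < t" for t
  proof -
    have "0 < A t" using big[OF that] mult_pos_pos[OF e that] by linarith
    then show ?thesis using big[OF that] e by (simp add: pos_divide_le_eq) (simp add: field_simps)
  qed
  show False
  proof (cases "n = 1")
    case True
    then have "\<forall>\<^sub>F t in at_right 0. t / A t \<ge> 1 / e + 1"
      using C3 by (auto simp: cond_C3_def filterlim_at_top)
    moreover have "\<forall>\<^sub>F t in at_right (0::real). 0 < t" by (simp add: eventually_at_right_less)
    ultimately have "\<forall>\<^sub>F t in at_right (0::real). False"
      by eventually_elim (use small in fastforce)
    then show False by simp
  next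
    case False
    then have n: "2 \<le> n" using n by simp
    let ?p = "1 / (real n - 1)"
    have "(\<integral>\<^sup>+ t\<in>{0<..1}. ennreal ((t / A t) powr ?p) \<partial>lborel)
      \<le> (\<integral>\<^sup>+ t\<in>{0<..1::real}. ennreal ((1 / e) powr ?p) \<partial>lborel)"
    proof (intro nn_integral_mono)
      fix t :: real
      show "ennreal ((t / A t) powr ?p) * indicator {0<..1} t \<le> ennreal ((1 / e) powr ?p) * indicator {0<..1} t"
        using n small[of t] young_fun_nonneg[OF A, of t]
        by (auto split: split_indicator intro!: ennreal_leI powr_mono2)
    qed
    also have "(\<integral>\<^sup>+ t\<in>{0<..1::real}. ennreal ((1 / e) powr ?p) \<partial>lborel) < top"
      by (subst nn_integral_cmult_indicator) (auto simp: ennreal_mult_less_top)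
    finally have "(\<integral>\<^sup>+ t\<in>{0<..1}. ennreal ((t / A t) powr ?p) \<partial>lborel) \<noteq> top" by simp
    then show False using C3 False unfolding cond_C3_def by auto
  qed
qed

text \<open>A conjugate is a supremum of affine functions of \<open>t\<close>, so a sublevel set is
  an intersection of half-lines. Dividing by \<open>l\<close> shows that its largest element is the
  infimum of \<open>(M + E l) / l\<close>.\<close>

lemma young_conj_le_iff:
  assumes "0 \<le> M" "\<And>l. 0 < l \<Longrightarrow> E l < \<infinity>" "E 0 = 0"
  shows "young_conj E t \<le> ennreal M \<longleftrightarrow> (\<forall>l>0. l * t \<le> M + enn2real (E l))"
proof -
  have "young_conj E t \<le> ennreal M \<longleftrightarrow> (\<forall>l\<in>{0..}. ennreal (l * t - enn2real (E l)) \<le> ennreal M)"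
    unfolding young_conj_def SUP_le_iff
  proof (intro ball_cong refl)
    fix l :: real assume "l \<in> {0..}"
    then have "E l \<noteq> \<infinity>" using assms(2)[of l] assms(3) by (cases "l = 0") auto
    then show "((if E l = \<infinity> then 0 else ennreal (l * t - enn2real (E l))) \<le> ennreal M)
       = (ennreal (l * t - enn2real (E l)) \<le> ennreal M)" by simp
  qed
  also have "\<dots> \<longleftrightarrow> (\<forall>l>0. l * t \<le> M + enn2real (E l))"
  proof (intro iffI allI impI ballI)
    fix l :: real assume *: "\<forall>l\<in>{0..}. ennreal (l * t - enn2real (E l)) \<le> ennreal M" and "0 < l"
    from *[rule_format, of l] \<open>0 < l\<close> show "l * t \<le> M + enn2real (E l)"
      using assms(1) by simp
  next
    fix l :: real assume *: "\<forall>l>0. l * t \<le> M + enn2real (E l)" and "l \<in> {0..}"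
    then show "ennreal (l * t - enn2real (E l)) \<le> ennreal M"
      using assms(1,3) *[rule_format, of l] by (cases "l = 0") (auto simp: algebra_simps)
  qed
  finally show ?thesis .
qed

text \<open>The function whose conjugate is \<open>B\<close>, with real values. Under (C1)
  \<open>enn2real\<close> loses nothing for \<open>l > 0\<close>; at 0 the tail may be infinite, but
  the power in front vanishes.\<close>

definition young_B_predual :: "nat \<Rightarrow> (real \<Rightarrow> real) \<Rightarrow> real \<Rightarrow> real" where
  "young_B_predual n A l = l powr (real n / (real n - 1)) * enn2real (young_tail n A l)"

lemma young_B_le_iff:
  assumes n: "2 \<le> n" and A: "young_fun A" and C1: "cond_C1 n A" and C2: "cond_C2 A" and "0 \<le> M"
  shows "young_B n A t \<le> ennreal M \<longleftrightarrow> (\<forall>l>0. l * t \<le> M + young_B_predual n A l)"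
  unfolding young_B_ge2[OF n] using young_tail_finite[OF n A C1 C2] \<open>0 \<le> M\<close>
  by (subst young_conj_le_iff) (auto simp: young_B_predual_def enn2real_mult ennreal_mult_less_top)

text \<open>With \<^term>\<open>l = \<mu> / r ^ (n - 1)\<close> the powers of \<^term>\<open>r\<close> cancel in front of the tail integral,
  which makes the right-hand side visibly increasing in \<^term>\<open>r\<close>.\<close>
lemma young_B_scaled_le_iff:
  assumes n: "2 \<le> n" and A: "young_fun A" and C1: "cond_C1 n A" and C2: "cond_C2 A" and "0 \<le> m" "0 < r"
  shows "young_B n A (t / r) \<le> ennreal (m / r ^ n) \<longleftrightarrow>
    (\<forall>\<mu>>0. \<mu> * t \<le> m + \<mu> powr (real n / (real n - 1)) * enn2real (young_tail n A (\<mu> / r ^ (n - 1))))"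
proof -
  let ?q = "real n / (real n - 1)"
  define R where "R = r ^ (n - 1)"
  have R: "0 < R" using \<open>0 < r\<close> by (simp add: R_def)
  have rn: "r ^ n = R * r" using n by (metis R_def One_nat_def Suc_pred less_le_trans pos2 power_Suc2)
  \<comment> \<open>The exponents are matched: \<open>(n - 1) * (n / (n - 1)) = n\<close>, so the
    power of \<open>R\<close> is exactly \<open>r ^ n\<close>.\<close>
  have pw: "R powr ?q = R * r"
  proof -
    have "R powr ?q = r powr (real (n - 1) * ?q)"
      using \<open>0 < r\<close> unfolding R_def by (simp add: powr_powr flip: powr_realpow)
    also have "real (n - 1) * ?q = real n" using n by (simp add: of_nat_diff)
    finally show ?thesis using \<open>0 < r\<close> by (simp add: powr_realpow rn)
  qed
  have eq: "(\<mu> / R) * (t / r) \<le> m / (R * r) + young_B_predual n A (\<mu> / R) \<longleftrightarrow>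
     \<mu> * t \<le> m + \<mu> powr ?q * enn2real (young_tail n A (\<mu> / R))" if "0 < \<mu>" for \<mu>
  proof -
    have "(\<mu> / R) * (t / r) = \<mu> * t / (R * r)" by simp
    moreover have "young_B_predual n A (\<mu> / R) = \<mu> powr ?q * enn2real (young_tail n A (\<mu> / R)) / (R * r)"
      using that R by (simp add: young_B_predual_def powr_divide pw)
    moreover have "0 < R * r" using R \<open>0 < r\<close> by simp
    ultimately show ?thesis
      by (simp only: add_divide_distrib[symmetric] divide_le_cancel) auto
  qed
  have "0 \<le> m / (R * r)" using assms R by simp
  note young_B_le_iff[OF n A C1 C2 this, of "t / r"]
  also have "(\<forall>l>0. l * (t / r) \<le> m / (R * r) + young_B_predual n A l) \<longleftrightarrow>
      (\<forall>\<mu>>0. (\<mu> / R) * (t / r) \<le> m / (R * r) + young_B_predual n A (\<mu> / R))"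
  proof (intro iffI allI impI)
    fix l :: real
    assume *: "\<forall>\<mu>>0. (\<mu> / R) * (t / r) \<le> m / (R * r) + young_B_predual n A (\<mu> / R)" and "0 < l"
    then show "l * (t / r) \<le> m / (R * r) + young_B_predual n A l"
      using *[rule_format, of "l * R"] \<open>0 < l\<close> R by simp
  next
    fix \<mu> :: real
    assume *: "\<forall>l>0. l * (t / r) \<le> m / (R * r) + young_B_predual n A l" and "0 < \<mu>"
    then show "(\<mu> / R) * (t / r) \<le> m / (R * r) + young_B_predual n A (\<mu> / R)"
      using *[rule_format, of "\<mu> / R"] R by simp
  qed
  also have "\<dots> \<longleftrightarrow> (\<forall>\<mu>>0. \<mu> * t \<le> m + \<mu> powr ?q * enn2real (young_tail n A (\<mu> / R)))"
    using eq by blast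
  finally show ?thesis unfolding rn R_def .
qed

lemma young_B_one: "young_B 1 A t = ennreal (A t)"
  by (simp add: young_B_def)

lemma young_fun_eventually_large:
  assumes A: "young_fun A"
  obtains T where "0 < T" "\<And>t. 0 \<le> t \<Longrightarrow> A t \<le> M \<Longrightarrow> t \<le> T"
proof -
  obtain t0 where t0: "0 < t0" "0 < A t0"
    using A by (auto simp: young_fun_def) (metis less_eq_real_def)
  show ?thesis
  proof (rule that[of "max t0 (M * t0 / A t0)"])
    fix t assume t: "0 \<le> t" "A t \<le> M"
    show "t \<le> max t0 (M * t0 / A t0)"
    proof (cases "t \<le> t0")
      case False
      then have "A t0 / t0 \<le> A t / t" using young_fun_ratio_mono[OF A t0(1)] by simp
      then have "t * A t0 \<le> A t * t0" using t0 False by (simp add: field_simps)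
      also have "\<dots> \<le> M * t0" using t t0 by simp
      finally show ?thesis using t0 by (simp add: field_simps le_max_iff_disj)
    qed auto
  qed (use t0 in auto)
qed

text \<open>The sublevel set of \<open>B\<close> contains 0, is bounded, closed and downward closed,
  so its supremum is attained and it is the interval from 0 to that point. For
  \<open>n \<ge> 2\<close> closedness is free, the set being an intersection of half-lines; for
  \<open>n = 1\<close> it comes from continuity of \<open>A\<close>.\<close>

lemma young_inv_ge_iff:
  assumes n: "1 \<le> n" and A: "young_fun A" and C1: "cond_C1 n A" and C2: "cond_C2 A" and M: "0 \<le> M" and t: "0 \<le> t"
  shows "t \<le> young_inv (young_B n A) M \<longleftrightarrow> young_B n A t \<le> ennreal M"
proof -
  let ?S = "{t. 0 \<le> t \<and> young_B n A t \<le> ennreal M}"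
  consider "n = 1" | "2 \<le> n" using n by linarith
  then have "0 \<in> ?S \<and> bdd_above ?S \<and> closed ?S \<and> (\<forall>s\<in>?S. \<forall>t. 0 \<le> t \<longrightarrow> t \<le> s \<longrightarrow> t \<in> ?S)"
  proof cases
    case 1
    have S: "?S = {t \<in> {0..}. A t \<le> M}"
      using 1 M young_B_one[of A] by auto
    have A0: "A 0 = 0" using A by (simp add: young_fun_def)
    have "bdd_above ?S" using young_fun_eventually_large[OF A, of M] unfolding S bdd_above_def by (metis (mono_tags, lifting) atLeast_iff mem_Collect_eq)
    \<comment> \<open>Convexity gives continuity in the interior only. At 0 it follows from
      \<open>0 \<le> A t \<le> t * A 1\<close>.\<close>
    moreover have "continuous_on {0..} A"
      unfolding continuous_on_eq_continuous_within
    proof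
      fix x :: real assume x: "x \<in> {0..}"
      show "continuous (at x within {0..}) A"
      proof (cases "x = 0")
        case False
        have "continuous_on {0<..} A"
          using A by (intro convex_on_continuous) (auto simp: young_fun_def intro: convex_on_subset)
        then have "continuous (at x) A"
          using False x by (simp add: continuous_on_eq_continuous_at)
        then show ?thesis by (rule continuous_at_imp_continuous_within)
      next
        case True
        have lim: "((\<lambda>t. t * A 1) \<longlongrightarrow> 0) (at 0 within {0..})"
          using tendsto_mult_right[OF tendsto_ident_at[of 0 "{0..}"], of "A 1"] by simp
        have "(A \<longlongrightarrow> 0) (at 0 within {0..})"
        proof (rule Lim_null_comparison[OF _ lim])
          have "norm (A t) \<le> t * A 1" if "t \<in> {0..}" "dist t 0 < 1" for t
            using young_fun_scale[OF A, of t 1] young_fun_nonneg[OF A, of t] that by (auto simp: dist_real_def)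
          then show "\<forall>\<^sub>F t in at 0 within {0..}. norm (A t) \<le> t * A 1"
            unfolding eventually_at by (intro exI[of _ 1]) auto
        qed
        then show ?thesis using True A0 by (simp add: continuous_within)
      qed
    qed
    then have "closed ?S"
      unfolding S by (intro continuous_on_closed_Collect_le continuous_on_const) auto
    ultimately show ?thesis
      using young_fun_mono[OF A] M A0 unfolding S by force
  next
    case 2
    note iff = young_B_le_iff[OF 2 A C1 C2 M]
    have S: "?S = {0..} \<inter> (\<Inter>l\<in>{0<..}. {t. l * t \<le> M + young_B_predual n A l})"
      using iff by auto
    have "bdd_above ?S"
      unfolding S by (rule bdd_aboveI[of _ "M + young_B_predual n A 1"]) (auto dest: bspec[of _ _ 1])
    moreover have "closed ?S"
      unfolding S by (intro closed_Int closed_INT ballI closed_atLeast closed_Collect_le continuous_intros)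
    moreover have "0 \<le> young_B_predual n A l" for l by (simp add: young_B_predual_def)
    ultimately show ?thesis
      unfolding S using M by (auto intro: order_trans[OF mult_left_mono] simp: less_imp_le)
  qed
  note P = this
  have "Sup ?S \<in> ?S"
    using P by (intro closed_contains_Sup) auto
  note Sup_in = this
  show ?thesis unfolding young_inv_def
  proof
    assume "t \<le> Sup ?S"
    then have "t \<in> ?S" using P Sup_in t by blast
    then show "young_B n A t \<le> ennreal M" by simp
  next
    assume "young_B n A t \<le> ennreal M"
    then have "t \<in> ?S" using t by simp
    then show "t \<le> Sup ?S" using P by (intro cSup_upper) auto
  qed
qed

section \<open>The gauge J\<close>

text \<open>By (C3) some \<open>\<tau>\<close> has at most half the slope of
  \<open>w = \<theta> * v\<close>, so \<open>\<tau> < w\<close> and the point of the graph over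
  \<open>\<tau>\<close> lies strictly below the chord from the origin to \<open>v\<close>. Since
  \<open>w\<close> lies between \<open>\<tau>\<close> and \<open>v\<close>, convexity carries the
  strictness to \<open>w\<close>.\<close>

lemma young_fun_strict_scale:
  assumes A: "young_fun A" and C2: "cond_C2 A" and C3: "cond_C3 n A" and n: "1 \<le> n"
    and \<theta>: "0 < \<theta>" "\<theta> < 1" and v: "0 < v"
  shows "A (\<theta> * v) < \<theta> * A v"
proof -
  define w where "w = \<theta> * v"
  have w: "0 < w" "w < v" using \<theta> v by (auto simp: w_def)
  have Aw: "0 < A w" using C2 w by (simp add: cond_C2_def)
  obtain \<tau> where \<tau>: "0 < \<tau>" "A \<tau> \<le> A w / (2 * w) * \<tau>"
    using cond_C3_small_slope[OF A C3 n, of "A w / (2 * w)"] Aw w by auto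
  have slope: "A \<tau> / \<tau> < A w / w"
  proof -
    have "A \<tau> / \<tau> \<le> A w / (2 * w)" using \<tau> by (simp add: pos_divide_le_eq)
    also have "\<dots> < A w / w" using Aw w by (simp add: field_simps)
    finally show ?thesis .
  qed
  have \<tau>w: "\<tau> < w" using young_fun_ratio_mono[OF A w(1), of \<tau>] slope by linarith
  have slope': "A \<tau> < \<tau> * (A v / v)"
  proof -
    have "A \<tau> / \<tau> < A v / v" using slope young_fun_ratio_mono[OF A w(1), of v] w by simp
    then show ?thesis using \<tau> by (simp only: pos_divide_less_eq mult.commute)
  qed
  define \<eta> where "\<eta> = (w - \<tau>) / (v - \<tau>)"
  have \<eta>: "0 < \<eta>" "\<eta> < 1" using \<tau>w w by (auto simp: \<eta>_def)
  have weq: "w = (1 - \<eta>) * \<tau> + \<eta> * v"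
  proof -
    have "\<eta> * (v - \<tau>) = w - \<tau>" using \<tau>w w by (simp add: \<eta>_def)
    then show ?thesis by (simp add: algebra_simps)
  qed
  have "A w \<le> (1 - \<eta>) * A \<tau> + \<eta> * A v"
    using A convex_onD[of "{0..}" A \<eta> \<tau> v] \<eta> \<tau> v weq by (auto simp: young_fun_def)
  also have "\<dots> < (1 - \<eta>) * (\<tau> * (A v / v)) + \<eta> * A v"
    using slope' \<eta> by (intro add_strict_right_mono mult_strict_left_mono) auto
  also have "\<dots> = w * (A v / v)" unfolding weq using v by (simp add: field_simps)
  also have "\<dots> = \<theta> * A v" using v by (simp add: w_def)
  finally show ?thesis by (simp add: w_def)
qed

text \<open>In the scaled criterion for \<open>B\<close>, \<open>x\<close> stands for
  \<open>1 / r ^ (n - 1)\<close>. Passing from \<open>x\<close> down to \<open>x'\<close> enlarges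
  the tail by the piece between \<open>\<mu> * x'\<close> and \<open>\<mu> * x\<close>, where the
  conjugate is at least \<open>\<tau> * (\<mu> * x') - A \<tau>\<close>. All powers of
  \<open>\<mu>\<close> outside this factor cancel.\<close>

lemma young_tail_gap:
  assumes n: "2 \<le> n" and A: "young_fun A" and C1: "cond_C1 n A" and C2: "cond_C2 A"
    and x: "0 < x'" "x' < x" and \<mu>: "0 < \<mu>" and \<tau>: "0 \<le> \<tau>" "A \<tau> \<le> \<tau> * (\<mu> * x')"
  shows "\<mu> powr (real n / (real n - 1)) * enn2real (young_tail n A (\<mu> * x)) +
      (\<tau> * (\<mu> * x') - A \<tau>) * ((x - x') * x powr (- 1 - real n / (real n - 1)))
    \<le> \<mu> powr (real n / (real n - 1)) * enn2real (young_tail n A (\<mu> * x'))"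
proof -
  let ?q = "real n / (real n - 1)"
  let ?K = "(\<mu> * x - \<mu> * x') * (\<mu> * x) powr (- 1 - ?q)"
  have pos: "0 < \<mu> * x'" "0 < \<mu> * x" "\<mu> * x' \<le> \<mu> * x" using x \<mu> by auto
  have K: "0 \<le> ?K" using pos by simp
  have "ennreal (\<tau> * (\<mu> * x') - A \<tau>) \<le> young_dual A (\<mu> * x')"
    unfolding young_conj_def using \<tau> young_fun_nonneg[OF A, of \<tau>] by (intro SUP_upper2[of \<tau>]) auto
  then have "ennreal (\<tau> * (\<mu> * x') - A \<tau>) * ennreal ?K \<le> young_dual A (\<mu> * x') * ennreal ?K"
    by (intro mult_right_mono) auto
  also have "\<dots> \<le> (\<integral>\<^sup>+ s\<in>{\<mu> * x'..<\<mu> * x}. young_dual A s * ennreal (s powr (- 1 - ?q)) \<partial>lborel)"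
    by (rule young_tail_piece_ge[OF pos(1,3) n])
  finally have "ennreal (\<tau> * (\<mu> * x') - A \<tau>) * ennreal ?K + young_tail n A (\<mu> * x) \<le> young_tail n A (\<mu> * x')"
    unfolding young_tail_split[OF pos(3)] by (rule add_right_mono)
  then have "enn2real (ennreal (\<tau> * (\<mu> * x') - A \<tau>) * ennreal ?K + young_tail n A (\<mu> * x)) \<le> enn2real (young_tail n A (\<mu> * x'))"
    using young_tail_finite[OF n A C1 C2 pos(1)] by (intro enn2real_mono) auto
  then have le: "(\<tau> * (\<mu> * x') - A \<tau>) * ?K + enn2real (young_tail n A (\<mu> * x)) \<le> enn2real (young_tail n A (\<mu> * x'))"
    using young_tail_finite[OF n A C1 C2 pos(2)] \<tau> K
    by (subst (asm) enn2real_plus) (auto simp: enn2real_mult ennreal_mult_less_top)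
  have "\<mu> powr ?q * ?K = (x - x') * (\<mu> powr ?q * \<mu> * (\<mu> * x) powr (- 1 - ?q))"
    by (simp add: algebra_simps)
  also have "\<mu> powr ?q * \<mu> * (\<mu> * x) powr (- 1 - ?q) = x powr (- 1 - ?q)"
  proof -
    have "\<mu> powr ?q * \<mu> * (\<mu> powr (- 1 - ?q)) = \<mu> powr (?q + 1 + (- 1 - ?q))"
      using \<mu> by (simp only: powr_add powr_one)
    also have "\<dots> = 1" using \<mu> by simp
    finally show ?thesis using \<mu> x by (simp add: powr_mult)
  qed
  finally have "\<mu> powr ?q * ?K = (x - x') * x powr (- 1 - ?q)" .
  moreover have "\<mu> powr ?q * ((\<tau> * (\<mu> * x') - A \<tau>) * ?K + enn2real (young_tail n A (\<mu> * x))) \<le> \<mu> powr ?q * enn2real (young_tail n A (\<mu> * x'))"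
    using le by (intro mult_left_mono) auto
  ultimately show ?thesis
    by (simp add: distrib_left mult.left_commute[of "\<mu> powr ?q"] add.commute)
qed

lemma young_inv_nonneg:
  assumes "1 \<le> n" "young_fun A" "cond_C1 n A" "cond_C2 A" "0 \<le> M"
  shows "0 \<le> young_inv (young_B n A) M"
proof -
  consider "n = 1" | "2 \<le> n" using assms(1) by linarith
  then have "young_B n A 0 \<le> ennreal M"
  proof cases
    case 1
    then show ?thesis using young_B_one[of A 0] assms by (simp add: young_fun_def)
  next
    case 2
    then show ?thesis using assms by (simp add: young_B_le_iff young_B_predual_def)
  qed
  then show ?thesis using young_inv_ge_iff[OF assms, of 0] by simp
qed

text \<open>It suffices to find one \<open>t'\<close> above the value \<open>t\<close> at radius
  \<open>s\<close> that is still admissible at radius \<open>s'\<close>. For \<open>n = 1\<close>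
  strict scaling leaves room above \<open>t\<close>. For \<open>n \<ge> 2\<close> every
  \<open>\<mu>\<close> must leave room for one common increment: small \<open>\<mu>\<close> do so
  because of the constant \<open>m\<close>, the others because of
  \<open>young_tail_gap\<close>.\<close>

lemma young_inv_scaled_strict_mono:
  assumes n: "1 \<le> n" and A: "young_fun A" and C1: "cond_C1 n A" and C2: "cond_C2 A" and C3: "cond_C3 n A"
    and m: "0 < m" and s: "0 < s" "s < s'"
  shows "s * young_inv (young_B n A) (m / s ^ n) < s' * young_inv (young_B n A) (m / s' ^ n)"
proof -
  define t where "t = s * young_inv (young_B n A) (m / s ^ n)"
  have ms: "0 \<le> m / s ^ n" "0 \<le> m / s' ^ n" using m s by auto
  note nonneg = young_inv_nonneg[OF n A C1 C2 ms(1)]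
  have t0: "0 \<le> t" using nonneg s by (simp add: t_def)
  have Bt: "young_B n A (t / s) \<le> ennreal (m / s ^ n)"
    using young_inv_ge_iff[OF n A C1 C2 ms(1), of "t / s"] nonneg s by (simp add: t_def)
  have "\<exists>t'>t. young_B n A (t' / s') \<le> ennreal (m / s' ^ n)"
  proof -
    consider "n = 1" | "2 \<le> n" using n by linarith
    then show ?thesis
    proof cases
      case 1
      define v where "v = t / s"
      define \<theta> where "\<theta> = s / s'"
      have \<theta>: "0 < \<theta>" "\<theta> < 1" using s by (auto simp: \<theta>_def)
      have A1: "0 < A 1" using C2 by (simp add: cond_C2_def)
      have Av: "A v \<le> m / s" using Bt 1 young_B_one[of A "t / s"] m s by (simp add: v_def)
      have "0 < v"
      proof -
        \<comment> \<open>A positive point where \<open>A\<close> is at most \<open>m / s\<close>,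
          by scaling from 1; it shows that \<open>v\<close> is not 0, as strict scaling
          requires.\<close>
        let ?w = "min 1 (m / s / A 1)"
        have w: "0 < ?w" using A1 m s by simp
        have "A ?w \<le> ?w * A 1" using young_fun_scale[OF A, of ?w 1] w by simp
        also have "\<dots> \<le> m / s / A 1 * A 1" using A1 by (intro mult_right_mono) auto
        also have "\<dots> = m / s" using A1 by simp
        finally have "young_B n A ?w \<le> ennreal (m / s ^ n)" using 1 young_B_one[of A ?w] m s by simp
        then have "?w \<le> young_inv (young_B n A) (m / s ^ n)"
          using young_inv_ge_iff[OF n A C1 C2 ms(1), of ?w] w by simp
        then show ?thesis using w s by (simp add: v_def t_def)
      qed
      have "A (\<theta> * v) < \<theta> * A v" by (rule young_fun_strict_scale[OF A C2 C3 n \<theta> \<open>0 < v\<close>])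
      also have "\<dots> \<le> \<theta> * (m / s)" using Av \<theta> by (intro mult_left_mono) auto
      also have "\<dots> = m / s'" using s by (simp add: \<theta>_def)
      finally have lt: "A (\<theta> * v) < m / s'" .
      have Av0: "0 \<le> A v" using young_fun_nonneg[OF A] \<open>0 < v\<close> by simp
      \<comment> \<open>The gap in \<open>A (\<theta> * v) < m / s'\<close> allows moving a fraction
        \<open>\<eta>\<close> of the way from \<open>\<theta> * v\<close> to \<open>v\<close>. The
        denominator \<open>A v + 1\<close> is positive in any case.\<close>
      define \<eta> where "\<eta> = min 1 ((m / s' - A (\<theta> * v)) / (A v + 1))"
      have \<eta>: "0 < \<eta>" "\<eta> \<le> 1" using lt Av0 by (auto simp: \<eta>_def)
      have \<eta>A: "\<eta> * A v \<le> m / s' - A (\<theta> * v)"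
      proof -
        have "\<eta> * A v \<le> \<eta> * (A v + 1)" using \<eta> by simp
        also have "\<dots> \<le> (m / s' - A (\<theta> * v)) / (A v + 1) * (A v + 1)"
          using Av0 by (intro mult_right_mono) (auto simp: \<eta>_def)
        finally show ?thesis using Av0 by simp
      qed
      define w where "w = (1 - \<eta>) * (\<theta> * v) + \<eta> * v"
      have "A w \<le> (1 - \<eta>) * A (\<theta> * v) + \<eta> * A v"
        using A convex_onD[of "{0..}" A \<eta> "\<theta> * v" v] \<eta> \<theta> \<open>0 < v\<close> by (auto simp: young_fun_def w_def)
      also have "\<dots> \<le> 1 * A (\<theta> * v) + \<eta> * A v"
        using \<eta> young_fun_nonneg[OF A, of "\<theta> * v"] \<theta> \<open>0 < v\<close> by (intro add_right_mono mult_right_mono) auto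
      finally have Aw: "A w \<le> m / s'" using \<eta>A by simp
      have wgt: "\<theta> * v < w"
      proof -
        have "w - \<theta> * v = \<eta> * ((1 - \<theta>) * v)" by (simp add: w_def algebra_simps)
        also have "\<dots> > 0" using \<eta> \<theta> \<open>0 < v\<close> by simp
        finally show ?thesis by simp
      qed
      have "t = s' * (\<theta> * v)" using s by (simp add: \<theta>_def v_def)
      also have "\<dots> < s' * w" using wgt s by simp
      finally show ?thesis
        using 1 Aw m s young_B_one[of A w] by (intro exI[of _ "s' * w"]) auto
    next
      case 2
      let ?q = "real n / (real n - 1)"
      define x where "x = 1 / s ^ (n - 1)"
      define x' where "x' = 1 / s' ^ (n - 1)"
      have x: "0 < x'" "x' < x"
        using s 2 power_strict_mono[of s s' "n - 1"] by (auto simp: x_def x'_def frac_less2)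
      \<comment> \<open>For \<open>\<mu> \<le> a\<close> even \<open>t + 1\<close> is admissible,
        since \<open>\<mu> * (t + 1) \<le> m\<close>. This explains the cap 1 in the increment
        \<open>min 1 c\<close>.\<close>
      define a where "a = m / (t + 1)"
      have a: "0 < a" using m t0 by (simp add: a_def)
      \<comment> \<open>The slope of \<open>A\<close> at \<open>\<tau>\<close> is at most half of
        \<open>a * x'\<close>, hence of \<open>\<mu> * x'\<close> for all \<open>\<mu> > a\<close>.
        Half of \<open>\<tau> * (\<mu> * x')\<close> thus survives in the gap, which makes the gain
        at least \<open>\<mu> * c\<close> with \<open>c\<close> independent of
        \<open>\<mu>\<close>.\<close>
      obtain \<tau> where \<tau>: "0 < \<tau>" "A \<tau> \<le> a * x' / 2 * \<tau>"
        using cond_C3_small_slope[OF A C3 n, of "a * x' / 2"] a x by auto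
      define c where "c = \<tau> * x' / 2 * ((x - x') * x powr (- 1 - ?q))"
      have c: "0 < c" using \<tau> x by (simp add: c_def)
      have old: "\<mu> * t \<le> m + \<mu> powr ?q * enn2real (young_tail n A (\<mu> * x))" if "0 < \<mu>" for \<mu>
        using Bt that young_B_scaled_le_iff[OF 2 A C1 C2, of m s t] m s by (auto simp: x_def)
      have "\<mu> * (t + min 1 c) \<le> m + \<mu> powr ?q * enn2real (young_tail n A (\<mu> * x'))" if \<mu>: "0 < \<mu>" for \<mu>
      proof (cases "\<mu> \<le> a")
        case True
        have "\<mu> * (t + min 1 c) \<le> a * (t + 1)" using True \<mu> t0 c by (intro mult_mono) auto
        also have "\<dots> = m" using t0 by (simp add: a_def)
        finally show ?thesis by (rule order_trans) simp
      next
        case False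
        have A\<tau>: "A \<tau> \<le> \<tau> * (\<mu> * x') / 2"
        proof -
          have "A \<tau> \<le> a * (x' * \<tau> / 2)" using \<tau> by (simp add: mult_ac)
          also have "\<dots> \<le> \<mu> * (x' * \<tau> / 2)" using False x \<tau> by (intro mult_right_mono) auto
          finally show ?thesis by (simp add: mult_ac)
        qed
        have nn: "0 \<le> \<tau> * (\<mu> * x')" using \<tau> \<mu> x by simp
        have "\<mu> * c = \<tau> * (\<mu> * x') / 2 * ((x - x') * x powr (- 1 - ?q))" by (simp add: c_def)
        also have "\<dots> \<le> (\<tau> * (\<mu> * x') - A \<tau>) * ((x - x') * x powr (- 1 - ?q))"
          using A\<tau> x by (intro mult_right_mono) (auto simp: mult_ac)
        finally have "\<mu> * c + \<mu> powr ?q * enn2real (young_tail n A (\<mu> * x))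
            \<le> \<mu> powr ?q * enn2real (young_tail n A (\<mu> * x'))"
          using young_tail_gap[OF 2 A C1 C2 x \<mu>, of \<tau>] \<tau> A\<tau> nn by simp
        moreover have "\<mu> * (t + min 1 c) \<le> \<mu> * t + \<mu> * c"
          using \<mu> by (simp add: distrib_left[symmetric])
        ultimately show ?thesis using old[OF \<mu>] by linarith
      qed
      then have "young_B n A ((t + min 1 c) / s') \<le> ennreal (m / s' ^ n)"
        using young_B_scaled_le_iff[OF 2 A C1 C2, of m s' "t + min 1 c"] m s by (auto simp: x'_def)
      then show ?thesis using c by (intro exI[of _ "t + min 1 c"]) auto
    qed
  qed
  then obtain t' where t': "t < t'" "young_B n A (t' / s') \<le> ennreal (m / s' ^ n)" by blast
  then have "t' / s' \<le> young_inv (young_B n A) (m / s' ^ n)"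
    using young_inv_ge_iff[OF n A C1 C2 ms(2), of "t' / s'"] t0 s by simp
  then have "t' \<le> s' * young_inv (young_B n A) (m / s' ^ n)" using s by (simp add: pos_divide_le_eq mult.commute)
  then show ?thesis using t' by (simp add: t_def)
qed

section \<open>Properties of \<open>b\<close>, \<open>J\<close> and \<open>\<psi>\<close> for a
  fixed gauge\<close>

locale young_gauge =
  fixes n :: nat and A \<phi> :: "real \<Rightarrow> real"
  assumes n: "1 \<le> n" and A: "young_fun A" and C1: "cond_C1 n A" and C2: "cond_C2 A" and C3: "cond_C3 n A"
    and gauge: "gauge_fun n \<phi>"
begin

abbreviation "b \<equiv> young_inv (young_B n A)"
abbreviation "J \<equiv> gauge_J n A \<phi>"
abbreviation "\<psi> \<equiv> gauge_psi n A \<phi>"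

lemma phi_0: "\<phi> 0 = 0" and phi_pos: "0 < r \<Longrightarrow> 0 < \<phi> r"
  and phi_mono: "0 \<le> r \<Longrightarrow> r \<le> s \<Longrightarrow> \<phi> r \<le> \<phi> s"
  and phi_ratio: "0 < r \<Longrightarrow> r \<le> s \<Longrightarrow> \<phi> s / s ^ n \<le> \<phi> r / r ^ n"
  and phi_cont: "continuous_on {0..} \<phi>"
  using gauge by (auto simp: gauge_fun_def mono_on_def)

lemma phi_nonneg: "0 \<le> r \<Longrightarrow> 0 \<le> \<phi> r"
  using phi_pos[of r] phi_0 by (cases "r = 0") auto

lemma phi_scale:
  assumes "1 \<le> c" "0 \<le> r"
  shows "\<phi> (c * r) \<le> c ^ n * \<phi> r"
proof (cases "r = 0")
  case False
  then have "\<phi> (c * r) / (c * r) ^ n \<le> \<phi> r / r ^ n"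
    using phi_ratio[of r "c * r"] assms by simp
  then show ?thesis using False assms by (simp add: power_mult_distrib field_simps)
qed (use phi_0 in simp)

lemma b_nonneg: "0 \<le> M \<Longrightarrow> 0 \<le> b M"
  by (rule young_inv_nonneg[OF n A C1 C2])

lemma b_ge_iff: "0 \<le> M \<Longrightarrow> 0 \<le> t \<Longrightarrow> t \<le> b M \<longleftrightarrow> young_B n A t \<le> ennreal M"
  by (rule young_inv_ge_iff[OF n A C1 C2])

lemma b_mono:
  assumes "0 \<le> M" "M \<le> M'"
  shows "b M \<le> b M'"
proof -
  have "young_B n A (b M) \<le> ennreal M" using b_ge_iff[OF assms(1) b_nonneg[OF assms(1)]] by simp
  also have "\<dots> \<le> ennreal M'" using assms by (intro ennreal_leI)
  finally show ?thesis using b_ge_iff[of M' "b M"] assms b_nonneg by auto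
qed

lemma b_scaled_strict_mono: "0 < m \<Longrightarrow> 0 < s \<Longrightarrow> s < s' \<Longrightarrow> s * b (m / s ^ n) < s' * b (m / s' ^ n)"
  by (rule young_inv_scaled_strict_mono[OF n A C1 C2 C3])

text \<open>The step from \<open>s\<close> to \<open>s'\<close> is taken in two moves: enlarging the
  radius with \<open>\<phi> s\<close> held fixed is strict, and replacing \<open>\<phi> s\<close> by
  \<open>\<phi> s'\<close> can only help.\<close>

lemma J_strict_mono:
  assumes "0 \<le> s" "s < s'"
  shows "J s < J s'"
proof (cases "s = 0")
  case True
  \<comment> \<open>Strictness needs a positive smaller radius; half of \<open>s'\<close> serves,
    and its value is known to be nonnegative.\<close>
  have "0 \<le> (s' / 2) * b (\<phi> s' / (s' / 2) ^ n)"
    using assms phi_pos[of s'] by (intro mult_nonneg_nonneg b_nonneg) auto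
  also have "\<dots> < s' * b (\<phi> s' / s' ^ n)"
    using assms phi_pos[of s'] by (intro b_scaled_strict_mono) auto
  finally show ?thesis using True assms by (simp add: gauge_J_def)
next
  case False
  then have s: "0 < s" using assms by simp
  have "s * b (\<phi> s / s ^ n) < s' * b (\<phi> s / s' ^ n)"
    using assms s phi_pos[of s] by (intro b_scaled_strict_mono) auto
  also have "\<dots> \<le> s' * b (\<phi> s' / s' ^ n)"
    using assms s phi_pos[of s] phi_mono[of s s'] by (intro mult_left_mono b_mono divide_right_mono) auto
  finally show ?thesis using s assms by (simp add: gauge_J_def)
qed

lemma J_0: "J 0 = 0"
  by (simp add: gauge_J_def)

lemma J_nonneg: "0 \<le> s \<Longrightarrow> 0 \<le> J s"
  using J_strict_mono[of 0 s] J_0 by (cases "s = 0") auto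

text \<open>\<open>\<psi>\<close> is defined through \<open>the_inv_into\<close>, which is
  informative on the range of \<open>J\<close> only. Evaluating it exactly at values of
  \<open>J\<close> avoids any discussion of surjectivity.\<close>

lemma psi_J:
  assumes "0 \<le> R"
  shows "\<psi> (J R) = \<phi> R"
proof -
  have "inj_on J {0..}"
    by (intro inj_onI) (metis J_strict_mono atLeast_iff less_irrefl linorder_less_linear)
  then show ?thesis using assms by (simp add: gauge_psi_def the_inv_into_f_f)
qed

lemma psi_0: "\<psi> 0 = 0"
  using psi_J[of 0] by (simp add: J_0 phi_0)

text \<open>The factor \<open>c\<close> is moved into the radius, with the mass multiplied by
  \<open>c ^ n\<close> so that the argument of \<open>b\<close> is unchanged. Then the mass is
  raised to \<open>\<phi> R\<close> and the radius to \<open>R\<close>, both of which increase the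
  expression.\<close>

lemma scaled_b_le_J:
  assumes "0 \<le> m" "0 < r" "1 \<le> c" "c ^ n * m \<le> \<phi> R" "c * r \<le> R"
  shows "c * (r * b (m / r ^ n)) \<le> J R"
proof -
  have cr: "0 < c * r" using assms by simp
  have pR: "0 < \<phi> R" using phi_pos[of R] assms cr by linarith
  have "c * (r * b (m / r ^ n)) = (c * r) * b ((c ^ n * m) / (c * r) ^ n)"
    using assms by (simp add: power_mult_distrib)
  also have "\<dots> \<le> (c * r) * b (\<phi> R / (c * r) ^ n)"
    using assms cr by (intro mult_left_mono b_mono divide_right_mono) auto
  also have "\<dots> \<le> R * b (\<phi> R / R ^ n)"
    using b_scaled_strict_mono[OF pR cr, of R] assms by (cases "c * r = R") auto
  also have "\<dots> = J R" using cr assms by (simp add: gauge_J_def)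
  finally show ?thesis .
qed

text \<open>Smallness of \<open>\<phi> R\<close> has to control \<open>J R\<close> although
  \<open>\<phi> R / R ^ n\<close> may be large. Enlarging the radius until the argument of
  \<open>b\<close> becomes \<open>\<phi> 1\<close> leaves a fixed multiple of that radius.\<close>

lemma J_small:
  assumes "0 < \<tau>"
  obtains \<eta> where "0 < \<eta>" "\<And>R. 0 \<le> R \<Longrightarrow> \<phi> R < \<eta> \<Longrightarrow> J R \<le> \<tau>"
proof -
  \<comment> \<open>The summand 1 keeps \<open>\<beta>\<close> positive, since it is used as a
    divisor.\<close>
  define \<beta> where "\<beta> = b (\<phi> 1) + 1"
  have \<beta>: "0 < \<beta>" using b_nonneg[of "\<phi> 1"] phi_pos[of 1] by (simp add: \<beta>_def)
  define \<eta> where "\<eta> = \<phi> 1 * min 1 ((\<tau> / \<beta>) ^ n)"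
  have p1: "0 < \<phi> 1" using phi_pos by simp
  show ?thesis
  proof (rule that[of \<eta>])
    show "0 < \<eta>" using p1 \<beta> assms by (simp add: \<eta>_def)
    fix R assume R: "0 \<le> R" "\<phi> R < \<eta>"
    show "J R \<le> \<tau>"
    proof (cases "R = 0")
      case False
      then have R0: "0 < R" using R by simp
      have "\<eta> \<le> \<phi> 1" using p1 by (simp add: \<eta>_def mult_le_cancel_left1)
      then have R1: "R \<le> 1" using phi_mono[of 1 R] R by force
      \<comment> \<open>The radius with \<open>\<phi> R / \<kappa> ^ n = \<phi> 1\<close>. It is at
        least \<open>R\<close> because \<open>\<phi> r / r ^ n\<close> is non-increasing and
        \<open>R \<le> 1\<close>.\<close>
      define \<kappa> where "\<kappa> = root n (\<phi> R / \<phi> 1)"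
      have pR: "0 < \<phi> R" using phi_pos R0 by simp
      have \<kappa>: "0 < \<kappa>" "\<kappa> ^ n = \<phi> R / \<phi> 1" using n pR p1 by (auto simp: \<kappa>_def)
      have "R ^ n \<le> \<kappa> ^ n"
        using phi_ratio[OF R0 R1] R0 p1 by (simp add: \<kappa> field_simps)
      then have R\<kappa>: "R \<le> \<kappa>" using n R0 \<kappa> power_mono_iff[of R \<kappa> n] by simp
      have "\<kappa> ^ n \<le> (\<tau> / \<beta>) ^ n"
      proof -
        have "\<phi> R \<le> \<phi> 1 * (\<tau> / \<beta>) ^ n" using R p1 unfolding \<eta>_def
          by (smt (verit) min.cobounded2 mult_left_mono)
        then show ?thesis using p1 by (simp add: \<kappa> pos_divide_le_eq mult.commute)
      qed
      then have \<kappa>\<tau>: "\<kappa> \<le> \<tau> / \<beta>" using n assms \<beta> \<kappa> power_mono_iff[of \<kappa> "\<tau> / \<beta>" n] by simp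
      have "J R = R * b (\<phi> R / R ^ n)" using R0 by (simp add: gauge_J_def)
      also have "\<dots> \<le> \<kappa> * b (\<phi> R / \<kappa> ^ n)"
        using b_scaled_strict_mono[OF pR R0, of \<kappa>] R\<kappa> by (cases "R = \<kappa>") auto
      also have "\<phi> R / \<kappa> ^ n = \<phi> 1" using pR p1 by (simp add: \<kappa>)
      also have "\<kappa> * b (\<phi> 1) \<le> (\<tau> / \<beta>) * \<beta>"
        using \<kappa>\<tau> \<kappa> b_nonneg[of "\<phi> 1"] p1 assms \<beta> by (intro mult_mono) (auto simp: \<beta>_def)
      finally show ?thesis using \<beta> by simp
    qed (use assms J_0 in simp)
  qed
qed

end

section \<open>Smooth bump functions\<close>

text \<open>One-variable counterpart of \<open>smooth_fun\<close>: a family closed under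
  differentiation replaces derivatives of all orders, so smoothness is proved by exhibiting such a
  family instead of by induction on the order.\<close>

definition smooth_real :: "(real \<Rightarrow> real) \<Rightarrow> bool" where
  "smooth_real f \<longleftrightarrow> (\<exists>F. f \<in> F \<and> (\<forall>g\<in>F. \<exists>h\<in>F. \<forall>x. (g has_real_derivative h x) (at x)))"

lemma smooth_real_deriv:
  assumes "smooth_real f"
  shows "\<exists>g. smooth_real g \<and> (\<forall>x. (f has_real_derivative g x) (at x))"
proof -
  from assms obtain F where F: "f \<in> F" "\<forall>g\<in>F. \<exists>h\<in>F. \<forall>x. (g has_real_derivative h x) (at x)"
    by (auto simp: smooth_real_def)
  then obtain h where "h \<in> F" "\<forall>x. (f has_real_derivative h x) (at x)" by blast
  then show ?thesis using F unfolding smooth_real_def by blast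
qed

lemma smooth_real_continuous: "smooth_real f \<Longrightarrow> continuous_on S f"
  using smooth_real_deriv[of f] DERIV_isCont continuous_at_imp_continuous_on by blast

text \<open>Adding the primitive to a family witnessing smoothness of its derivative keeps the
  family closed. It is needed for the primitive of a difference of two densities.\<close>

lemma smooth_real_antideriv:
  assumes "smooth_real g" "\<And>x. (f has_real_derivative g x) (at x)"
  shows "smooth_real f"
proof -
  from assms obtain F where "g \<in> F" "\<forall>g\<in>F. \<exists>h\<in>F. \<forall>x. (g has_real_derivative h x) (at x)"
    by (auto simp: smooth_real_def)
  then show ?thesis unfolding smooth_real_def using assms(2) by (intro exI[of _ "insert f F"]) auto
qed

lemma smooth_real_affine:
  assumes "smooth_real f"
  shows "smooth_real (\<lambda>x. c * f (a * x + b))"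
  unfolding smooth_real_def
proof (intro exI conjI ballI)
  let ?F = "{\<lambda>x. c * f (a * x + b) | c f. smooth_real f}"
  show "(\<lambda>x. c * f (a * x + b)) \<in> ?F" using assms by blast
  fix g assume "g \<in> ?F"
  then obtain c f where g: "g = (\<lambda>x. c * f (a * x + b))" and "smooth_real f" by blast
  then obtain f' where f': "smooth_real f'" "\<And>x. (f has_real_derivative f' x) (at x)"
    using smooth_real_deriv by blast
  have "(g has_real_derivative (c * a) * f' (a * x + b)) (at x)" for x
    unfolding g by (auto intro!: derivative_eq_intros DERIV_chain'[OF _ f'(2)])
  then show "\<exists>h\<in>?F. \<forall>x. (g has_real_derivative h x) (at x)"
    using f'(1) by (intro bexI[of _ "\<lambda>x. (c * a) * f' (a * x + b)"]) auto
qed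

lemma smooth_real_diff:
  assumes "smooth_real f" "smooth_real g"
  shows "smooth_real (\<lambda>x. f x - g x)"
  unfolding smooth_real_def
proof (intro exI conjI ballI)
  let ?F = "{\<lambda>x. f x - g x | f g. smooth_real f \<and> smooth_real g}"
  show "(\<lambda>x. f x - g x) \<in> ?F" using assms by blast
  fix h assume "h \<in> ?F"
  then obtain f g where h: "h = (\<lambda>x. f x - g x)" and "smooth_real f" "smooth_real g" by blast
  then obtain f' g' where "smooth_real f'" "\<And>x. (f has_real_derivative f' x) (at x)"
     "smooth_real g'" "\<And>x. (g has_real_derivative g' x) (at x)"
    using smooth_real_deriv by metis
  then show "\<exists>k\<in>?F. \<forall>x. (h has_real_derivative k x) (at x)"
    unfolding h by (intro bexI[of _ "\<lambda>x. f' x - g' x"]) (auto intro!: DERIV_diff)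
qed

text \<open>The derivative of a member of this family is again a member.\<close>
definition bump_term :: "real poly \<Rightarrow> nat \<Rightarrow> real \<Rightarrow> real" where
  "bump_term p k x = (if 0 < x \<and> x < 1
     then poly p x * (1 / (x * (1 - x))) ^ k * exp (- (1 / (x * (1 - x)))) else 0)"

lemma power_div_fact_le_exp:
  fixes w :: real
  assumes "0 \<le> w"
  shows "w ^ N / fact N \<le> exp w"
  using sum_le_suminf[OF summable_exp_generic[of w], of "{N}"] assms
  by (simp add: exp_def divide_inverse mult.commute)

text \<open>With \<open>w = 1 / (x * (1 - x))\<close>, one term of the exponential series gives
  \<open>w ^ (k + 2) \<le> fact (k + 2) * exp w\<close>, so the function is at most a multiple of
  \<open>1 / w\<^sup>2\<close>. Quadratic decay at both ends is what makes the derivative there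
  exist and vanish.\<close>

lemma bump_term_bound:
  obtains C where "\<And>x. \<bar>bump_term p k x\<bar> \<le> C * x\<^sup>2" "\<And>x. \<bar>bump_term p k x\<bar> \<le> C * (1 - x)\<^sup>2"
proof -
  have "bounded ((poly p) ` {0..1})"
    by (intro compact_imp_bounded compact_continuous_image continuous_intros) auto
  then obtain P where P: "0 < P" "\<forall>x\<in>{0..1}. \<bar>poly p x\<bar> \<le> P"
    by (auto simp: bounded_pos)
  let ?C = "P * fact (k + 2)"
  have *: "\<bar>bump_term p k x\<bar> \<le> ?C * (x * (1 - x))\<^sup>2" if "0 < x" "x < 1" for x
  proof -
    define w where "w = 1 / (x * (1 - x))"
    have w: "0 < w" using that by (simp add: w_def)
    have "w ^ (k + 2) \<le> fact (k + 2) * exp w"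
      using power_div_fact_le_exp[of w "k + 2"] w by (simp only: pos_divide_le_eq fact_gt_zero mult.commute)
    then have "w ^ k * exp (- w) \<le> fact (k + 2) / w\<^sup>2"
      using w by (simp add: exp_minus field_simps power_add power2_eq_square)
    moreover have "\<bar>bump_term p k x\<bar> = \<bar>poly p x\<bar> * (w ^ k * exp (- w))"
      using that w by (simp add: bump_term_def w_def[symmetric] abs_mult)
    ultimately have "\<bar>bump_term p k x\<bar> \<le> P * (fact (k + 2) / w\<^sup>2)"
      using P that w by (simp only:) (intro mult_mono, auto)
    also have "\<dots> = ?C * (x * (1 - x))\<^sup>2" by (simp add: w_def power_one_over)
    finally show ?thesis .
  qed
  show ?thesis
  proof (rule that[of ?C])
    fix x :: real
    have C: "0 \<le> ?C" using P by simp
    have 1: "(x * (1 - x))\<^sup>2 \<le> x\<^sup>2" if "0 < x" "x < 1"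
      using that by (intro power_mono) (auto simp: mult_le_cancel_left1)
    have 2: "(x * (1 - x))\<^sup>2 \<le> (1 - x)\<^sup>2" if "0 < x" "x < 1"
      using that by (intro power_mono) (auto simp: mult_le_cancel_right2)
    show "\<bar>bump_term p k x\<bar> \<le> ?C * x\<^sup>2"
    proof (cases "0 < x \<and> x < 1")
      case True
      then show ?thesis using order_trans[OF * mult_left_mono[OF 1 C]] by auto
    qed (use C in \<open>auto simp: bump_term_def intro!: mult_nonneg_nonneg\<close>)
    show "\<bar>bump_term p k x\<bar> \<le> ?C * (1 - x)\<^sup>2"
    proof (cases "0 < x \<and> x < 1")
      case True
      then show ?thesis using order_trans[OF * mult_left_mono[OF 2 C]] by auto
    qed (use C in \<open>auto simp: bump_term_def intro!: mult_nonneg_nonneg\<close>)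
  qed
qed

lemma DERIV_zero_of_quadratic_bound:
  fixes f :: "real \<Rightarrow> real"
  assumes "\<And>y. \<bar>f y\<bar> \<le> C * (y - x)\<^sup>2"
  shows "(f has_real_derivative 0) (at x)"
proof -
  have f0: "f x = 0" using assms[of x] by simp
  have "((\<lambda>h. f (x + h) / h) \<longlongrightarrow> 0) (at 0)"
  proof (rule Lim_null_comparison)
    show "\<forall>\<^sub>F h in at 0. norm (f (x + h) / h) \<le> \<bar>C\<bar> * \<bar>h\<bar>"
    proof (rule always_eventually, rule allI)
      fix h :: real
      show "norm (f (x + h) / h) \<le> \<bar>C\<bar> * \<bar>h\<bar>"
      proof (cases "h = 0")
        case False
        have "\<bar>f (x + h)\<bar> \<le> C * h\<^sup>2" using assms[of "x + h"] by simp
        also have "\<dots> \<le> \<bar>C\<bar> * h\<^sup>2" by (intro mult_right_mono) auto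
        also have "\<dots> = \<bar>C\<bar> * \<bar>h\<bar> * \<bar>h\<bar>" by (simp add: power2_eq_square)
        finally show ?thesis using False by (simp add: abs_divide pos_divide_le_eq)
      qed simp
    qed
    show "((\<lambda>h. \<bar>C\<bar> * \<bar>h\<bar>) \<longlongrightarrow> 0) (at 0)"
      by (auto intro!: tendsto_eq_intros)
  qed
  then show ?thesis unfolding DERIV_def by (simp add: f0)
qed

text \<open>Put \<open>u = x * (1 - x)\<close>, \<open>w = 1 / u\<close>,
  \<open>v = 1 - 2 * x\<close>, so that \<open>w\<close> has derivative
  \<open>- v * w\<^sup>2\<close>. The three terms of the product rule carry the powers
  \<open>k\<close>, \<open>k + 1\<close> and \<open>k + 2\<close> of \<open>w\<close>; multiplying
  the first two by powers of \<open>u\<close> brings all to \<open>k + 2\<close>, whence the new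
  polynomial.\<close>

lemma bump_term_deriv:
  "(bump_term p k has_real_derivative bump_term (pderiv p * [:0, 1, -1:]\<^sup>2
      - of_nat k * p * [:1, -2:] * [:0, 1, -1:] + p * [:1, -2:]) (k + 2) x) (at x)"
  (is "(_ has_real_derivative bump_term ?q _ _) _")
proof -
  obtain C where C: "\<And>x. \<bar>bump_term p k x\<bar> \<le> C * x\<^sup>2" "\<And>x. \<bar>bump_term p k x\<bar> \<le> C * (1 - x)\<^sup>2"
    using bump_term_bound by blast
  consider "0 < x \<and> x < 1" | "x = 0" | "x = 1" | "x < 0" | "x > 1" by linarith
  then show ?thesis
  proof cases
    case 1
    define u w v where "u = x * (1 - x)" and "w = 1 / (x * (1 - x))" and "v = 1 - 2 * x"
    have u: "x \<noteq> 0" "1 - x \<noteq> 0" using 1 by auto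
    have dw: "((\<lambda>x. 1 / (x * (1 - x))) has_real_derivative - v * w\<^sup>2) (at x)"
      using u unfolding w_def v_def
      by (auto intro!: derivative_eq_intros simp: power2_eq_square divide_simps)
    have "((\<lambda>x. poly p x * (1 / (x * (1 - x))) ^ k * exp (- (1 / (x * (1 - x))))) has_real_derivative
       bump_term ?q (k + 2) x) (at x)"
    proof -
      have dk: "((\<lambda>x. (1 / (x * (1 - x))) ^ k) has_real_derivative - (of_nat k * v * w ^ (k + 1))) (at x)"
      proof (cases k)
        case (Suc j)
        show ?thesis using DERIV_power[OF dw, of k] Suc
          by (simp add: power_add power2_eq_square mult_ac flip: w_def)
      qed simp
      have de: "((\<lambda>x. exp (- (1 / (x * (1 - x))))) has_real_derivative exp (- w) * (v * w\<^sup>2)) (at x)"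
        using DERIV_fun_exp[OF DERIV_minus[OF dw]] by (simp flip: w_def)
      note D = DERIV_mult[OF DERIV_mult[OF poly_DERIV[of p x] dk] de, folded w_def]
      have uw: "u * w = 1" using u by (simp add: u_def w_def)
      have "poly ?q x = poly (pderiv p) x * u\<^sup>2 - of_nat k * poly p x * v * u + poly p x * v"
        by (simp add: u_def v_def algebra_simps)
      then have "bump_term ?q (k + 2) x = (poly (pderiv p) x * u\<^sup>2 - of_nat k * poly p x * v * u + poly p x * v) * w ^ (k + 2) * exp (- w)"
        using 1 unfolding bump_term_def w_def by presburger
      also have "\<dots> = (poly (pderiv p) x * (u * w)\<^sup>2 * w ^ k - of_nat k * poly p x * v * (u * w) * w ^ (k + 1)
           + poly p x * v * w\<^sup>2 * w ^ k) * exp (- w)"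
        by (simp add: power_mult_distrib power_add power2_eq_square) (simp add: algebra_simps)
      finally have eq: "bump_term ?q (k + 2) x = (poly (pderiv p) x * w ^ k - of_nat k * poly p x * v * w ^ (k + 1)
           + poly p x * v * w\<^sup>2 * w ^ k) * exp (- w)"
        unfolding uw by simp
      show ?thesis
        by (rule DERIV_cong[OF D]) (simp only: eq, simp add: algebra_simps)
    qed
    then show ?thesis
    proof (rule has_field_derivative_transform_within_open[of _ _ _ "{0<..<1}"])
    qed (use 1 in \<open>auto simp: bump_term_def\<close>)
  next
    case 2
    then show ?thesis using DERIV_zero_of_quadratic_bound[of "bump_term p k" C 0] C by (simp add: bump_term_def)
  next
    case 3
    then show ?thesis using DERIV_zero_of_quadratic_bound[of "bump_term p k" C 1] C by (simp add: bump_term_def power2_commute)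
  next
    case 4
    have "(bump_term p k has_real_derivative 0) (at x)"
      by (rule has_field_derivative_transform_within_open[of "\<lambda>_. 0" _ _ "{..<0}"])
         (use 4 in \<open>auto simp: bump_term_def\<close>)
    then show ?thesis using 4 by (simp add: bump_term_def)
  next
    case 5
    have "(bump_term p k has_real_derivative 0) (at x)"
      by (rule has_field_derivative_transform_within_open[of "\<lambda>_. 0" _ _ "{1<..}"])
         (use 5 in \<open>auto simp: bump_term_def\<close>)
    then show ?thesis using 5 by (simp add: bump_term_def)
  qed
qed

lemma smooth_real_bump_term: "smooth_real (bump_term p k)"
  unfolding smooth_real_def
  by (rule exI[of _ "{bump_term p k | p k. True}"]) (use bump_term_deriv in blast)

text \<open>The unnormalised bump is at most the indicator of the unit interval, so its integral
  \<open>Z\<close> is at most 1. After division by \<open>Z\<close> the upper bound is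
  \<open>1 / Z\<close>, which accounts for \<open>1 \<le> D\<close>.\<close>

lemma bump_exists:
  obtains h :: "real \<Rightarrow> real" and D where "smooth_real h" "\<And>x. 0 \<le> h x" "\<And>x. h x \<le> D" "1 \<le> D"
    "\<And>x. x \<notin> {0..1} \<Longrightarrow> h x = 0" "(\<integral>\<^sup>+ x. ennreal (h x) \<partial>lborel) = 1"
proof -
  let ?g = "bump_term 1 0"
  have g: "0 \<le> ?g x" "?g x \<le> indicator {0..1} x" for x
    by (auto simp: bump_term_def split: split_indicator)
  have [measurable]: "?g \<in> borel_measurable borel"
    by (intro borel_measurable_continuous_onI smooth_real_continuous smooth_real_bump_term)
  define Z where "Z = enn2real (\<integral>\<^sup>+ x. ennreal (?g x) \<partial>lborel)"
  have le: "(\<integral>\<^sup>+ x. ennreal (?g x) \<partial>lborel) \<le> 1"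
  proof -
    have "(\<integral>\<^sup>+ x. ennreal (?g x) \<partial>lborel) \<le> (\<integral>\<^sup>+ x. indicator {0..1::real} x \<partial>lborel)"
      using g(2) by (intro nn_integral_mono) (metis ennreal_leI ennreal_indicator)
    then show ?thesis by simp
  qed
  then have Z: "(\<integral>\<^sup>+ x. ennreal (?g x) \<partial>lborel) = ennreal Z"
    unfolding Z_def by (subst ennreal_enn2real) (auto intro: le_less_trans)
  have "(\<integral>\<^sup>+ x. ennreal (?g x) \<partial>lborel) \<noteq> 0"
  proof
    assume "(\<integral>\<^sup>+ x. ennreal (?g x) \<partial>lborel) = 0"
    then have "AE x in lborel. ?g x \<le> 0" by (subst (asm) nn_integral_0_iff_AE) (auto simp: ennreal_eq_0_iff)
    then have "AE x in lborel. x \<notin> {0<..<1::real}"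
      by eventually_elim (auto simp: bump_term_def split: if_splits)
    then have "emeasure lborel {0<..<1::real} = 0" 
      by (intro null_setsD1) (simp add: AE_iff_null_sets del: greaterThanLessThan_iff)
    then show False by simp
  qed
  then have Zpos: "0 < Z" using Z by (metis ennreal_eq_0_iff linorder_not_less)
  have Z1: "Z \<le> 1" using le Zpos unfolding Z by simp
  show ?thesis
  proof (rule that[of "\<lambda>x. (1 / Z) * ?g (1 * x + 0)" "1 / Z"])
    show "smooth_real (\<lambda>x. (1 / Z) * ?g (1 * x + 0))" by (rule smooth_real_affine[OF smooth_real_bump_term])
    have "(\<integral>\<^sup>+ x. ennreal ((1 / Z) * ?g x) \<partial>lborel) = ennreal (1 / Z) * ennreal Z"
      using Zpos g by (simp add: ennreal_mult' nn_integral_cmult Z del: times_divide_eq_left)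
    then show "(\<integral>\<^sup>+ x. ennreal ((1 / Z) * ?g (1 * x + 0)) \<partial>lborel) = 1"
      using Zpos by (simp add: ennreal_mult[symmetric])
    fix x
    show "0 \<le> (1 / Z) * ?g (1 * x + 0)" using g Zpos by simp
    show "(1 / Z) * ?g (1 * x + 0) \<le> 1 / Z"
      using g(2)[of x] Zpos by (simp add: divide_right_mono indicator_le_1 order_trans)
    show "(1 / Z) * ?g (1 * x + 0) = 0" if "x \<notin> {0..1}" using that by (auto simp: bump_term_def)
    show "1 \<le> 1 / Z" using Z1 Zpos by simp
  qed
qed

text \<open>The distribution function of the density: any primitive, shifted to vanish at
  \<open>\<alpha>\<close>. It is constant outside the support, and the fundamental theorem
  identifies its total increase with the integral 1.\<close>

lemma density_primitive_exists:
  fixes p :: "real \<Rightarrow> real"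
  assumes p: "continuous_on UNIV p" "\<And>x. 0 \<le> p x" "\<And>x. x \<notin> {\<alpha>..\<beta>} \<Longrightarrow> p x = 0"
    and int: "(\<integral>\<^sup>+ x. ennreal (p x) \<partial>lborel) = 1" and "\<alpha> \<le> \<beta>"
  obtains P where "\<And>x. (P has_real_derivative p x) (at x)" "\<And>x. 0 \<le> P x" "\<And>x. P x \<le> 1"
    "\<And>x. x \<le> \<alpha> \<Longrightarrow> P x = 0" "\<And>x. \<beta> \<le> x \<Longrightarrow> P x = 1"
proof -
  obtain F where "\<And>x::real. (F has_vector_derivative p x) (at x)"
    using einterval_antiderivative[of "-\<infinity>" "\<infinity>" p] p(1) continuous_on_eq_continuous_at[of UNIV p] by auto
  then have F: "(F has_real_derivative p x) (at x)" for x
    by (simp add: has_real_derivative_iff_has_vector_derivative)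
  have mono: "F x \<le> F y" if "x \<le> y" for x y
    using F p(2) that by (intro DERIV_nonneg_imp_nondecreasing[of x y F]) auto
  have const: "F x = F y" if "x < y" "\<And>z. x < z \<Longrightarrow> z < y \<Longrightarrow> p z = 0" for x y
  proof -
    have "\<exists>z>x. z < y \<and> F y - F x = (y - x) * p z"
      using F that(1) by (intro MVT2) auto
    then show ?thesis using that by auto
  qed
  have left: "F x = F \<alpha>" if "x \<le> \<alpha>" for x
    using const[of x \<alpha>] that p(3) by (cases "x = \<alpha>") auto
  have right: "F x = F \<beta>" if "\<beta> \<le> x" for x
    using const[of \<beta> x] that p(3) by (cases "x = \<beta>") auto
  have "1 = (\<integral>\<^sup>+ x. ennreal (p x) * indicator {\<alpha>..\<beta>} x \<partial>lborel)"
    unfolding int[symmetric] using p(3) by (auto intro!: nn_integral_cong split: split_indicator)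
  also have "\<dots> = ennreal (F \<beta> - F \<alpha>)"
    using F p(2) \<open>\<alpha> \<le> \<beta>\<close> borel_measurable_continuous_onI[OF p(1)]
    by (intro nn_integral_FTC_Icc) (auto intro: has_field_derivative_at_within)
  finally have tot: "F \<beta> - F \<alpha> = 1" by (metis ennreal_eq_1)
  show ?thesis
  proof (rule that[of "\<lambda>x. F x - F \<alpha>"])
    fix x
    show "((\<lambda>x. F x - F \<alpha>) has_real_derivative p x) (at x)"
      using DERIV_diff[OF F DERIV_const] by simp
    show "0 \<le> F x - F \<alpha>" using mono left by (metis diff_ge_0_iff_ge linear)
    show "F x - F \<alpha> \<le> 1" using mono right tot by (metis add.commute diff_le_eq eq_diff_eq linear)
    show "F x - F \<alpha> = 0" if "x \<le> \<alpha>" using left[OF that] by simp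
    show "F x - F \<alpha> = 1" if "\<beta> \<le> x" using right[OF that] tot by simp
  qed
qed

lemma prod_axis_shift:
  fixes f :: "'n::finite \<Rightarrow> real \<Rightarrow> real"
  shows "(\<Prod>j\<in>UNIV. f j ((x + t *\<^sub>R axis i 1) $ j)) = f i (x $ i + t) * (\<Prod>j\<in>UNIV - {i}. f j (x $ j))"
  by (subst prod.remove[of _ i]) (auto simp: axis_def intro!: prod.cong)

lemma prod_axis_deriv:
  fixes f :: "'n::finite \<Rightarrow> real \<Rightarrow> real"
  assumes "\<And>y. (f i has_real_derivative g y) (at y)"
  shows "((\<lambda>t. \<Prod>j\<in>UNIV. f j ((x + t *\<^sub>R axis i 1) $ j)) has_real_derivative
    g (x $ i) * (\<Prod>j\<in>UNIV - {i}. f j (x $ j))) (at 0)"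
proof -
  have "((\<lambda>t. f i (x $ i + t)) has_real_derivative g (x $ i + 0) * 1) (at 0)"
    by (rule DERIV_chain2[OF assms]) (auto intro!: derivative_eq_intros)
  then have "((\<lambda>t. f i (x $ i + t)) has_real_derivative g (x $ i)) (at 0)" by simp
  then show ?thesis unfolding prod_axis_shift by (intro DERIV_cmult_right)
qed

text \<open>Tensor products of smooth functions form a family closed under partial derivatives,
  because the \<open>i\<close>-th one merely replaces the \<open>i\<close>-th factor by its
  derivative.\<close>

lemma smooth_fun_prod:
  fixes f :: "'n::finite \<Rightarrow> real \<Rightarrow> real"
  assumes "\<And>j. smooth_real (f j)"
  shows "smooth_fun (\<lambda>x :: real^'n. \<Prod>j\<in>UNIV. f j (x $ j))"
  unfolding smooth_fun_def
proof (intro exI conjI ballI allI)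
  let ?F = "{\<lambda>x :: real^'n. \<Prod>j\<in>UNIV. f j (x $ j) | f. \<forall>j. smooth_real (f j)}"
  show "(\<lambda>x. \<Prod>j\<in>UNIV. f j (x $ j)) \<in> ?F" using assms by blast
  fix g assume "g \<in> ?F"
  then obtain f where g: "g = (\<lambda>x. \<Prod>j\<in>UNIV. f j (x $ j))" and f: "\<And>j. smooth_real (f j)" by blast
  show "continuous_on UNIV g" unfolding g
    by (intro continuous_on_prod continuous_on_compose2[OF smooth_real_continuous[OF f]] continuous_intros) auto
  fix i
  obtain f' where f': "smooth_real f'" "\<And>y. (f i has_real_derivative f' y) (at y)"
    using smooth_real_deriv[OF f] by blast
  show "\<exists>h\<in>?F. \<forall>x. ((\<lambda>t. g (x + t *\<^sub>R axis i 1)) has_real_derivative h x) (at 0)"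
  proof (intro bexI allI)
    show "(\<lambda>x. \<Prod>j\<in>UNIV. (f(i := f')) j (x $ j)) \<in> ?F"
      using f f'(1) by (intro CollectI exI[of _ "f(i := f')"]) auto
    fix x :: "real^'n"
    have "(\<Prod>j\<in>UNIV. (f(i := f')) j (x $ j)) = f' (x $ i) * (\<Prod>j\<in>UNIV - {i}. f j (x $ j))"
      by (subst prod.remove[of _ i]) (auto intro!: prod.cong)
    then show "((\<lambda>t. g (x + t *\<^sub>R axis i 1)) has_real_derivative (\<Prod>j\<in>UNIV. (f(i := f')) j (x $ j))) (at 0)"
      unfolding g using prod_axis_deriv[of f i f' x, OF f'(2)] by simp
  qed
qed

lemma test_fun_prod:
  fixes f :: "'n::finite \<Rightarrow> real \<Rightarrow> real" and a b :: "real^'n"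
  assumes "\<And>j. smooth_real (f j)" "\<And>j y. y \<notin> {a $ j..b $ j} \<Longrightarrow> f j y = 0" "cbox a b \<subseteq> \<Omega>"
  shows "test_fun \<Omega> (\<lambda>x. \<Prod>j\<in>UNIV. f j (x $ j))"
proof -
  have "{x. (\<Prod>j\<in>UNIV. f j (x $ j)) \<noteq> 0} \<subseteq> cbox a b"
    using assms(2) by (force simp: mem_box_cart)
  then have cl: "closure {x. (\<Prod>j\<in>UNIV. f j (x $ j)) \<noteq> 0} \<subseteq> cbox a b"
    by (rule closure_minimal) (rule closed_cbox)
  moreover have "compact (closure {x. (\<Prod>j\<in>UNIV. f j (x $ j)) \<noteq> 0})"
    using bounded_subset[OF bounded_cbox cl] by (simp add: compact_eq_bounded_closed)
  ultimately show ?thesis using assms smooth_fun_prod[of f] unfolding test_fun_def by blast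
qed

lemma partial_deriv_prod:
  fixes f :: "'n::finite \<Rightarrow> real \<Rightarrow> real"
  assumes "\<And>y. (f i has_real_derivative g y) (at y)"
  shows "partial_deriv i (\<lambda>x. \<Prod>j\<in>UNIV. f j (x $ j)) x = g (x $ i) * (\<Prod>j\<in>UNIV - {i}. f j (x $ j))"
  unfolding partial_deriv_def by (rule DERIV_imp_deriv[OF prod_axis_deriv[of f i g x, OF assms]])

section \<open>Averages of a weakly differentiable map\<close>

definition bump_on :: "real \<Rightarrow> real \<Rightarrow> (real \<Rightarrow> real) \<Rightarrow> bool" where
  "bump_on \<alpha> \<beta> p \<longleftrightarrow> smooth_real p \<and> (\<forall>x. 0 \<le> p x) \<and> (\<forall>x. x \<notin> {\<alpha>..\<beta>} \<longrightarrow> p x = 0) \<and>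
     (\<integral>\<^sup>+ x. ennreal (p x) \<partial>lborel) = 1"

lemma bump_on_mono:
  assumes "bump_on \<alpha> \<beta> p" "\<alpha>' \<le> \<alpha>" "\<beta> \<le> \<beta>'"
  shows "bump_on \<alpha>' \<beta>' p"
  using assms unfolding bump_on_def by auto

lemma bump_on_le:
  assumes "bump_on \<alpha> \<beta> p"
  shows "\<alpha> \<le> \<beta>"
proof (rule ccontr)
  assume "\<not> \<alpha> \<le> \<beta>"
  then have "p = (\<lambda>x. 0)" using assms by (auto simp: bump_on_def fun_eq_iff)
  then show False using assms by (simp add: bump_on_def)
qed

lemma bump_on_scaled:
  assumes h: "bump_on 0 1 h" and \<rho>: "0 < \<rho>"
  shows "bump_on \<alpha> (\<alpha> + \<rho>) (\<lambda>x. (1 / \<rho>) * h ((1 / \<rho>) * x + (- \<alpha> / \<rho>)))"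
proof -
  have hm [measurable]: "h \<in> borel_measurable borel"
    using h by (auto simp: bump_on_def intro!: borel_measurable_continuous_onI smooth_real_continuous)
  have "1 = (\<integral>\<^sup>+ x. ennreal (h x) \<partial>lborel)" using h by (simp add: bump_on_def)
  also have "\<dots> = ennreal \<bar>1 / \<rho>\<bar> * (\<integral>\<^sup>+ x. ennreal (h (- \<alpha> / \<rho> + (1 / \<rho>) * x)) \<partial>lborel)"
    using \<rho> by (intro nn_integral_real_affine) auto
  also have "\<dots> = (\<integral>\<^sup>+ x. ennreal ((1 / \<rho>) * h ((1 / \<rho>) * x + (- \<alpha> / \<rho>))) \<partial>lborel)"
    using \<rho> by (subst nn_integral_cmult[symmetric]) (auto simp: ennreal_mult'[symmetric] add.commute)
  finally have "(\<integral>\<^sup>+ x. ennreal ((1 / \<rho>) * h ((1 / \<rho>) * x + (- \<alpha> / \<rho>))) \<partial>lborel) = 1" ..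
  moreover have "h ((1 / \<rho>) * x + (- \<alpha> / \<rho>)) = 0" if "x \<notin> {\<alpha>..\<alpha> + \<rho>}" for x
  proof -
    have "(1 / \<rho>) * x + (- \<alpha> / \<rho>) = (x - \<alpha>) / \<rho>" by (simp add: diff_divide_distrib)
    moreover have "(x - \<alpha>) / \<rho> \<notin> {0..1}" using that \<rho> by (auto simp: field_simps)
    ultimately show ?thesis using h by (auto simp: bump_on_def)
  qed
  ultimately show ?thesis
    using h \<rho> smooth_real_affine[of h "1 / \<rho>" "1 / \<rho>" "- \<alpha> / \<rho>"] unfolding bump_on_def by auto
qed

abbreviation tensor :: "('n::finite \<Rightarrow> real \<Rightarrow> real) \<Rightarrow> real^'n \<Rightarrow> real" where
  "tensor f \<equiv> (\<lambda>x. \<Prod>j\<in>UNIV. f j (x $ j))"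

lemma tensor_zero:
  assumes "\<And>j y. y \<notin> {a $ j..b $ j} \<Longrightarrow> f j y = 0" "x \<notin> cbox a b"
  shows "tensor f x = 0"
proof -
  obtain j where "x $ j \<notin> {a $ j..b $ j}" using assms(2) by (auto simp: mem_box_cart)
  then have "f j (x $ j) = 0" by (rule assms(1))
  then show ?thesis by (intro prod_zero) auto
qed

lemma continuous_on_tensor:
  assumes "\<And>j. continuous_on UNIV (f j)"
  shows "continuous_on S (tensor f)"
  by (intro continuous_on_prod continuous_on_compose2[OF assms] continuous_intros) auto

lemma nn_integral_tensor:
  fixes f :: "'n::finite \<Rightarrow> real \<Rightarrow> real"
  assumes f: "\<And>j. f j \<in> borel_measurable borel" "\<And>j x. 0 \<le> f j x"
  shows "(\<integral>\<^sup>+ x. ennreal (tensor f x) \<partial>lebesgue) = (\<Prod>j\<in>UNIV. (\<integral>\<^sup>+ x. ennreal (f j x) \<partial>lborel))"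
proof -
  \<comment> \<open>Fubini for \<open>lborel\<close> is stated over \<open>Basis\<close>;
    \<open>?i\<close> recovers the coordinate from a basis vector.\<close>
  let ?i = "the_inv_into UNIV (\<lambda>i::'n. axis i (1::real))"
  have inj: "inj (\<lambda>i::'n. axis i (1::real))" by (auto simp: inj_def axis_eq_axis)
  have B: "(Basis :: (real^'n) set) = range (\<lambda>i. axis i 1)" by (auto simp: Basis_vec_def)
  have reindex: "(\<Prod>b\<in>(Basis :: (real^'n) set). g b) = (\<Prod>j\<in>UNIV. g (axis j 1))" for g :: "real^'n \<Rightarrow> 'b::comm_monoid_mult"
    unfolding B by (subst prod.reindex[OF inj]) simp
  have "(\<integral>\<^sup>+ x. ennreal (tensor f x) \<partial>lebesgue) = (\<integral>\<^sup>+ x. (\<Prod>b\<in>Basis. ennreal (f (?i b) (x \<bullet> b))) \<partial>(lborel :: (real^'n) measure))"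
    unfolding reindex nn_integral_completion
    using f by (simp add: the_inv_into_f_f[OF inj] inner_axis prod_ennreal)
  also have "\<dots> = (\<Prod>b\<in>(Basis :: (real^'n) set). (\<integral>\<^sup>+ x. ennreal (f (?i b) x) \<partial>lborel))"
    using f by (intro nn_integral_lborel_prod) auto
  also have "\<dots> = (\<Prod>j\<in>UNIV. (\<integral>\<^sup>+ x. ennreal (f j x) \<partial>lborel))"
    unfolding reindex by (simp add: the_inv_into_f_f[OF inj])
  finally show ?thesis .
qed

locale sobolev_map =
  fixes \<Omega> :: "(real^'n) set" and u :: "real^'n \<Rightarrow> real^'m" and G :: "real^'n \<Rightarrow> real^'n^'m"
  assumes wg: "weak_gradient \<Omega> u G" and cont: "continuous_on \<Omega> u"
begin

lemma set_integrable_cbox: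
  assumes "cbox a b \<subseteq> \<Omega>"
  shows "set_integrable lebesgue (cbox a b) (\<lambda>x. u x $ c)" "set_integrable lebesgue (cbox a b) (\<lambda>x. G x $ c $ i)"
    "set_integrable lebesgue (cbox a b) (\<lambda>x. norm (G x))"
proof -
  have 1: "set_integrable lebesgue (cbox a b) u" "set_integrable lebesgue (cbox a b) G"
    using wg assms compact_cbox[of a b] by (simp_all add: weak_gradient_def locally_integrable_on_def)
  show "set_integrable lebesgue (cbox a b) (\<lambda>x. u x $ c)"
    using integrable_bounded_linear[OF bounded_linear_vec_nth[of c] 1(1)[unfolded set_integrable_def]]
    unfolding set_integrable_def by simp
  show "set_integrable lebesgue (cbox a b) (\<lambda>x. G x $ c $ i)"
    using integrable_bounded_linear[OF bounded_linear_vec_nth[of i]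
        integrable_bounded_linear[OF bounded_linear_vec_nth[of c] 1(2)[unfolded set_integrable_def]]]
    unfolding set_integrable_def by simp
  show "set_integrable lebesgue (cbox a b) (\<lambda>x. norm (G x))"
    using set_integrable_norm[OF 1(2)] .
qed

lemma set_integrable_mult_compact_support:
  fixes g v :: "real^'n \<Rightarrow> real"
  assumes "continuous_on UNIV g" "\<And>x. x \<notin> cbox a b \<Longrightarrow> g x = 0" "cbox a b \<subseteq> \<Omega>" "set_integrable lebesgue (cbox a b) v"
  shows "set_integrable lebesgue \<Omega> (\<lambda>x. g x * v x)"
proof -
  have "bounded (g ` cbox a b)"
    using assms(1) by (intro compact_imp_bounded compact_continuous_image) (auto intro: continuous_on_subset)
  then obtain K where K: "\<And>x. x \<in> cbox a b \<Longrightarrow> \<bar>g x\<bar> \<le> K" "0 < K" by (auto simp: bounded_pos)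
  have gm [measurable]: "g \<in> borel_measurable lebesgue"
    using borel_measurable_continuous_onI[OF assms(1)] by (simp add: measurable_completion)
  have iv: "integrable lebesgue (\<lambda>x. indicator (cbox a b) x *\<^sub>R v x)"
    using assms(4) by (simp add: set_integrable_def)
  have eq: "(\<lambda>x. indicator \<Omega> x *\<^sub>R (g x * v x)) = (\<lambda>x. g x * (indicator (cbox a b) x *\<^sub>R v x))"
    using assms(2,3) by (auto simp: fun_eq_iff split: split_indicator)
  show ?thesis unfolding set_integrable_def eq
  proof (rule Bochner_Integration.integrable_bound)
    show "integrable lebesgue (\<lambda>x. K * (indicator (cbox a b) x *\<^sub>R v x))" using iv by simp
    show "(\<lambda>x. g x * (indicator (cbox a b) x *\<^sub>R v x)) \<in> borel_measurable lebesgue"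
      using borel_measurable_integrable[OF iv] by (intro borel_measurable_times gm)
    show "AE x in lebesgue. norm (g x * (indicator (cbox a b) x *\<^sub>R v x)) \<le> norm (K * (indicator (cbox a b) x *\<^sub>R v x))"
      using K by (auto simp: abs_mult split: split_indicator intro!: mult_right_mono)
  qed
qed

definition avg :: "'m \<Rightarrow> ('n \<Rightarrow> real \<Rightarrow> real) \<Rightarrow> real" where
  "avg c f = (\<integral>x\<in>\<Omega>. tensor f x * u x $ c \<partial>lebesgue)"

text \<open>The primitive of \<^term>\<open>p i - q\<close> has compact support, since both densities have integral 1.
  Multiplied by the remaining factors it is a test function whose \<^term>\<open>i\<close>-th partial derivative is
  the difference of the two tensor products.\<close>
lemma avg_change_coord:
  assumes p: "\<And>j. bump_on (a $ j) (b $ j) (p j)" and q: "bump_on (a $ i) (b $ i) q" and box: "cbox a b \<subseteq> \<Omega>"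
    and D: "\<And>j y. p j y \<le> D"
  shows "ennreal \<bar>avg c p - avg c (p(i := q))\<bar> \<le> ennreal (D ^ (CARD('n) - 1)) * (\<integral>\<^sup>+ x\<in>cbox a b. ennreal (norm (G x)) \<partial>lebesgue)"
proof -
  have cont_b: "continuous_on UNIV r" if "bump_on \<alpha> \<beta> r" for \<alpha> \<beta> r using that by (simp add: bump_on_def smooth_real_continuous)
  have D0: "0 \<le> D" using D[of i 0] p[of i] unfolding bump_on_def by (meson order_trans)
  obtain P where P: "\<And>x. (P has_real_derivative p i x) (at x)" "\<And>x. 0 \<le> P x" "\<And>x. P x \<le> 1"
    "\<And>x. x \<le> a $ i \<Longrightarrow> P x = 0" "\<And>x. b $ i \<le> x \<Longrightarrow> P x = 1"
    using density_primitive_exists[of "p i" "a $ i" "b $ i"] p[of i] bump_on_le[OF p[of i]] cont_b[OF p[of i]]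
    unfolding bump_on_def by metis
  obtain Q where Q: "\<And>x. (Q has_real_derivative q x) (at x)" "\<And>x. 0 \<le> Q x" "\<And>x. Q x \<le> 1"
    "\<And>x. x \<le> a $ i \<Longrightarrow> Q x = 0" "\<And>x. b $ i \<le> x \<Longrightarrow> Q x = 1"
    using density_primitive_exists[of q "a $ i" "b $ i"] q bump_on_le[OF q] cont_b[OF q]
    unfolding bump_on_def by metis
  define W where "W x = P x - Q x" for x
  have dW: "(W has_real_derivative p i x - q x) (at x)" for x
    unfolding W_def using DERIV_diff[OF P(1) Q(1)] by simp
  have sW: "smooth_real W"
    using smooth_real_antideriv[OF smooth_real_diff dW] p q unfolding bump_on_def by auto
  \<comment> \<open>Both primitives take values between 0 and 1. The factor in direction
    \<open>i\<close> therefore costs nothing, and only the other \<open>n - 1\<close> factors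
    contribute a bound \<open>D\<close>.\<close>
  have W1: "\<bar>W x\<bar> \<le> 1" for x using P(2,3)[of x] Q(2,3)[of x] by (simp add: W_def)
  have W0: "W x = 0" if "x \<notin> {a $ i..b $ i}" for x
    using that P(4,5)[of x] Q(4,5)[of x] by (cases "x \<le> a $ i") (auto simp: W_def)
  let ?f = "p(i := W)"
  have sf: "smooth_real (?f j)" for j using p sW by (auto simp: bump_on_def)
  have f0: "?f j y = 0" if "y \<notin> {a $ j..b $ j}" for j y
    using that p[of j] W0[of y] by (auto simp: bump_on_def)
  have test: "test_fun \<Omega> (tensor ?f)" by (rule test_fun_prod[OF sf f0 box])
  have dfi: "(?f i has_real_derivative p i y - q y) (at y)" for y using dW by simp
  have pd: "partial_deriv i (tensor ?f) x = tensor p x - tensor (p(i := q)) x" for x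
  proof -
    have "partial_deriv i (tensor ?f) x = (p i (x $ i) - q (x $ i)) * (\<Prod>j\<in>UNIV - {i}. ?f j (x $ j))"
      by (rule partial_deriv_prod[of ?f i "\<lambda>y. p i y - q y" x, OF dfi])
    also have "(\<Prod>j\<in>UNIV - {i}. ?f j (x $ j)) = (\<Prod>j\<in>UNIV - {i}. p j (x $ j))"
      by (intro prod.cong) auto
    also have "(p i (x $ i) - q (x $ i)) * \<dots> = tensor p x - tensor (p(i := q)) x"
    proof -
      have "tensor p x = p i (x $ i) * (\<Prod>j\<in>UNIV - {i}. p j (x $ j))"
        by (rule prod.remove) auto
      moreover have "tensor (p(i := q)) x = q (x $ i) * (\<Prod>j\<in>UNIV - {i}. p j (x $ j))"
        by (subst prod.remove[of UNIV i]) (auto intro!: prod.cong)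
      ultimately show ?thesis by (simp add: left_diff_distrib)
    qed
    finally show ?thesis .
  qed
  have int_p: "set_integrable lebesgue \<Omega> (\<lambda>x. tensor r x * u x $ c)" if r: "\<And>j. bump_on (a $ j) (b $ j) (r j)" for r
  proof (rule set_integrable_mult_compact_support[OF _ _ box set_integrable_cbox(1)[OF box]])
    show "continuous_on UNIV (tensor r)" by (intro continuous_on_tensor cont_b[OF r])
    show "tensor r x = 0" if "x \<notin> cbox a b" for x
      using r by (intro tensor_zero[OF _ that]) (auto simp: bump_on_def)
  qed
  have q': "bump_on (a $ j) (b $ j) ((p(i := q)) j)" for j using p q by simp
  have "avg c p - avg c (p(i := q)) = (\<integral>x\<in>\<Omega>. (tensor p x - tensor (p(i := q)) x) * u x $ c \<partial>lebesgue)"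
    unfolding avg_def left_diff_distrib by (rule set_integral_diff(2)[OF int_p[OF p] int_p[OF q'], symmetric])
  also have "\<dots> = (\<integral>x\<in>\<Omega>. partial_deriv i (tensor ?f) x * u x $ c \<partial>lebesgue)"
    unfolding pd ..
  also have "\<dots> = - (\<integral>x\<in>\<Omega>. tensor ?f x * G x $ c $ i \<partial>lebesgue)"
    using wg test unfolding weak_gradient_def by blast
  finally have eq: "\<bar>avg c p - avg c (p(i := q))\<bar> = norm (\<integral>x\<in>\<Omega>. tensor ?f x * G x $ c $ i \<partial>lebesgue)" by simp
  have "set_integrable lebesgue \<Omega> (\<lambda>x. tensor ?f x * G x $ c $ i)"
    using f0 by (intro set_integrable_mult_compact_support[OF _ _ box set_integrable_cbox(2)[OF box]]
        continuous_on_tensor smooth_real_continuous sf tensor_zero)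
  then have int: "integrable lebesgue (\<lambda>x. indicator \<Omega> x *\<^sub>R (tensor ?f x * G x $ c $ i))"
    unfolding set_integrable_def .
  have "ennreal \<bar>avg c p - avg c (p(i := q))\<bar> \<le> (\<integral>\<^sup>+ x. ennreal (norm (indicator \<Omega> x *\<^sub>R (tensor ?f x * G x $ c $ i))) \<partial>lebesgue)"
    unfolding eq set_lebesgue_integral_def by (rule integral_norm_bound_ennreal[OF int])
  also have "\<dots> \<le> (\<integral>\<^sup>+ x. ennreal (D ^ (CARD('n) - 1)) * (ennreal (norm (G x)) * indicator (cbox a b) x) \<partial>lebesgue)"
  proof (intro nn_integral_mono)
    fix x
    show "ennreal (norm (indicator \<Omega> x *\<^sub>R (tensor ?f x * G x $ c $ i)))
      \<le> ennreal (D ^ (CARD('n) - 1)) * (ennreal (norm (G x)) * indicator (cbox a b) x)"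
    proof (cases "x \<in> cbox a b")
      case True
      have "\<bar>tensor ?f x\<bar> = \<bar>W (x $ i)\<bar> * (\<Prod>j\<in>UNIV - {i}. \<bar>p j (x $ j)\<bar>)"
        by (subst prod.remove[of UNIV i]) (auto simp: abs_mult abs_prod intro!: prod.cong)
      also have "\<dots> \<le> 1 * (\<Prod>j\<in>UNIV - {i}. D)"
        using W1 D p by (intro mult_mono prod_mono) (auto simp: bump_on_def intro!: prod_nonneg)
      also have "\<dots> = D ^ (CARD('n) - 1)" by (simp add: card_Diff_singleton)
      finally have tf: "\<bar>tensor ?f x\<bar> \<le> D ^ (CARD('n) - 1)" .
      have "\<bar>G x $ c $ i\<bar> \<le> norm (G x)"
        by (rule order_trans[OF component_le_norm_cart Finite_Cartesian_Product.norm_nth_le])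
      then have "\<bar>tensor ?f x * G x $ c $ i\<bar> \<le> D ^ (CARD('n) - 1) * norm (G x)"
        using tf D0 by (simp only: abs_mult) (intro mult_mono, auto)
      then show ?thesis using True box D0 by (auto simp: ennreal_mult[symmetric] intro!: ennreal_leI)
    next
      case False
      then have "tensor ?f x = 0" using f0 by (intro tensor_zero)
      then show ?thesis by (simp only:) simp
    qed
  qed
  also have "\<dots> = ennreal (D ^ (CARD('n) - 1)) * (\<integral>\<^sup>+ x\<in>cbox a b. ennreal (norm (G x)) \<partial>lebesgue)"
  proof (rule nn_integral_cmult)
    have "(\<lambda>x. indicator (cbox a b) x *\<^sub>R norm (G x)) \<in> borel_measurable lebesgue"
      using set_integrable_cbox(3)[OF box] unfolding set_integrable_def by (rule borel_measurable_integrable)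
    then have "(\<lambda>x. ennreal (indicator (cbox a b) x *\<^sub>R norm (G x))) \<in> borel_measurable lebesgue" by measurable
    also have "(\<lambda>x. ennreal (indicator (cbox a b) x *\<^sub>R norm (G x))) = (\<lambda>x. ennreal (norm (G x)) * indicator (cbox a b) x)"
      by (auto simp: fun_eq_iff split: split_indicator)
    finally show "(\<lambda>x. ennreal (norm (G x)) * indicator (cbox a b) x) \<in> borel_measurable lebesgue" .
  qed
  finally show ?thesis .
qed

text \<open>The densities are exchanged one coordinate at a time, passing through products that mix
  factors of \<open>p\<close> and \<open>q\<close>. All of them are supported in the same box and
  bounded by \<open>D\<close>, so each exchange costs the same.\<close>

lemma avg_change:
  fixes D :: real
  assumes p: "\<And>j. bump_on (a $ j) (b $ j) (p j)" and q: "\<And>j. bump_on (a $ j) (b $ j) (q j)" and box: "cbox a b \<subseteq> \<Omega>"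
    and D: "\<And>j y. p j y \<le> D" "\<And>j y. q j y \<le> D"
  shows "ennreal \<bar>avg c p - avg c q\<bar> \<le> ennreal (real CARD('n) * D ^ (CARD('n) - 1)) * (\<integral>\<^sup>+ x\<in>cbox a b. ennreal (norm (G x)) \<partial>lebesgue)"
proof -
  let ?I = "(\<integral>\<^sup>+ x\<in>cbox a b. ennreal (norm (G x)) \<partial>lebesgue)"
  \<comment> \<open>The mixed family in which the coordinates in \<open>S\<close> have been
    exchanged already; the induction enlarges \<open>S\<close> up to all coordinates.\<close>
  let ?m = "\<lambda>S j. if j \<in> S then q j else p j"
  have D0: "0 \<le> D" using D(1)[of undefined 0] p[of undefined] unfolding bump_on_def by (meson order_trans)
  have "ennreal \<bar>avg c p - avg c (?m S)\<bar> \<le> ennreal (real (card S) * D ^ (CARD('n) - 1)) * ?I" for S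
  proof (induction S rule: finite_induct[OF finite])
    case (2 i S)
    have m: "?m (insert i S) = (?m S)(i := q i)" by auto
    have "ennreal \<bar>avg c p - avg c (?m (insert i S))\<bar>
      \<le> ennreal (\<bar>avg c p - avg c (?m S)\<bar> + \<bar>avg c (?m S) - avg c ((?m S)(i := q i))\<bar>)"
      unfolding m by (intro ennreal_leI) linarith
    also have "\<dots> = ennreal \<bar>avg c p - avg c (?m S)\<bar> + ennreal \<bar>avg c (?m S) - avg c ((?m S)(i := q i))\<bar>"
      by simp
    also have "\<dots> \<le> ennreal (real (card S) * D ^ (CARD('n) - 1)) * ?I + ennreal (D ^ (CARD('n) - 1)) * ?I"
      using p q D by (intro add_mono 2 avg_change_coord[of a b "?m S", OF _ _ box]) auto
    also have "\<dots> = ennreal (real (card (insert i S)) * D ^ (CARD('n) - 1)) * ?I"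
      using 2 D0 by (simp add: distrib_right[symmetric] ennreal_plus[symmetric] algebra_simps del: ennreal_plus)
    finally show ?case .
  qed simp
  from this[of UNIV] show ?thesis by simp
qed

text \<open>The tensor product is a probability density on the box, so the average differs from
  \<open>v\<close> by a weighted mean of \<open>u x $ c - v\<close>.\<close>

lemma avg_near:
  assumes p: "\<And>j. bump_on (a $ j) (b $ j) (p j)" and box: "cbox a b \<subseteq> \<Omega>"
    and e: "\<And>x. x \<in> cbox a b \<Longrightarrow> \<bar>u x $ c - v\<bar> \<le> e"
  shows "\<bar>avg c p - v\<bar> \<le> e"
proof -
  have cp: "continuous_on UNIV (p j)" for j using p[of j] by (simp add: bump_on_def smooth_real_continuous)
  have nn: "0 \<le> tensor p x" for x using p by (intro prod_nonneg) (auto simp: bump_on_def)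
  have t0: "tensor p x = 0" if "x \<notin> cbox a b" for x
    using p by (intro tensor_zero[OF _ that]) (auto simp: bump_on_def)
  have tm: "tensor p \<in> borel_measurable lebesgue"
    using borel_measurable_continuous_onI[OF continuous_on_tensor[of p, OF cp]] by (simp add: measurable_completion)
  have "(\<integral>\<^sup>+ x. ennreal (tensor p x) \<partial>lebesgue) = 1"
    using p by (subst nn_integral_tensor) (auto simp: bump_on_def borel_measurable_continuous_onI[OF cp])
  then have hb: "has_bochner_integral lebesgue (tensor p) 1"
    using tm nn by (intro has_bochner_integral_nn_integral) auto
  have hb': "integrable lebesgue (\<lambda>x. indicator \<Omega> x *\<^sub>R (tensor p x * k))" "(\<integral>x\<in>\<Omega>. tensor p x * k \<partial>lebesgue) = k" for k
  proof -
    have eq: "(\<lambda>x. indicator \<Omega> x *\<^sub>R (tensor p x * k)) = (\<lambda>x. tensor p x * k)"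
      using t0 box by (auto simp: fun_eq_iff split: split_indicator)
    show "integrable lebesgue (\<lambda>x. indicator \<Omega> x *\<^sub>R (tensor p x * k))" "(\<integral>x\<in>\<Omega>. tensor p x * k \<partial>lebesgue) = k"
      unfolding set_lebesgue_integral_def eq using hb by (auto simp: has_bochner_integral_iff)
  qed
  have int: "set_integrable lebesgue \<Omega> (\<lambda>x. tensor p x * u x $ c)"
    by (intro set_integrable_mult_compact_support[OF _ t0 box set_integrable_cbox(1)[OF box]] continuous_on_tensor cp)
  have "avg c p - v = (\<integral>x\<in>\<Omega>. tensor p x * u x $ c - tensor p x * v \<partial>lebesgue)"
    unfolding avg_def using set_integral_diff(2)[OF int, of "\<lambda>x. tensor p x * v"] hb'[of v]
    by (simp add: set_integrable_def)
  also have "norm \<dots> \<le> (\<integral>x. norm (indicator \<Omega> x *\<^sub>R (tensor p x * u x $ c - tensor p x * v)) \<partial>lebesgue)"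
    unfolding set_lebesgue_integral_def by (rule integral_norm_bound)
  also have "\<dots> \<le> (\<integral>x. indicator \<Omega> x *\<^sub>R (tensor p x * e) \<partial>lebesgue)"
  proof (rule integral_mono[OF integrable_norm hb'(1)])
    show "integrable lebesgue (\<lambda>x. indicator \<Omega> x *\<^sub>R (tensor p x * u x $ c - tensor p x * v))"
      using set_integral_diff(1)[OF int, of "\<lambda>x. tensor p x * v"] hb'(1)[of v] by (simp add: set_integrable_def)
    fix x
    show "norm (indicator \<Omega> x *\<^sub>R (tensor p x * u x $ c - tensor p x * v)) \<le> indicator \<Omega> x *\<^sub>R (tensor p x * e)"
    proof (cases "x \<in> cbox a b")
      case True
      then show ?thesis using e[OF True] nn[of x]
        by (auto simp: abs_mult right_diff_distrib[symmetric] split: split_indicator intro!: mult_left_mono)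
    qed (simp add: t0)
  qed
  also have "\<dots> = e" using hb'(2)[of e] unfolding set_lebesgue_integral_def .
  finally show ?thesis by simp
qed

end

section \<open>A Morrey-type estimate on cubes\<close>

lemma young_pieces_le_tail:
  assumes "\<And>j. x j \<le> x (Suc j)"
  shows "(\<Sum>j. \<integral>\<^sup>+ s\<in>{x j..<x (Suc j)}. young_dual A s *
      ennreal (s powr (- 1 - real n / (real n - 1))) \<partial>lborel) \<le> young_tail n A (x 0)"
proof (rule suminf_le_const)
  fix N
  let ?p = "\<lambda>j. \<integral>\<^sup>+ s\<in>{x j..<x (Suc j)}. young_dual A s *
      ennreal (s powr (- 1 - real n / (real n - 1))) \<partial>lborel"
  have "(\<Sum>j<N. ?p j) + young_tail n A (x N) = young_tail n A (x 0)"
  proof (induction N)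
    case (Suc N)
    show ?case unfolding Suc.IH[symmetric] young_tail_split[OF assms[of N]] by (simp add: add.assoc)
  qed simp
  then have "young_tail n A (x 0) = (\<Sum>j<N. ?p j) + young_tail n A (x N)" ..
  also have "\<dots> \<ge> (\<Sum>j<N. ?p j)" by simp
  finally show "(\<Sum>j<N. ?p j) \<le> young_tail n A (x 0)" .
qed simp

text \<open>Each term is at least twice the preceding one when \<open>m \<ge> 1\<close>, so the last
  term dominates. For \<open>m = 0\<close> the terms do not grow, which is one reason to treat
  dimension one separately.\<close>

lemma sum_dyadic_powers_le:
  assumes "1 \<le> m"
  shows "(\<Sum>k\<le>j. (2 ^ k) ^ m) \<le> 2 * (2 ^ j :: real) ^ m"
proof (induction j)
  case (Suc j)
  have "2 * (2 ^ j :: real) ^ m \<le> 2 ^ m * (2 ^ j) ^ m"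
    using assms power_increasing[of 1 m "2::real"] by (intro mult_right_mono) auto
  also have "\<dots> = (2 ^ Suc j) ^ m" by (simp add: power_mult_distrib)
  finally show ?case using Suc unfolding sum.atMost_Suc by linarith
qed simp

text \<open>The sum of the averages is the integral of \<^term>\<open>g\<close> against the kernel
  \<^term>\<open>\<Sum>k. indicator (Q k) z / \<rho> k ^ (n - 1)\<close>, which is comparable to its last term on each shell.
  Young's inequality then splits the integrand.\<close>
lemma dyadic_potential_le:
  fixes Q :: "nat \<Rightarrow> 'a set" and M :: "'a measure"
  assumes n: "2 \<le> n" and A: "young_fun A" and r: "0 < r" and l: "0 < \<kappa>"
    and Q: "\<And>k. Q k \<in> sets M" "\<And>k. Q (Suc k) \<subseteq> Q k" "\<And>k. emeasure M (Q k) = ennreal ((r / 2 ^ k) ^ n)"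
    and null: "AE z in M. \<exists>k. z \<notin> Q k"
    and g: "g \<in> borel_measurable M" "\<And>z. 0 \<le> g z" "(\<lambda>z. ennreal (A (g z))) \<in> borel_measurable M"
  shows "ennreal \<kappa> * (\<Sum>k. ennreal (1 / (r / 2 ^ k) ^ (n - 1)) * (\<integral>\<^sup>+ z\<in>Q k. ennreal (g z) \<partial>M))
    \<le> ennreal (4 ^ n) * ((\<integral>\<^sup>+ z\<in>Q 0. ennreal (A (g z)) \<partial>M) +
        ennreal (\<kappa> powr (real n / (real n - 1))) * young_tail n A (\<kappa> / r ^ (n - 1)))"
proof -
  let ?q = "real n / (real n - 1)" and ?At = "young_dual A"
  define m where "m = n - 1"
  have m: "1 \<le> m" "n = Suc m" using n by (auto simp: m_def)
  define \<rho> where "\<rho> k = r / 2 ^ k" for k :: nat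
  have \<rho>: "0 < \<rho> k" for k using r by (simp add: \<rho>_def)
  \<comment> \<open>The dual variable at scale \<open>\<rho> k\<close>. These points grow by the
    factor \<open>2 ^ m\<close>, so the intervals between consecutive ones tile the half-line of
    integration of the tail starting at \<open>x 0\<close>.\<close>
  define x where "x k = \<kappa> / \<rho> k ^ m" for k
  have x: "0 < x k" for k using \<rho> l by (simp add: x_def)
  note [measurable] = Q(1) g(1,3)
  have Qmono: "Q j \<subseteq> Q i" if "i \<le> j" for i j using Q(2) that by (rule lift_Suc_antimono_le)
  define K where "K z = (\<Sum>k. ennreal (1 / \<rho> k ^ m) * indicator (Q k) z)" for z
  have Kle: "K z \<le> ennreal (2 / \<rho> j ^ m)" if "z \<notin> Q (Suc j)" for z j
  proof -
    have "K z = (\<Sum>k\<le>j. ennreal (1 / \<rho> k ^ m) * indicator (Q k) z)"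
      unfolding K_def
    proof (rule suminf_finite)
      fix k assume "k \<notin> {..j}"
      then have "z \<notin> Q k" using that Qmono[of "Suc j" k] by auto
      then show "ennreal (1 / \<rho> k ^ m) * indicator (Q k) z = 0" by simp
    qed simp
    also have "\<dots> \<le> (\<Sum>k\<le>j. ennreal (1 / \<rho> k ^ m))"
      by (intro sum_mono) (auto split: split_indicator)
    also have "\<dots> = ennreal (\<Sum>k\<le>j. 1 / \<rho> k ^ m)" using \<rho> by (intro sum_ennreal) (simp add: less_imp_le)
    also have "\<dots> \<le> ennreal (2 / \<rho> j ^ m)"
    proof (intro ennreal_leI)
      have "(\<Sum>k\<le>j. 1 / \<rho> k ^ m) = (\<Sum>k\<le>j. (2 ^ k) ^ m) / r ^ m"
        by (simp add: \<rho>_def power_divide sum_divide_distrib)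
      also have "\<dots> \<le> 2 * (2 ^ j) ^ m / r ^ m"
        using r by (intro divide_right_mono sum_dyadic_powers_le m) auto
      also have "\<dots> = 2 / \<rho> j ^ m" by (simp add: \<rho>_def power_divide)
      finally show "(\<Sum>k\<le>j. 1 / \<rho> k ^ m) \<le> 2 / \<rho> j ^ m" .
    qed
    finally show ?thesis .
  qed
  \<comment> \<open>The factor 1/2 absorbs the 2 in the bound \<open>Kle\<close>; on the shell of
    index \<open>j\<close> the integrand is then at most exactly \<open>g z * x j\<close>.\<close>
  have "ennreal (\<kappa> / 2) * (\<Sum>k. ennreal (1 / \<rho> k ^ m) * (\<integral>\<^sup>+ z\<in>Q k. ennreal (g z) \<partial>M))
     = ennreal (\<kappa> / 2) * (\<Sum>k. (\<integral>\<^sup>+ z. ennreal (g z) * (ennreal (1 / \<rho> k ^ m) * indicator (Q k) z) \<partial>M))"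
    by (subst nn_integral_cmult[symmetric]) (auto simp: mult_ac)
  also have "\<dots> = (\<integral>\<^sup>+ z. ennreal (\<kappa> / 2) * (ennreal (g z) * K z) \<partial>M)"
    unfolding K_def by (subst nn_integral_suminf[symmetric]) (auto simp: nn_integral_cmult)
  also have "\<dots> \<le> (\<integral>\<^sup>+ z. ennreal (A (g z)) * indicator (Q 0) z + (\<Sum>j. ?At (x j) * indicator (Q j) z) \<partial>M)"
  proof (rule nn_integral_mono_AE, use null in eventually_elim)
    fix z assume "\<exists>k. z \<notin> Q k"
    show "ennreal (\<kappa> / 2) * (ennreal (g z) * K z) \<le> ennreal (A (g z)) * indicator (Q 0) z + (\<Sum>j. ?At (x j) * indicator (Q j) z)"
    proof (cases "z \<in> Q 0")
      case False
      then have "z \<notin> Q k" for k using Qmono[of 0 k] by auto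
      then have "K z = 0" by (simp add: K_def)
      then show ?thesis by simp
    next
      case True
      \<comment> \<open>The first cube that misses \<open>z\<close>; it exists for almost every
        \<open>z\<close>. Its predecessor \<open>j\<close> is the shell of \<open>z\<close>, the
        deepest scale contributing to the kernel.\<close>
      define k where "k = (LEAST k. z \<notin> Q k)"
      have k: "z \<notin> Q k" unfolding k_def using \<open>\<exists>k. z \<notin> Q k\<close> by (rule LeastI_ex)
      then obtain j where j: "k = Suc j" using True by (cases k) auto
      have zj: "z \<in> Q j" using not_less_Least[of j "\<lambda>k. z \<notin> Q k"] j by (auto simp: k_def)
      have "ennreal (\<kappa> / 2) * (ennreal (g z) * K z) \<le> ennreal (\<kappa> / 2) * (ennreal (g z) * ennreal (2 / \<rho> j ^ m))"
        using Kle[of z j] k j by (intro mult_left_mono) auto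
      also have "\<dots> = ennreal (g z * x j)"
        using l g(2)[of z] \<rho>[of j] by (simp add: ennreal_mult[symmetric] x_def field_simps)
      also have "\<dots> \<le> ennreal (A (g z)) + ?At (x j)"
        using g(2) young_fun_nonneg[OF A] by (intro young_ineq) auto
      also have "?At (x j) = (\<Sum>i\<in>{j}. ?At (x i) * indicator (Q i) z)" using zj by simp
      also have "\<dots> \<le> (\<Sum>j. ?At (x j) * indicator (Q j) z)"
        by (rule sum_le_suminf) auto
      finally show ?thesis using True by (simp add: add_left_mono)
    qed
  qed
  also have "\<dots> = (\<integral>\<^sup>+ z\<in>Q 0. ennreal (A (g z)) \<partial>M) + (\<Sum>j. ?At (x j) * ennreal (\<rho> j ^ n))"
    by (subst nn_integral_add) (auto simp: nn_integral_suminf nn_integral_cmult_indicator Q \<rho>_def)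
  also have "(\<Sum>j. ?At (x j) * ennreal (\<rho> j ^ n)) \<le>
     (\<Sum>j. ennreal (2 ^ (2 * n - 1) * \<kappa> powr ?q) * (\<integral>\<^sup>+ s\<in>{x j..<x (Suc j)}. ?At s * ennreal (s powr (- 1 - ?q)) \<partial>lborel))"
  proof (intro suminf_le allI)
    fix j
    have xS: "x (Suc j) = 2 ^ m * x j" by (simp add: x_def \<rho>_def power_divide power_mult_distrib)
    have le: "x j \<le> x (Suc j)" unfolding xS using x[of j] by simp
    \<comment> \<open>Volumes become powers of the dual variable, since
      \<open>m * (n / (n - 1)) = n\<close>. The sum over shells is thereby a Riemann sum of the tail
      integral.\<close>
    have rn1: "\<rho> j ^ n = \<kappa> powr ?q * x j powr - ?q"
    proof -
      have "x j powr - ?q = \<kappa> powr - ?q * (\<rho> j ^ m) powr ?q"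
        using \<rho>[of j] l by (simp add: x_def powr_divide powr_minus field_simps)
      also have "(\<rho> j ^ m) powr ?q = \<rho> j powr (real m * ?q)"
        using \<rho>[of j] by (simp add: powr_powr flip: powr_realpow)
      also have "real m * ?q = real n" using m by simp
      also have "\<rho> j powr real n = \<rho> j ^ n" using \<rho>[of j] by (rule powr_realpow)
      finally have "\<kappa> powr ?q * x j powr - ?q = (\<kappa> powr ?q * \<kappa> powr - ?q) * \<rho> j ^ n" by simp
      also have "\<kappa> powr ?q * \<kappa> powr - ?q = 1" using l by (simp add: powr_minus)
      finally show ?thesis by simp
    qed
    \<comment> \<open>The constant is the loss from evaluating the power at the right end
      \<open>2 ^ m * x j\<close>: with \<open>q = n / (n - 1)\<close>,
      \<open>(2 ^ m) powr (- 1 - q) = 2 powr - (2 * n - 1)\<close>. The length of the interval is at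
      least \<open>x j\<close>, as \<open>2 ^ m - 1 \<ge> 1\<close>.\<close>
    have rn2: "x j powr - ?q \<le> 2 ^ (2 * n - 1) * ((x (Suc j) - x j) * x (Suc j) powr (- 1 - ?q))"
    proof -
      have "(2 ^ m :: real) powr (- 1 - ?q) = 2 powr (real m * (- 1 - ?q))"
        by (simp add: powr_powr flip: powr_realpow)
      also have "real m * (- 1 - ?q) = - real (2 * n - 1)"
      proof -
        have "real m * ?q = real n" using m by simp
        then show ?thesis using m by (simp add: right_diff_distrib)
      qed
      also have "2 powr - real (2 * n - 1) = 1 / (2::real) ^ (2 * n - 1)"
        by (simp only: powr_minus_divide powr_realpow zero_less_numeral)
      finally have e: "2 ^ (2 * n - 1) * (2 ^ m :: real) powr (- 1 - ?q) = 1" by simp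
      have "x j * x j powr (- 1 - ?q) = x j powr (1 + (- 1 - ?q))" using x[of j] by (simp only: powr_add) simp
      then have e2: "x j * x j powr (- 1 - ?q) = x j powr - ?q" by simp
      have "2 ^ (2 * n - 1) * ((x (Suc j) - x j) * x (Suc j) powr (- 1 - ?q))
        = (2 ^ m - 1) * (2 ^ (2 * n - 1) * (2 ^ m) powr (- 1 - ?q)) * (x j * x j powr (- 1 - ?q))"
        unfolding xS using x[of j] by (simp add: powr_mult algebra_simps)
      also have "\<dots> = (2 ^ m - 1) * x j powr - ?q" unfolding e e2 by simp
      also have "\<dots> \<ge> 1 * x j powr - ?q"
        using m power_increasing[of 1 m "2::real"] by (intro mult_right_mono) auto
      finally show ?thesis by simp
    qed
    have rn: "\<rho> j ^ n \<le> 2 ^ (2 * n - 1) * \<kappa> powr ?q * ((x (Suc j) - x j) * x (Suc j) powr (- 1 - ?q))"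
    proof -
      have "\<kappa> powr ?q * x j powr - ?q \<le> \<kappa> powr ?q * (2 ^ (2 * n - 1) * ((x (Suc j) - x j) * x (Suc j) powr (- 1 - ?q)))"
        by (rule mult_left_mono[OF rn2]) simp
      then show ?thesis unfolding rn1 by (simp only: mult_ac)
    qed
    have "?At (x j) * ennreal (\<rho> j ^ n) \<le> ?At (x j) * ennreal (2 ^ (2 * n - 1) * \<kappa> powr ?q * ((x (Suc j) - x j) * x (Suc j) powr (- 1 - ?q)))"
      using rn by (intro mult_left_mono ennreal_leI) auto
    also have "\<dots> = ennreal (2 ^ (2 * n - 1) * \<kappa> powr ?q) * (?At (x j) * ennreal ((x (Suc j) - x j) * x (Suc j) powr (- 1 - ?q)))"
      using le by (subst ennreal_mult) (auto simp: mult_ac)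
    also have "\<dots> \<le> ennreal (2 ^ (2 * n - 1) * \<kappa> powr ?q) * (\<integral>\<^sup>+ s\<in>{x j..<x (Suc j)}. ?At s * ennreal (s powr (- 1 - ?q)) \<partial>lborel)"
      by (intro mult_left_mono young_tail_piece_ge x le n) auto
    finally show "?At (x j) * ennreal (\<rho> j ^ n) \<le> ennreal (2 ^ (2 * n - 1) * \<kappa> powr ?q) * (\<integral>\<^sup>+ s\<in>{x j..<x (Suc j)}. ?At s * ennreal (s powr (- 1 - ?q)) \<partial>lborel)" .
  qed auto
  also have "\<dots> = ennreal (2 ^ (2 * n - 1) * \<kappa> powr ?q) * (\<Sum>j. \<integral>\<^sup>+ s\<in>{x j..<x (Suc j)}. ?At s * ennreal (s powr (- 1 - ?q)) \<partial>lborel)"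
    by simp
  also have "\<dots> \<le> ennreal (2 ^ (2 * n - 1) * \<kappa> powr ?q) * young_tail n A (x 0)"
  proof (intro mult_left_mono young_pieces_le_tail)
    fix j
    have "x (Suc j) = 2 ^ m * x j" by (simp add: x_def \<rho>_def power_divide power_mult_distrib)
    then show "x j \<le> x (Suc j)" using x[of j] by simp
  qed simp
  finally have main: "ennreal (\<kappa> / 2) * (\<Sum>k. ennreal (1 / \<rho> k ^ m) * (\<integral>\<^sup>+ z\<in>Q k. ennreal (g z) \<partial>M))
    \<le> (\<integral>\<^sup>+ z\<in>Q 0. ennreal (A (g z)) \<partial>M) + ennreal (2 ^ (2 * n - 1) * \<kappa> powr ?q) * young_tail n A (x 0)"
    by (simp add: add_left_mono)
  let ?S = "(\<Sum>k. ennreal (1 / \<rho> k ^ m) * (\<integral>\<^sup>+ z\<in>Q k. ennreal (g z) \<partial>M))"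
  let ?I = "(\<integral>\<^sup>+ z\<in>Q 0. ennreal (A (g z)) \<partial>M)"
  \<comment> \<open>Undoing the factor 1/2 turns the constant into
    \<open>2 * 2 ^ (2 * n - 1) = 4 ^ n\<close>.\<close>
  have "ennreal \<kappa> * ?S = ennreal 2 * (ennreal (\<kappa> / 2) * ?S)"
    using l by (simp add: ennreal_mult[symmetric] mult.assoc[symmetric] del: ennreal_numeral)
  also have "\<dots> \<le> ennreal 2 * (?I + ennreal (2 ^ (2 * n - 1) * \<kappa> powr ?q) * young_tail n A (x 0))"
    by (intro mult_left_mono main) simp
  also have "\<dots> = ennreal 2 * ?I + ennreal 4 ^ n * (ennreal (\<kappa> powr ?q) * young_tail n A (x 0))"
  proof -
    have "(2::real) * 2 ^ (2 * n - 1) = 4 ^ n" using n by (simp add: power_mult flip: power_Suc)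
    then have "ennreal 2 * ennreal (2 ^ (2 * n - 1) * \<kappa> powr ?q) = ennreal (4 ^ n) * ennreal (\<kappa> powr ?q)"
      by (simp add: ennreal_mult[symmetric] mult.assoc[symmetric] del: ennreal_numeral)
    then show ?thesis by (simp add: distrib_left mult.assoc[symmetric] ennreal_power del: ennreal_numeral)
  qed
  also have "\<dots> \<le> ennreal 4 ^ n * ?I + ennreal 4 ^ n * (ennreal (\<kappa> powr ?q) * young_tail n A (x 0))"
  proof (intro add_right_mono mult_right_mono)
    have "(2::real) \<le> 4 ^ n" using n power_increasing[of 1 n "4::real"] by simp
    then show "ennreal 2 \<le> ennreal 4 ^ n" by (simp add: ennreal_power del: ennreal_numeral)
  qed simp
  finally show ?thesis
    by (simp add: distrib_left ennreal_power x_def \<rho>_def m_def del: ennreal_numeral)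
qed

section \<open>Closed cubes and their contractions towards a point\<close>

definition cube :: "real^'n \<Rightarrow> real \<Rightarrow> (real^'n) set" where
  "cube a r = cbox a (\<chi> j. a $ j + r)"

lemma mem_cube: "x \<in> cube a r \<longleftrightarrow> (\<forall>j. a $ j \<le> x $ j \<and> x $ j \<le> a $ j + r)"
  by (simp add: cube_def mem_box_cart)

lemma sets_cube [measurable]: "cube a r \<in> sets lebesgue"
  by (simp add: cube_def)

lemma emeasure_cube:
  fixes a :: "real^'n"
  assumes "0 \<le> r"
  shows "emeasure lebesgue (cube a r) = ennreal (r ^ CARD('n))"
proof -
  have eq: "((\<chi> j. a $ j + r) - a) \<bullet> b = r" if "b \<in> Basis" for b
    using that by (auto simp: Basis_vec_def inner_axis)
  have "emeasure lborel (cube a r) = (\<Prod>b\<in>(Basis :: (real^'n) set). ((\<chi> j. a $ j + r) - a) \<bullet> b)"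
    unfolding cube_def using assms eq
    by (intro emeasure_lborel_cbox) (metis diff_ge_0_iff_ge inner_diff_left)
  also have "(\<Prod>b\<in>(Basis :: (real^'n) set). ((\<chi> j. a $ j + r) - a) \<bullet> b) = r ^ CARD('n)"
    using eq by simp
  finally show ?thesis by (simp add: cube_def)
qed

lemma dist_cube_le:
  fixes x :: "real^'n"
  assumes "x \<in> cube a r" "y \<in> cube a r"
  shows "dist x y \<le> real CARD('n) * r"
proof -
  have "dist x y \<le> (\<Sum>j\<in>UNIV. \<bar>(x - y) $ j\<bar>)" unfolding dist_norm by (rule norm_le_l1_cart)
  also have "\<dots> \<le> (\<Sum>j\<in>(UNIV::'n set). r)"
  proof (rule sum_mono)
    fix j show "\<bar>(x - y) $ j\<bar> \<le> r"
      using assms[unfolded mem_cube, THEN spec[of _ j]] by (simp add: abs_le_iff)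
  qed
  finally show ?thesis by simp
qed

text \<open>The image of the corner \<open>a\<close> under the homothety with centre
  \<open>x\<close> and ratio \<open>1 / 2 ^ k\<close>. Contracting towards \<open>x\<close> keeps
  its relative position, so the cubes are nested, contain \<open>x\<close> even when it lies on a
  face, and never leave the initial cube.\<close>

definition zoom_corner :: "real^'n \<Rightarrow> real^'n \<Rightarrow> nat \<Rightarrow> real^'n" where
  "zoom_corner x a k = (\<chi> j. x $ j - (x $ j - a $ j) / 2 ^ k)"

lemma zoom_0: "zoom_corner x a 0 = a"
  by (simp add: zoom_corner_def vec_eq_iff)

lemma mem_zoom: "x \<in> cube a r \<Longrightarrow> x \<in> cube (zoom_corner x a k) (r / 2 ^ k)"
  unfolding mem_cube zoom_corner_def
  by (auto simp: diff_divide_distrib[symmetric] add_divide_distrib[symmetric] field_simps)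

lemma zoom_mono:
  assumes "x \<in> cube a r" "k \<le> l"
  shows "zoom_corner x a k $ j \<le> zoom_corner x a l $ j"
    "zoom_corner x a l $ j + r / 2 ^ l \<le> zoom_corner x a k $ j + r / 2 ^ k"
proof -
  have xa: "0 \<le> x $ j - a $ j" "0 \<le> r - (x $ j - a $ j)" using assms(1) by (auto simp: mem_cube algebra_simps)
  have *: "y / 2 ^ l \<le> y / 2 ^ k" if "0 \<le> y" for y :: real
    using assms(2) that by (intro divide_left_mono power_increasing) auto
  show "zoom_corner x a k $ j \<le> zoom_corner x a l $ j"
    using *[OF xa(1)] by (simp add: zoom_corner_def)
  show "zoom_corner x a l $ j + r / 2 ^ l \<le> zoom_corner x a k $ j + r / 2 ^ k"
    using *[OF xa(2)] by (simp add: zoom_corner_def diff_divide_distrib)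
qed

lemma zoom_subset:
  assumes "x \<in> cube a r" "k \<le> l"
  shows "cube (zoom_corner x a l) (r / 2 ^ l) \<subseteq> cube (zoom_corner x a k) (r / 2 ^ k)"
  using zoom_mono[OF assms] unfolding mem_cube subset_iff by (meson order_trans)

lemma zoom_subset_cube:
  assumes "x \<in> cube a r"
  shows "cube (zoom_corner x a k) (r / 2 ^ k) \<subseteq> cube a r"
  using zoom_subset[OF assms, of 0 k] by (simp add: zoom_0)

definition zoom_bump :: "(real \<Rightarrow> real) \<Rightarrow> real^'n \<Rightarrow> real^'n \<Rightarrow> real \<Rightarrow> nat \<Rightarrow> 'n \<Rightarrow> real \<Rightarrow> real" where
  "zoom_bump h x a r k j = (\<lambda>y. (1 / (r / 2 ^ k)) * h ((1 / (r / 2 ^ k)) * y + (- (zoom_corner x a k $ j) / (r / 2 ^ k))))"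

lemma zoom_bump_bump:
  assumes "bump_on 0 1 h" "0 < r"
  shows "bump_on (zoom_corner x a k $ j) ((\<chi> j. zoom_corner x a k $ j + r / 2 ^ k) $ j) (zoom_bump h x a r k j)"
  using bump_on_scaled[OF assms(1), of "r / 2 ^ k" "zoom_corner x a k $ j"] assms(2)
  unfolding zoom_bump_def by simp

text \<open>The bound of the finer level \<open>l\<close> also covers the coarser level
  \<open>k\<close>, so that two consecutive scales share the single constant \<open>D\<close> of
  \<open>avg_change\<close>.\<close>

lemma zoom_bump_le:
  assumes "\<And>y. h y \<le> D" "0 < r" "k \<le> l" "0 \<le> D"
  shows "zoom_bump h x a r k j y \<le> D * 2 ^ l / r"
proof -
  have "zoom_bump h x a r k j y \<le> 1 / (r / 2 ^ k) * D"
    unfolding zoom_bump_def using assms by (intro mult_left_mono) auto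
  also have "\<dots> = D / r * 2 ^ k" by simp
  also have "\<dots> \<le> D / r * 2 ^ l" using assms by (intro mult_left_mono power_increasing) auto
  finally show ?thesis by simp
qed

context sobolev_map
begin

text \<open>The supports shrink to \<open>x\<close> and \<open>u\<close> is continuous there. It is
  here that the continuous representative turns statements on averages into statements on point
  values.\<close>

lemma avg_zoom_tendsto:
  assumes h: "bump_on 0 1 h" and r: "0 < r" and x: "x \<in> cube a r" and sub: "cube a r \<subseteq> \<Omega>"
  shows "(\<lambda>k. avg c (zoom_bump h x a r k)) \<longlonglongrightarrow> u x $ c"
proof (rule LIMSEQ_I)
  fix e :: real assume e: "0 < e"
  have "continuous_on \<Omega> (\<lambda>y. u y $ c)" by (intro continuous_intros cont)
  then obtain d where d: "0 < d" "\<And>y. y \<in> \<Omega> \<Longrightarrow> dist y x < d \<Longrightarrow> dist (u y $ c) (u x $ c) < e / 2"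
    using x sub e unfolding continuous_on_iff by (metis half_gt_zero subsetD)
  have "(\<lambda>k. real CARD('n) * (r * (1 / 2) ^ k)) \<longlonglongrightarrow> real CARD('n) * (r * 0)"
    by (intro tendsto_mult tendsto_const LIMSEQ_power_zero) auto
  then have "\<forall>\<^sub>F k in sequentially. real CARD('n) * (r * (1 / 2) ^ k) < d"
    using d(1) by (intro order_tendstoD(2)) auto
  then obtain N where N: "\<And>k. k \<ge> N \<Longrightarrow> real CARD('n) * (r * (1 / 2) ^ k) < d"
    by (auto simp: eventually_sequentially)
  show "\<exists>N. \<forall>k\<ge>N. norm (avg c (zoom_bump h x a r k) - u x $ c) < e"
  proof (intro exI allI impI)
    fix k assume k: "N \<le> k"
    let ?Q = "cube (zoom_corner x a k) (r / 2 ^ k)"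
    have "\<bar>avg c (zoom_bump h x a r k) - u x $ c\<bar> \<le> e / 2"
    proof (rule avg_near[OF zoom_bump_bump[OF h r]])
      show "cbox (zoom_corner x a k) (\<chi> j. zoom_corner x a k $ j + r / 2 ^ k) \<subseteq> \<Omega>"
        using zoom_subset_cube[OF x, of k] sub by (simp add: cube_def)
      fix y assume "y \<in> cbox (zoom_corner x a k) (\<chi> j. zoom_corner x a k $ j + r / 2 ^ k)"
      then have y: "y \<in> ?Q" by (simp add: cube_def)
      have "dist y x \<le> real CARD('n) * (r / 2 ^ k)" by (rule dist_cube_le[OF y mem_zoom[OF x]])
      also have "\<dots> < d" using N[OF k] by (simp add: power_one_over field_simps)
      finally have "dist (u y $ c) (u x $ c) < e / 2"
        using y zoom_subset_cube[OF x, of k] sub by (intro d) auto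
      then show "\<bar>u y $ c - u x $ c\<bar> \<le> e / 2" by (simp add: dist_real_def)
    qed
    then show "norm (avg c (zoom_bump h x a r k) - u x $ c) < e" using e by simp
  qed
qed

text \<open>In dimension one the factor \<open>D ^ (n - 1)\<close> equals 1. Concentrated densities
  at \<open>x\<close> and at \<open>y\<close> can be compared directly on the whole interval, with a
  bound that does not deteriorate as \<open>k\<close> grows.\<close>

lemma oscillation_dim1:
  assumes n1: "CARD('n) = 1" and r: "0 < r" and xy: "x \<in> cube a r" "y \<in> cube a r" and sub: "cube a r \<subseteq> \<Omega>"
  shows "ennreal \<bar>u x $ c - u y $ c\<bar> \<le> (\<integral>\<^sup>+ z\<in>cube a r. ennreal (norm (G z)) \<partial>lebesgue)"
proof -
  obtain h :: "real \<Rightarrow> real" and D where h: "bump_on 0 1 h" "\<And>y. h y \<le> D" "1 \<le> D"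
    using bump_exists unfolding bump_on_def by metis
  have "(\<lambda>k. ennreal \<bar>avg c (zoom_bump h x a r k) - avg c (zoom_bump h y a r k)\<bar>) \<longlonglongrightarrow> ennreal \<bar>u x $ c - u y $ c\<bar>"
    by (intro tendsto_ennrealI tendsto_rabs tendsto_diff avg_zoom_tendsto h r xy sub)
  then show ?thesis
  proof (rule Lim_bounded)
    show "\<forall>k\<ge>0. ennreal \<bar>avg c (zoom_bump h x a r k) - avg c (zoom_bump h y a r k)\<bar> \<le> (\<integral>\<^sup>+ z\<in>cube a r. ennreal (norm (G z)) \<partial>lebesgue)"
    proof (intro allI impI)
      fix k
      have b: "bump_on (a $ j) ((\<chi> j. a $ j + r) $ j) (zoom_bump h w a r k j)" if "w \<in> cube a r" for w j
        using bump_on_mono[OF zoom_bump_bump[OF h(1) r]] zoom_mono[OF that, of 0 k j] by (simp add: zoom_0)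
      have "ennreal \<bar>avg c (zoom_bump h x a r k) - avg c (zoom_bump h y a r k)\<bar>
        \<le> ennreal (real CARD('n) * (D * 2 ^ k / r) ^ (CARD('n) - 1)) * (\<integral>\<^sup>+ z\<in>cbox a (\<chi> j. a $ j + r). ennreal (norm (G z)) \<partial>lebesgue)"
        using sub h r by (intro avg_change b xy zoom_bump_le) (auto simp: cube_def)
      then show "ennreal \<bar>avg c (zoom_bump h x a r k) - avg c (zoom_bump h y a r k)\<bar> \<le> (\<integral>\<^sup>+ z\<in>cube a r. ennreal (norm (G z)) \<partial>lebesgue)"
        using n1 by (simp add: cube_def)
    qed
  qed
qed

text \<open>The averages are telescoped down to the value at \<open>x\<close>. Both densities of a
  step live in the cube of level \<open>k\<close> and are at most \<open>D * 2 ^ Suc k / r\<close>;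
  the power \<open>n - 1\<close> of this bound splits into \<open>(2 * D) ^ (n - 1)\<close> and the
  weight of level \<open>k\<close>.\<close>

lemma avg_zoom_series:
  assumes h: "bump_on 0 1 h" "\<And>y. h y \<le> D" "1 \<le> D" and r: "0 < r" and x: "x \<in> cube a r" and sub: "cube a r \<subseteq> \<Omega>"
  shows "ennreal \<bar>u x $ c - avg c (zoom_bump h x a r 0)\<bar> \<le>
    ennreal (real CARD('n) * (2 * D) ^ (CARD('n) - 1)) * (\<Sum>k. ennreal (1 / (r / 2 ^ k) ^ (CARD('n) - 1)) *
       (\<integral>\<^sup>+ z\<in>cube (zoom_corner x a k) (r / 2 ^ k). ennreal (norm (G z)) \<partial>lebesgue))"
    (is "_ \<le> ?C * (\<Sum>k. ?w k * ?I k)")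
proof -
  let ?M = "\<lambda>k. avg c (zoom_bump h x a r k)"
  have step: "ennreal \<bar>?M (Suc k) - ?M k\<bar> \<le> ?C * (?w k * ?I k)" for k
  proof -
    have b: "bump_on (zoom_corner x a k $ j) ((\<chi> j. zoom_corner x a k $ j + r / 2 ^ k) $ j) (zoom_bump h x a r l j)" if "k \<le> l" for l j
      using bump_on_mono[OF zoom_bump_bump[OF h(1) r]] zoom_mono[OF x that, of j] by simp
    have "ennreal \<bar>?M (Suc k) - ?M k\<bar> \<le> ennreal (real CARD('n) * (D * 2 ^ Suc k / r) ^ (CARD('n) - 1)) *
       (\<integral>\<^sup>+ z\<in>cbox (zoom_corner x a k) (\<chi> j. zoom_corner x a k $ j + r / 2 ^ k). ennreal (norm (G z)) \<partial>lebesgue)"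
      using zoom_subset_cube[OF x, of k] sub h r by (intro avg_change b zoom_bump_le) (auto simp: cube_def)
    also have "real CARD('n) * (D * 2 ^ Suc k / r) ^ (CARD('n) - 1)
       = (real CARD('n) * (2 * D) ^ (CARD('n) - 1)) * (1 / (r / 2 ^ k) ^ (CARD('n) - 1))"
      by (simp add: power_divide power_mult_distrib field_simps)
    also have "ennreal \<dots> = ?C * ?w k" using h(3) by (intro ennreal_mult') simp
    finally show ?thesis by (simp only: mult.assoc cube_def)
  qed
  have part: "ennreal \<bar>?M N - ?M 0\<bar> \<le> (\<Sum>k<N. ?C * (?w k * ?I k))" for N
  proof (induction N)
    case (Suc N)
    have "ennreal \<bar>?M (Suc N) - ?M 0\<bar> \<le> ennreal (\<bar>?M N - ?M 0\<bar> + \<bar>?M (Suc N) - ?M N\<bar>)"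
      by (intro ennreal_leI) linarith
    also have "\<dots> = ennreal \<bar>?M N - ?M 0\<bar> + ennreal \<bar>?M (Suc N) - ?M N\<bar>" by simp
    also have "\<dots> \<le> (\<Sum>k<N. ?C * (?w k * ?I k)) + ?C * (?w N * ?I N)" by (intro add_mono Suc step)
    finally show ?case by simp
  qed simp
  have "(\<lambda>k. ennreal \<bar>?M k - ?M 0\<bar>) \<longlonglongrightarrow> ennreal \<bar>u x $ c - ?M 0\<bar>"
    by (intro tendsto_ennrealI tendsto_rabs tendsto_diff avg_zoom_tendsto h r x sub tendsto_const)
  then have "ennreal \<bar>u x $ c - ?M 0\<bar> \<le> (\<Sum>k. ?C * (?w k * ?I k))"
  proof (rule Lim_bounded)
    show "\<forall>N\<ge>0. ennreal \<bar>?M N - ?M 0\<bar> \<le> (\<Sum>k. ?C * (?w k * ?I k))"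
      using order_trans[OF part sum_le_suminf[OF summableI]] by auto
  qed
  then show ?thesis by simp
qed

end

lemma young_fun_supporting_line:
  assumes A: "young_fun A" and t: "0 < t"
  obtains p where "\<And>x. 0 \<le> x \<Longrightarrow> A t + p * (x - t) \<le> A x"
proof -
  have "convex_on {0..} A" using A by (simp add: young_fun_def)
  then have "A t + Inf ((\<lambda>s. (A t - A s) / (t - s)) ` ({t<..} \<inter> {0..})) * (x - t) \<le> A x" if "0 \<le> x" for x
    using t that by (intro convex_le_Inf_differential) (auto intro: interiorI[of "{0<..}"])
  then show ?thesis using that by blast
qed

text \<open>Nothing is known about \<open>A\<close> on negative numbers, so the argument is
  truncated at 0 to obtain a monotone function on the whole line.\<close>

lemma young_fun_measurable:
  assumes A: "young_fun A"
  shows "(\<lambda>t. A (max 0 t)) \<in> borel_measurable borel"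
proof (rule borel_measurable_mono)
  show "mono (\<lambda>t. A (max 0 t))"
    unfolding mono_def using young_fun_mono[OF A] by (auto simp: max_def)
qed

text \<open>Jensen's inequality by integrating a supporting line at the mean \<open>t\<close>. The
  line is multiplied by the indicator of \<open>Q\<close>, so its integral is exactly
  \<open>A t * r\<close>.\<close>

lemma young_jensen:
  assumes A: "young_fun A" and Q: "Q \<in> sets M" "emeasure M Q = ennreal r" "0 < r"
    and g: "integrable M (\<lambda>z. indicator Q z * g z)" "\<And>z. 0 \<le> g z"
    and m: "(\<integral>\<^sup>+ z\<in>Q. ennreal (A (g z)) \<partial>M) = ennreal m" "0 \<le> m"
  shows "A ((\<integral>z. indicator Q z * g z \<partial>M) / r) \<le> m / r"
proof -
  define t where "t = (\<integral>z. indicator Q z * g z \<partial>M) / r"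
  have t0: "0 \<le> t" unfolding t_def using g(2) Q by (intro divide_nonneg_nonneg integral_nonneg) auto
  show ?thesis
  \<comment> \<open>Supporting lines are available at interior points only; at the end point 0 the
    claim is \<open>A 0 = 0\<close>.\<close>
  proof (cases "t = 0")
    case True
    then show ?thesis using A m Q unfolding t_def[symmetric] by (simp add: young_fun_def)
  next
    case False
    then obtain p where p: "\<And>x. 0 \<le> x \<Longrightarrow> A t + p * (x - t) \<le> A x"
      using young_fun_supporting_line[OF A, of t] t0 by auto
    have indQ: "integrable M (indicator Q :: _ \<Rightarrow> real)" "(\<integral>z. indicator Q z \<partial>M) = r"
      using Q by (auto simp: integrable_indicator_iff measure_def)
    let ?f = "\<lambda>z. (A t - p * t) * indicator Q z + p * (indicator Q z * g z)"
    have int: "integrable M ?f" using g indQ by (intro Bochner_Integration.integrable_add integrable_mult_right) auto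
    have "(\<integral>z. ?f z \<partial>M) = (A t - p * t) * r + p * (t * r)"
      using g indQ Q by (simp add: t_def)
    also have "\<dots> = A t * r" by (simp add: algebra_simps)
    finally have I: "(\<integral>z. ?f z \<partial>M) = A t * r" .
    have "ennreal (A t * r) \<le> (\<integral>\<^sup>+ z. ennreal (?f z) \<partial>M)"
    proof -
      \<comment> \<open>The affine minorant may be negative, and \<open>ennreal\<close> cuts it off
        at 0. Passing to the positive part can only increase the integral.\<close>
      have intm: "integrable M (\<lambda>z. max 0 (?f z))" using int by (intro integrable_max) auto
      have "ennreal (\<integral>z. ?f z \<partial>M) \<le> ennreal (\<integral>z. max 0 (?f z) \<partial>M)"
        using int intm by (intro ennreal_leI integral_mono) auto
      also have "\<dots> = (\<integral>\<^sup>+ z. ennreal (max 0 (?f z)) \<partial>M)"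
        by (rule nn_integral_eq_integral[OF intm, symmetric]) simp
      also have "\<dots> = (\<integral>\<^sup>+ z. ennreal (?f z) \<partial>M)"
        by (intro nn_integral_cong) (simp add: max_def ennreal_neg)
      finally show ?thesis unfolding I .
    qed
    also have "\<dots> \<le> (\<integral>\<^sup>+ z\<in>Q. ennreal (A (g z)) \<partial>M)"
    proof (rule nn_integral_mono)
      fix z
      show "ennreal (?f z) \<le> ennreal (A (g z)) * indicator Q z"
        using p[OF g(2)[of z]] by (auto split: split_indicator intro!: ennreal_leI simp: algebra_simps)
    qed
    finally have "A t * r \<le> m" using m by simp
    then show ?thesis using Q unfolding t_def[symmetric] by (simp add: pos_le_divide_eq)
  qed
qed

section \<open>The oscillation of \<open>u\<close> on a cube in terms of \<open>b\<close>\<close>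

context sobolev_map
begin

text \<open>The constant is uniform over all cubes inside \<open>\<Omega>\<close> and over both
  points. The requirement \<open>1 \<le> C\<close> lets \<open>2 * C\<close> act as an admissible
  dilation factor for \<open>\<phi>\<close> later.\<close>

definition morrey_constant :: "(real \<Rightarrow> real) \<Rightarrow> real \<Rightarrow> real \<Rightarrow> bool" where
  "morrey_constant A l C \<longleftrightarrow> 1 \<le> C \<and> (\<forall>a r m x y. 0 < r \<longrightarrow> cube a r \<subseteq> \<Omega> \<longrightarrow> 0 \<le> m \<longrightarrow>
     (\<integral>\<^sup>+ z\<in>cube a r. ennreal (A (norm (G z) / l)) \<partial>lebesgue) = ennreal m \<longrightarrow>
     x \<in> cube a r \<longrightarrow> y \<in> cube a r \<longrightarrow>
     norm (u x - u y) \<le> C * (r * young_inv (young_B CARD('n) A) (m / r ^ CARD('n))))"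

text \<open>In dimension one Jensen's inequality bounds the mean of the gradient. In higher
  dimension the telescoped averages and the dyadic potential give, for every
  \<open>\<kappa>\<close>, precisely the condition that characterises sublevel sets of
  \<open>B\<close>. Components are treated one by one and added.\<close>

lemma morrey_constant_exists:
  assumes A: "young_fun A" and C1: "cond_C1 CARD('n) A" and C2: "cond_C2 A" and l: "0 < l"
  shows "\<exists>C. morrey_constant A l C"
proof -
  have n: "1 \<le> CARD('n)" by (simp add: Suc_leI)
  let ?b = "young_inv (young_B CARD('n) A)"
  have "\<exists>C\<ge>0. \<forall>a r m x y c. 0 < r \<longrightarrow> cube a r \<subseteq> \<Omega> \<longrightarrow> 0 \<le> m \<longrightarrow>
      (\<integral>\<^sup>+ z\<in>cube a r. ennreal (A (norm (G z) / l)) \<partial>lebesgue) = ennreal m \<longrightarrow>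
      x \<in> cube a r \<longrightarrow> y \<in> cube a r \<longrightarrow> \<bar>u x $ c - u y $ c\<bar> \<le> C * (r * ?b (m / r ^ CARD('n)))"
  proof (cases "CARD('n) = 1")
    case True
    have "\<bar>u x $ c - u y $ c\<bar> \<le> l * (r * ?b (m / r ^ CARD('n)))"
      if *: "0 < r" "cube a r \<subseteq> \<Omega>" "0 \<le> m" "(\<integral>\<^sup>+ z\<in>cube a r. ennreal (A (norm (G z) / l)) \<partial>lebesgue) = ennreal m"
        "x \<in> cube a r" "y \<in> cube a r" for a r m x y c
    proof -
      have int: "integrable lebesgue (\<lambda>z. indicator (cube a r) z * norm (G z))"
        using set_integrable_cbox(3)[of a "\<chi> j. a $ j + r"] *(2) by (simp add: cube_def set_integrable_def)
      have int': "integrable lebesgue (\<lambda>z. indicator (cube a r) z * (norm (G z) / l))"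
        using integrable_divide[OF int, of l] by simp
      let ?t = "(\<integral>z. indicator (cube a r) z * (norm (G z) / l) \<partial>lebesgue) / r"
      have t0: "0 \<le> ?t" using l * by (intro divide_nonneg_nonneg integral_nonneg) auto
      have "A ?t \<le> m / r"
        using young_jensen[OF A sets_cube _ *(1) int' _ *(4,3)] emeasure_cube[of r a] *(1) l True by simp
      then have "young_B CARD('n) A ?t \<le> ennreal (m / r ^ CARD('n))"
        using True young_B_one[of A ?t] by (simp add: ennreal_leI)
      then have t: "?t \<le> ?b (m / r ^ CARD('n))"
        using young_inv_ge_iff[OF n A C1 C2, of "m / r ^ CARD('n)" ?t] t0 * by simp
      have "ennreal \<bar>u x $ c - u y $ c\<bar> \<le> (\<integral>\<^sup>+ z\<in>cube a r. ennreal (norm (G z)) \<partial>lebesgue)"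
        by (rule oscillation_dim1[OF True *(1,5,6,2)])
      also have "\<dots> = (\<integral>\<^sup>+ z. ennreal (indicator (cube a r) z * norm (G z)) \<partial>lebesgue)"
        by (auto intro!: nn_integral_cong split: split_indicator)
      also have "\<dots> = ennreal (\<integral>z. indicator (cube a r) z * norm (G z) \<partial>lebesgue)"
        by (rule nn_integral_eq_integral[OF int]) auto
      finally have "\<bar>u x $ c - u y $ c\<bar> \<le> (\<integral>z. indicator (cube a r) z * norm (G z) \<partial>lebesgue)"
        by (subst (asm) ennreal_le_iff) (auto intro!: integral_nonneg)
      also have "\<dots> = l * (r * ?t)"
        using l *(1) by simp
      also have "\<dots> \<le> l * (r * ?b (m / r ^ CARD('n)))"
        using t l *(1) by (intro mult_left_mono) auto
      finally show ?thesis .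
    qed
    then show ?thesis using l by (intro exI[of _ l]) auto
  next
    case False
    then have n2: "2 \<le> CARD('n)" using n by linarith
    obtain h :: "real \<Rightarrow> real" and D where h: "bump_on 0 1 h" "\<And>y. h y \<le> D" "1 \<le> D"
      using bump_exists unfolding bump_on_def by metis
    define c0 where "c0 = real CARD('n) * (2 * D) ^ (CARD('n) - 1)"
    have c0: "0 < c0" using h(3) n by (simp add: c0_def)
    define c1 where "c1 = c0 * l * 4 ^ CARD('n)"
    have c1: "0 < c1" using c0 l by (simp add: c1_def)
    have one: "\<bar>u x $ c - avg c (zoom_bump h x a r 0)\<bar> \<le> c1 * (r * ?b (m / r ^ CARD('n)))"
      if *: "0 < r" "cube a r \<subseteq> \<Omega>" "0 \<le> m" "(\<integral>\<^sup>+ z\<in>cube a r. ennreal (A (norm (G z) / l)) \<partial>lebesgue) = ennreal m"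
        "x \<in> cube a r" for a r m x c
    proof -
      \<comment> \<open>\<open>G\<close> is controlled on \<open>\<Omega>\<close> only; cutting off
        outside the cube makes \<open>g\<close> measurable on the whole space, without changing
        integrals over the zoomed cubes.\<close>
      define g where "g z = indicator (cube a r) z * (norm (G z) / l)" for z
      let ?Q = "\<lambda>k. cube (zoom_corner x a k) (r / 2 ^ k)"
      have int: "integrable lebesgue (\<lambda>z. indicator (cube a r) z * norm (G z))"
        using set_integrable_cbox(3)[of a "\<chi> j. a $ j + r"] *(2) by (simp add: cube_def set_integrable_def)
      have gm: "g \<in> borel_measurable lebesgue"
        using borel_measurable_integrable[OF integrable_divide[OF int, of l]] by (simp add: g_def[abs_def])
      have g0: "0 \<le> g z" for z using l by (simp add: g_def)
      have Agm: "(\<lambda>z. ennreal (A (g z))) \<in> borel_measurable lebesgue"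
        using measurable_compose[OF gm young_fun_measurable[OF A]] g0 by (simp add: max_absorb2)
      have Q0: "?Q 0 = cube a r" by (simp add: zoom_0)
      have null: "AE z in lebesgue. \<exists>k. z \<notin> ?Q k"
      proof -
        have "AE z in lebesgue. z \<noteq> x"
          by (rule AE_I'[of "{x}"]) auto
        then show ?thesis
        proof eventually_elim
          case (elim z)
          show "\<exists>k. z \<notin> ?Q k"
          proof (rule ccontr)
            assume "\<not> (\<exists>k. z \<notin> ?Q k)"
            then have "dist z x \<le> real CARD('n) * (r / 2 ^ k)" for k
              using dist_cube_le[of z _ _ x] mem_zoom[OF *(5), of k] by blast
            then have "dist z x \<le> real CARD('n) * (r * (1 / 2) ^ k)" for k by (simp add: power_one_over)
            then have le: "\<exists>N. \<forall>k\<ge>N. dist z x \<le> real CARD('n) * (r * (1 / 2) ^ k)" by blast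
            have "(\<lambda>k. real CARD('n) * (r * (1 / 2) ^ k)) \<longlonglongrightarrow> real CARD('n) * (r * 0)"
              by (intro tendsto_mult tendsto_const LIMSEQ_power_zero) auto
            then have "dist z x \<le> real CARD('n) * (r * 0)" using le by (rule LIMSEQ_le_const)
            then show False using elim by simp
          qed
        qed
      qed
      define X where "X = (\<Sum>k. ennreal (1 / (r / 2 ^ k) ^ (CARD('n) - 1)) * (\<integral>\<^sup>+ z\<in>?Q k. ennreal (g z) \<partial>lebesgue))"
      have intA: "(\<integral>\<^sup>+ z\<in>?Q 0. ennreal (A (g z)) \<partial>lebesgue) = ennreal m"
        unfolding *(4)[symmetric] Q0 by (auto intro!: nn_integral_cong split: split_indicator simp: g_def)
      have pot: "ennreal \<kappa> * X \<le> ennreal (4 ^ CARD('n)) * (ennreal m +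
        ennreal (\<kappa> powr (real CARD('n) / (real CARD('n) - 1))) * young_tail CARD('n) A (\<kappa> / r ^ (CARD('n) - 1)))"
        if "0 < \<kappa>" for \<kappa>
        unfolding X_def intA[symmetric]
      proof (rule dyadic_potential_le[OF n2 A *(1) that _ _ _ null gm g0 Agm])
        show "?Q (Suc k) \<subseteq> ?Q k" for k by (intro zoom_subset *(5)) simp
        show "emeasure lebesgue (?Q k) = ennreal ((r / 2 ^ k) ^ CARD('n))" for k
          using *(1) by (intro emeasure_cube) simp
      qed simp
      define t where "t = \<bar>u x $ c - avg c (zoom_bump h x a r 0)\<bar>"
      have "ennreal t \<le> ennreal c0 * (\<Sum>k. ennreal (1 / (r / 2 ^ k) ^ (CARD('n) - 1)) *
         (\<integral>\<^sup>+ z\<in>?Q k. ennreal (norm (G z)) \<partial>lebesgue))"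
        unfolding c0_def t_def by (rule avg_zoom_series[OF h *(1,5,2)])
      also have "\<dots> = ennreal c0 * (\<Sum>k. ennreal (1 / (r / 2 ^ k) ^ (CARD('n) - 1)) *
         (ennreal l * (\<integral>\<^sup>+ z\<in>?Q k. ennreal (g z) \<partial>lebesgue)))"
      proof (intro arg_cong[where f = "\<lambda>s. ennreal c0 * suminf s"] ext arg_cong2[where f = "(*)"] refl)
        fix k
        have "ennreal l * (\<integral>\<^sup>+ z\<in>?Q k. ennreal (g z) \<partial>lebesgue) = (\<integral>\<^sup>+ z. ennreal l * (ennreal (g z) * indicator (?Q k) z) \<partial>lebesgue)"
          by (intro nn_integral_cmult[symmetric] borel_measurable_times_ennreal
              measurable_compose[OF gm measurable_ennreal] borel_measurable_indicator sets_cube)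
        also have "\<dots> = (\<integral>\<^sup>+ z\<in>?Q k. ennreal (norm (G z)) \<partial>lebesgue)"
          using zoom_subset_cube[OF *(5), of k] l
          by (intro nn_integral_cong) (auto split: split_indicator simp: g_def ennreal_mult'[symmetric])
        finally show "(\<integral>\<^sup>+ z\<in>?Q k. ennreal (norm (G z)) \<partial>lebesgue) = ennreal l * (\<integral>\<^sup>+ z\<in>?Q k. ennreal (g z) \<partial>lebesgue)" ..
      qed
      also have "\<dots> = ennreal (c0 * l) * X"
      proof -
        have "(\<lambda>k. ennreal (1 / (r / 2 ^ k) ^ (CARD('n) - 1)) * (ennreal l * (\<integral>\<^sup>+ z\<in>?Q k. ennreal (g z) \<partial>lebesgue)))
          = (\<lambda>k. ennreal l * (ennreal (1 / (r / 2 ^ k) ^ (CARD('n) - 1)) * (\<integral>\<^sup>+ z\<in>?Q k. ennreal (g z) \<partial>lebesgue)))"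
          by (intro ext) (rule mult.left_commute)
        then show ?thesis unfolding X_def ennreal_mult'[OF less_imp_le[OF c0]] mult.assoc
          by (simp only: ennreal_suminf_cmult)
      qed
      finally have tX: "ennreal t \<le> ennreal (c0 * l) * X" .
      \<comment> \<open>This is the scaled criterion for \<open>B\<close> at \<open>t / c1\<close>.
        The constant \<open>c1\<close> collects the telescoping constant, the normalisation
        \<open>l\<close> and the \<open>4 ^ n\<close> of the potential estimate.\<close>
      have "\<kappa> * (t / c1) \<le> m + \<kappa> powr (real CARD('n) / (real CARD('n) - 1)) * enn2real (young_tail CARD('n) A (\<kappa> / r ^ (CARD('n) - 1)))"
        if \<kappa>: "0 < \<kappa>" for \<kappa>
      proof -
        let ?T = "young_tail CARD('n) A (\<kappa> / r ^ (CARD('n) - 1))"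
        let ?P = "\<kappa> powr (real CARD('n) / (real CARD('n) - 1))"
        have fin: "?T < \<infinity>" using \<kappa> *(1) by (intro young_tail_finite[OF n2 A C1 C2]) auto
        have "ennreal \<kappa> * ennreal t \<le> ennreal (c0 * l) * (ennreal \<kappa> * X)"
          using mult_left_mono[OF tX, of "ennreal \<kappa>"] by (simp add: mult_ac)
        also have "\<dots> \<le> ennreal (c0 * l) * (ennreal (4 ^ CARD('n)) * (ennreal m + ennreal ?P * ?T))"
          by (intro mult_left_mono pot \<kappa>) simp
        also have "\<dots> = ennreal (c0 * l) * (ennreal (4 ^ CARD('n)) * (ennreal m + ennreal ?P * ennreal (enn2real ?T)))"
          using fin by simp
        also have "\<dots> = ennreal (c1 * (m + ?P * enn2real ?T))"
          using c0 l *(3) by (simp add: c1_def ennreal_mult ennreal_plus mult_ac)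
        finally have "ennreal (\<kappa> * t) \<le> ennreal (c1 * (m + ?P * enn2real ?T))"
          using \<kappa> by (simp add: ennreal_mult' t_def)
        then have "\<kappa> * t \<le> c1 * (m + ?P * enn2real ?T)"
          using c1 *(3) by (subst (asm) ennreal_le_iff) auto
        then show ?thesis using c1 by (simp add: pos_divide_le_eq mult.commute)
      qed
      then have "young_B CARD('n) A ((t / c1) / r) \<le> ennreal (m / r ^ CARD('n))"
        using young_B_scaled_le_iff[OF n2 A C1 C2 *(3,1), of "t / c1"] by blast
      then have "(t / c1) / r \<le> ?b (m / r ^ CARD('n))"
        using young_inv_ge_iff[OF n A C1 C2, of "m / r ^ CARD('n)" "(t / c1) / r"] * c1 by (simp add: t_def)
      then show ?thesis using c1 *(1) unfolding t_def[symmetric] by (simp add: pos_divide_le_eq mult_ac)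
    qed
    have "\<bar>u x $ c - u y $ c\<bar> \<le> (2 * c1) * (r * ?b (m / r ^ CARD('n)))"
      if *: "0 < r" "cube a r \<subseteq> \<Omega>" "0 \<le> m" "(\<integral>\<^sup>+ z\<in>cube a r. ennreal (A (norm (G z) / l)) \<partial>lebesgue) = ennreal m"
        "x \<in> cube a r" "y \<in> cube a r" for a r m x y c
    proof -
      \<comment> \<open>At level 0 no contraction has taken place, so the initial average does not
        depend on the centre and links \<open>x\<close> with \<open>y\<close>; this gives the factor
        2.\<close>
      have "zoom_bump h x a r 0 = zoom_bump h y a r 0" by (simp add: zoom_bump_def zoom_0 fun_eq_iff)
      then show ?thesis using one[OF *(1-5), of c] one[OF *(1-4,6), of c] by simp
    qed
    then show ?thesis using c1 by (intro exI[of _ "2 * c1"]) auto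
  qed
  then obtain C where C: "0 \<le> C" and osc: "\<forall>a r m x y c. 0 < r \<longrightarrow> cube a r \<subseteq> \<Omega> \<longrightarrow> 0 \<le> m \<longrightarrow>
      (\<integral>\<^sup>+ z\<in>cube a r. ennreal (A (norm (G z) / l)) \<partial>lebesgue) = ennreal m \<longrightarrow>
      x \<in> cube a r \<longrightarrow> y \<in> cube a r \<longrightarrow> \<bar>u x $ c - u y $ c\<bar> \<le> C * (r * ?b (m / r ^ CARD('n)))"
    by blast
  show ?thesis
    unfolding morrey_constant_def
  proof (intro exI[of _ "real CARD('m) * C + 1"] conjI allI impI)
    show "1 \<le> real CARD('m) * C + 1" using C by simp
    fix a r m x y
    assume *: "0 < r" "cube a r \<subseteq> \<Omega>" "0 \<le> m" "(\<integral>\<^sup>+ z\<in>cube a r. ennreal (A (norm (G z) / l)) \<partial>lebesgue) = ennreal m"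
        "x \<in> cube a r" "y \<in> cube a r"
    let ?H = "r * ?b (m / r ^ CARD('n))"
    have H: "0 \<le> ?H" using young_inv_nonneg[OF n A C1 C2, of "m / r ^ CARD('n)"] * by simp
    have "norm (u x - u y) \<le> (\<Sum>c\<in>UNIV. \<bar>(u x - u y) $ c\<bar>)" by (rule norm_le_l1_cart)
    also have "\<dots> \<le> (\<Sum>c\<in>(UNIV::'m set). C * ?H)" using osc[rule_format, OF *] by (intro sum_mono) simp
    also have "\<dots> = real CARD('m) * C * ?H" by simp
    also have "\<dots> \<le> (real CARD('m) * C + 1) * ?H" using H by (intro mult_right_mono) auto
    finally show "norm (u x - u y) \<le> (real CARD('m) * C + 1) * ?H" .
  qed
qed

end

section \<open>Dyadic covers and Hausdorff contents\<close>

lemma hausdorff_content_le: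
  assumes "E \<subseteq> (\<Union>i. C i)" "\<And>i. bounded (C i)" "\<And>i. ennreal (diameter (C i)) \<le> \<sigma>"
  shows "hausdorff_content \<phi> \<sigma> E \<le> (\<Sum>i. ennreal (\<phi> (diameter (C i))))"
  unfolding hausdorff_content_def using assms by (intro INF_lower) auto

lemma hausdorff_content_le_countable:
  assumes T: "countable T" and sub: "E \<subseteq> (\<Union>t\<in>T. B t)" and bd: "\<And>t. t \<in> T \<Longrightarrow> bounded (B t)"
    and diam: "\<And>t. t \<in> T \<Longrightarrow> ennreal (diameter (B t)) \<le> \<sigma>" and "\<phi> 0 = 0"
  shows "hausdorff_content \<phi> \<sigma> E \<le> (\<integral>\<^sup>+ t. ennreal (\<phi> (diameter (B t))) \<partial>count_space T)"
proof -
  let ?e = "to_nat_on T"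
  define C where "C i = (if i \<in> ?e ` T then B (from_nat_into T i) else {})" for i
  have Ce: "C (?e t) = B t" if "t \<in> T" for t using that T by (simp add: C_def)
  have C: "C i = {} \<or> (\<exists>t\<in>T. C i = B t)" for i using Ce by (auto simp: C_def)
  have "hausdorff_content \<phi> \<sigma> E \<le> (\<Sum>i. ennreal (\<phi> (diameter (C i))))"
  proof (rule hausdorff_content_le)
    show "E \<subseteq> (\<Union>i. C i)"
    proof
      fix x assume "x \<in> E"
      then obtain t where "t \<in> T" "x \<in> B t" using sub by blast
      then have "x \<in> C (?e t)" by (simp add: Ce)
      then show "x \<in> (\<Union>i. C i)" by blast
    qed
    show "bounded (C i)" for i using C[of i] bd by auto
    show "ennreal (diameter (C i)) \<le> \<sigma>" for i using C[of i] diam by (auto simp: diameter_empty)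
  qed
  also have "\<dots> = (\<integral>\<^sup>+ i. ennreal (\<phi> (diameter (C i))) \<partial>count_space UNIV)"
    by (simp add: nn_integral_count_space_nat)
  also have "\<dots> = (\<integral>\<^sup>+ i. ennreal (\<phi> (diameter (C i))) * indicator (?e ` T) i \<partial>count_space UNIV)"
    using assms(5) by (intro nn_integral_cong) (auto simp: C_def split: split_indicator)
  also have "\<dots> = (\<integral>\<^sup>+ i. ennreal (\<phi> (diameter (C i))) \<partial>count_space (?e ` T))"
    by (simp add: nn_integral_count_space_indicator)
  also have "\<dots> = (\<integral>\<^sup>+ t. ennreal (\<phi> (diameter (C (?e t)))) \<partial>count_space T)"
    using inj_on_to_nat_on[OF T] by (intro nn_integral_bij_count_space[symmetric]) (simp add: bij_betw_def)
  also have "\<dots> = (\<integral>\<^sup>+ t. ennreal (\<phi> (diameter (B t))) \<partial>count_space T)"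
    by (intro nn_integral_cong) (simp add: Ce)
  finally show ?thesis .
qed

text \<open>The function is truncated at a height \<open>k\<close> beyond which only
  \<open>e / 2\<close> of the integral is left. The truncated part contributes at most
  \<open>k\<close> times the measure of \<open>S\<close>.\<close>

lemma nn_integral_absolutely_continuous:
  assumes f [measurable]: "f \<in> borel_measurable M" and fin: "(\<integral>\<^sup>+ x. f x \<partial>M) < \<infinity>" and e: "0 < (e::real)"
  obtains d :: real where "0 < d" "\<And>S. S \<in> sets M \<Longrightarrow> emeasure M S \<le> ennreal d \<Longrightarrow> (\<integral>\<^sup>+ x\<in>S. f x \<partial>M) \<le> ennreal e"
proof -
  let ?f = "\<lambda>k::nat. \<lambda>x. min (f x) (of_nat k)"
  have sup: "(SUP k. ?f k x) = f x" for x
  proof (rule antisym)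
    show "(SUP k. ?f k x) \<le> f x" by (intro SUP_least) simp
    have "f x = min (f x) (SUP k. of_nat k)" by (simp add: ennreal_SUP_of_nat_eq_top)
    also have "\<dots> \<le> (SUP k. ?f k x)" by (simp add: inf_min[symmetric] inf_SUP)
    finally show "f x \<le> (SUP k. ?f k x)" .
  qed
  have "(\<integral>\<^sup>+ x. f x \<partial>M) = (\<integral>\<^sup>+ x. (SUP k. ?f k x) \<partial>M)" by (simp add: sup)
  also have "\<dots> = (SUP k. \<integral>\<^sup>+ x. ?f k x \<partial>M)"
    by (rule nn_integral_monotone_convergence_SUP) (auto simp: incseq_def le_fun_def min_le_iff_disj)
  finally have S: "(\<integral>\<^sup>+ x. f x \<partial>M) = (SUP k. \<integral>\<^sup>+ x. ?f k x \<partial>M)" .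
  have "\<exists>k. (\<integral>\<^sup>+ x. f x \<partial>M) \<le> (\<integral>\<^sup>+ x. ?f k x \<partial>M) + ennreal (e / 2)"
  proof (cases "(\<integral>\<^sup>+ x. f x \<partial>M) = 0")
    case False
    then have "(\<integral>\<^sup>+ x. f x \<partial>M) - ennreal (e / 2) < (\<integral>\<^sup>+ x. f x \<partial>M)"
      using fin e by (intro ennreal_between) (auto simp: zero_less_iff_neq_zero)
    then have "(\<integral>\<^sup>+ x. f x \<partial>M) - ennreal (e / 2) < (SUP k. \<integral>\<^sup>+ x. ?f k x \<partial>M)"
      by (subst S[symmetric])
    then obtain k where "(\<integral>\<^sup>+ x. f x \<partial>M) - ennreal (e / 2) < (\<integral>\<^sup>+ x. ?f k x \<partial>M)"
      by (auto simp: less_SUP_iff)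
    then have "(\<integral>\<^sup>+ x. f x \<partial>M) - ennreal (e / 2) \<le> (\<integral>\<^sup>+ x. ?f k x \<partial>M)" by (rule less_imp_le)
    then have "(\<integral>\<^sup>+ x. f x \<partial>M) \<le> ennreal (e / 2) + (\<integral>\<^sup>+ x. ?f k x \<partial>M)"
      unfolding ennreal_minus_le_iff by (rule conjunct1)
    then show ?thesis by (intro exI[of _ k]) (simp only: add.commute)
  qed auto
  then obtain k where k: "(\<integral>\<^sup>+ x. f x \<partial>M) \<le> (\<integral>\<^sup>+ x. ?f k x \<partial>M) + ennreal (e / 2)" by blast
  have fink: "(\<integral>\<^sup>+ x. ?f k x \<partial>M) < \<infinity>"
    using fin by (rule le_less_trans[rotated]) (intro nn_integral_mono, simp)
  have "(\<integral>\<^sup>+ x. f x \<partial>M) = (\<integral>\<^sup>+ x. ?f k x + (f x - ?f k x) \<partial>M)"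
    by (intro nn_integral_cong) (simp add: add_diff_inverse_ennreal)
  also have "\<dots> = (\<integral>\<^sup>+ x. ?f k x \<partial>M) + (\<integral>\<^sup>+ x. f x - ?f k x \<partial>M)"
    by (rule nn_integral_add) auto
  finally have "(\<integral>\<^sup>+ x. ?f k x \<partial>M) + (\<integral>\<^sup>+ x. f x - ?f k x \<partial>M) \<le> (\<integral>\<^sup>+ x. ?f k x \<partial>M) + ennreal (e / 2)"
    using k by (simp only:)
  then have rest: "(\<integral>\<^sup>+ x. f x - ?f k x \<partial>M) \<le> ennreal (e / 2)"
    using fink by (auto simp: ennreal_add_left_cancel_le)
  \<comment> \<open>One more than \<open>k\<close>, so that division is possible for
    \<open>k = 0\<close> too.\<close>
  define a where "a = real k + 1"
  have a: "0 < a" by (simp add: a_def)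
  show ?thesis
  proof (rule that[of "e / (2 * a)"])
    show "0 < e / (2 * a)" using e a by simp
    fix S assume S: "S \<in> sets M" "emeasure M S \<le> ennreal (e / (2 * a))"
    have "(\<integral>\<^sup>+ x\<in>S. f x \<partial>M) \<le> (\<integral>\<^sup>+ x. (f x - ?f k x) + of_nat k * indicator S x \<partial>M)"
    proof (rule nn_integral_mono)
      fix x
      have "f x = (f x - ?f k x) + ?f k x" by (simp add: diff_add_cancel_ennreal)
      also have "\<dots> \<le> (f x - ?f k x) + of_nat k" by (intro add_left_mono) simp
      finally show "f x * indicator S x \<le> (f x - ?f k x) + of_nat k * indicator S x"
        by (auto split: split_indicator)
    qed
    also have "\<dots> = (\<integral>\<^sup>+ x. f x - ?f k x \<partial>M) + of_nat k * emeasure M S"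
      using S by (subst nn_integral_add) (auto simp: nn_integral_cmult_indicator)
    also have "\<dots> \<le> ennreal (e / 2) + ennreal (real k) * ennreal (e / (2 * a))"
      using S rest by (intro add_mono mult_mono) (auto simp: ennreal_of_nat_eq_real_of_nat)
    also have "\<dots> = ennreal (e / 2 + real k * (e / (2 * a)))"
      using e a by (simp only: ennreal_mult[symmetric] ennreal_plus[symmetric] of_nat_0_le_iff
          divide_nonneg_nonneg less_imp_le mult_nonneg_nonneg zero_less_mult_iff zero_less_numeral half_gt_zero)
    also have "\<dots> \<le> ennreal e"
    proof (intro ennreal_leI)
      have "real k * (e / (2 * a)) \<le> a * (e / (2 * a))" using e a by (intro mult_right_mono) (auto simp: a_def)
      also have "\<dots> = e / 2" using a by simp
      finally show "e / 2 + real k * (e / (2 * a)) \<le> e" by linarith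
    qed
    finally show "(\<integral>\<^sup>+ x\<in>S. f x \<partial>M) \<le> ennreal e" .
  qed
qed

text \<open>The integer vector naming the half-open dyadic cube of side \<open>1 / 2 ^ k\<close>
  that contains \<open>x\<close>. Levels and codes form a countable type, so countability of
  families of cubes is automatic.\<close>

definition dyadic_code :: "nat \<Rightarrow> real^'n \<Rightarrow> 'n \<Rightarrow> int" where
  "dyadic_code k x j = \<lfloor>2 ^ k * x $ j\<rfloor>"

definition dyadic_cube :: "nat \<Rightarrow> ('n \<Rightarrow> int) \<Rightarrow> (real^'n) set" where
  "dyadic_cube k v = {x. dyadic_code k x = v}"

text \<open>A coarser code is the integer quotient of the finer one by \<open>2 ^ (l - k)\<close>.
  This is the nesting of dyadic cubes.\<close>

lemma dyadic_code_coarser: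
  assumes "dyadic_code l x = dyadic_code l y" "k \<le> l"
  shows "dyadic_code k x = dyadic_code k y"
proof
  fix j
  have *: "\<lfloor>2 ^ k * t\<rfloor> = \<lfloor>2 ^ l * t\<rfloor> div 2 ^ (l - k)" for t :: real
  proof -
    have "(2::real) ^ l = 2 ^ k * 2 ^ (l - k)" using assms(2) by (simp flip: power_add)
    then have "2 ^ k * t = 2 ^ l * t / real_of_int (2 ^ (l - k))" by simp
    then show ?thesis by (simp only: floor_divide_real_eq_div zero_le_power zero_le_numeral)
  qed
  show "dyadic_code k x j = dyadic_code k y j"
    using fun_cong[OF assms(1), of j] unfolding dyadic_code_def *[of "x $ j"] *[of "y $ j"] by simp
qed

text \<open>Scaled by \<open>2 ^ k\<close>, coordinates of two points of \<open>C\<close> differ by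
  at most 1, so their floors do as well. Around one reference code this leaves three values per
  coordinate.\<close>

lemma card_dyadic_codes_le:
  fixes C :: "(real^'n) set"
  assumes C: "bounded C" "diameter C \<le> 1 / 2 ^ k"
  shows "finite (dyadic_code k ` C)" "card (dyadic_code k ` C) \<le> 3 ^ CARD('n)"
proof -
  have "\<exists>F. finite F \<and> card F = 3 ^ CARD('n) \<and> dyadic_code k ` C \<subseteq> F"
  proof (cases "C = {}")
    case True
    have "card (PiE (UNIV::'n set) (\<lambda>j. {0..2::int})) = 3 ^ CARD('n)" by (simp add: card_PiE)
    then show ?thesis using True by (intro exI[of _ "PiE (UNIV::'n set) (\<lambda>j. {0..2::int})"]) (auto intro!: finite_PiE)
  next
    case False
    then obtain y where y: "y \<in> C" by blast
    let ?F = "PiE (UNIV::'n set) (\<lambda>j. {dyadic_code k y j - 1..dyadic_code k y j + 1})"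
    have "dyadic_code k x \<in> ?F" if x: "x \<in> C" for x
    proof -
      have "dyadic_code k y j - 1 \<le> dyadic_code k x j \<and> dyadic_code k x j \<le> dyadic_code k y j + 1" for j
      proof -
        have "\<bar>x $ j - y $ j\<bar> \<le> dist x y"
          using component_le_norm_cart[of "x - y" j] by (simp add: dist_norm)
        also have "\<dots> \<le> 1 / 2 ^ k" using diameter_bounded_bound[OF C(1) x y] C(2) by simp
        finally have "2 ^ k * \<bar>x $ j - y $ j\<bar> \<le> 2 ^ k * (1 / 2 ^ k)" by (intro mult_left_mono) auto
        then have "\<bar>2 ^ k * x $ j - 2 ^ k * y $ j\<bar> \<le> 1"
          by (simp add: abs_mult right_diff_distrib[symmetric])
        then show ?thesis unfolding dyadic_code_def by linarith
      qed
      then show ?thesis by auto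
    qed
    moreover have "card ?F = 3 ^ CARD('n)" by (simp add: card_PiE)
    ultimately show ?thesis by (intro exI[of _ ?F]) (auto intro!: finite_PiE)
  qed
  then show "finite (dyadic_code k ` C)" "card (dyadic_code k ` C) \<le> 3 ^ CARD('n)"
    by (auto intro: finite_subset) (metis card_mono)
qed

text \<open>Two dyadic cubes are nested or disjoint, so the maximal ones among those that meet the given
  cover are pairwise disjoint.\<close>
lemma dyadic_disjoint_cover:
  fixes C :: "nat \<Rightarrow> (real^'n) set" and k :: "nat \<Rightarrow> nat"
  assumes E: "E \<subseteq> (\<Union>i. C i)" and C: "\<And>i. bounded (C i)" "\<And>i. diameter (C i) \<le> 1 / 2 ^ k i"
  obtains T where "E \<subseteq> (\<Union>(l, v)\<in>T. dyadic_cube l v)"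
    "\<And>l v l' v'. (l, v) \<in> T \<Longrightarrow> (l', v') \<in> T \<Longrightarrow> (l, v) \<noteq> (l', v') \<Longrightarrow> dyadic_cube l v \<inter> dyadic_cube l' v' = {}"
    "\<And>l v. (l, v) \<in> T \<Longrightarrow> \<exists>i. \<exists>y\<in>C i \<inter> E. l = k i \<and> v = dyadic_code l y"
    "\<And>w. (\<integral>\<^sup>+ t. w (fst t) \<partial>count_space T) \<le> 3 ^ CARD('n) * (\<Sum>i. w (k i))"
proof -
  define B where "B i = {k i} \<times> dyadic_code (k i) ` (C i \<inter> E)" for i
  define S where "S = (\<Union>i. B i)"
  \<comment> \<open>The coarsest selected level at \<open>x\<close>. A cube meeting another chosen
    cube at a finer level would contain the point that selected the latter, against
    minimality.\<close>
  define K where "K x = (LEAST l. (l, dyadic_code l x) \<in> S)" for x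
  define T where "T = (\<lambda>x. (K x, dyadic_code (K x) x)) ` E"
  have KS: "(K x, dyadic_code (K x) x) \<in> S" if x: "x \<in> E" for x
  proof -
    obtain i where "x \<in> C i" using x E by blast
    then have "(k i, dyadic_code (k i) x) \<in> S" using x by (auto simp: S_def B_def)
    then show ?thesis unfolding K_def by (rule LeastI)
  qed
  have TS: "T \<subseteq> S" using KS by (auto simp: T_def)
  have disj: "(l, v) = (l', v')" if h: "(l, v) \<in> T" "(l', v') \<in> T" "l \<le> l'" "z \<in> dyadic_cube l v" "z \<in> dyadic_cube l' v'" for l v l' v' z
  proof -
    obtain x where x: "x \<in> E" "l' = K x" "v' = dyadic_code l' x" using h(2) by (auto simp: T_def)
    have "dyadic_code l' z = dyadic_code l' x" using h(5) x by (simp add: dyadic_cube_def)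
    then have "dyadic_code l x = dyadic_code l z" using dyadic_code_coarser[OF _ h(3)] by metis
    then have v: "v = dyadic_code l x" using h(4) by (simp add: dyadic_cube_def)
    then have "(l, dyadic_code l x) \<in> S" using h(1) TS by auto
    then have "K x \<le> l" unfolding K_def by (rule Least_le)
    then show ?thesis using x v h(3) by simp
  qed
  show ?thesis
  proof (rule that[of T])
    show "E \<subseteq> (\<Union>(l, v)\<in>T. dyadic_cube l v)" by (auto simp: T_def dyadic_cube_def)
    show "dyadic_cube l v \<inter> dyadic_cube l' v' = {}" if "(l, v) \<in> T" "(l', v') \<in> T" "(l, v) \<noteq> (l', v')" for l v l' v'
      using disj[OF that(1,2)] disj[OF that(2,1)] that(3) by (metis disjoint_iff linear)
    show "\<exists>i. \<exists>y\<in>C i \<inter> E. l = k i \<and> v = dyadic_code l y" if "(l, v) \<in> T" for l v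
      using subsetD[OF TS that] by (auto simp: S_def B_def)
    \<comment> \<open>The weight is arbitrary because the estimate is applied twice, to volumes and
      to values of \<open>\<phi>\<close>.\<close>
    fix w :: "nat \<Rightarrow> ennreal"
    have "(\<integral>\<^sup>+ t. w (fst t) \<partial>count_space T) = (\<integral>\<^sup>+ t. w (fst t) * indicator T t \<partial>count_space UNIV)"
      by (simp add: nn_integral_count_space_indicator)
    also have "\<dots> \<le> (\<integral>\<^sup>+ t. (\<Sum>i. w (k i) * indicator (B i) t) \<partial>count_space UNIV)"
    proof (rule nn_integral_mono)
      fix t
      show "w (fst t) * indicator T t \<le> (\<Sum>i. w (k i) * indicator (B i) t)"
      proof (cases "t \<in> T")
        case True
        then obtain i where i: "t \<in> B i" using TS by (auto simp: S_def)
        then have "w (fst t) * indicator T t = (\<Sum>i\<in>{i}. w (k i) * indicator (B i) t)"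
          using True by (auto simp: B_def)
        also have "\<dots> \<le> (\<Sum>i. w (k i) * indicator (B i) t)" by (rule sum_le_suminf) auto
        finally show ?thesis .
      qed simp
    qed
    also have "\<dots> = (\<Sum>i. \<integral>\<^sup>+ t. w (k i) * indicator (B i) t \<partial>count_space UNIV)"
      by (rule nn_integral_suminf) simp
    also have "\<dots> \<le> (\<Sum>i. 3 ^ CARD('n) * w (k i))"
    proof (intro suminf_le allI)
      fix i
      have bd: "bounded (C i \<inter> E)" "diameter (C i \<inter> E) \<le> 1 / 2 ^ k i"
        using C[of i] diameter_subset[of "C i \<inter> E" "C i"] bounded_subset[of "C i" "C i \<inter> E"] by auto
      have fin: "finite (B i)" and "card (B i) \<le> 3 ^ CARD('n)"
        using card_dyadic_codes_le[OF bd] by (auto simp: B_def card_cartesian_product)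
      then have "(of_nat (card (B i)) :: ennreal) \<le> of_nat (3 ^ CARD('n))" by (intro of_nat_mono)
      then have "emeasure (count_space UNIV) (B i) \<le> (3 :: ennreal) ^ CARD('n)"
        using fin by (simp add: emeasure_count_space_finite)
      moreover have "(\<integral>\<^sup>+ t. w (k i) * indicator (B i) t \<partial>count_space UNIV) = w (k i) * emeasure (count_space UNIV) (B i)"
        by (rule nn_integral_cmult_indicator) simp
      ultimately show "(\<integral>\<^sup>+ t. w (k i) * indicator (B i) t \<partial>count_space UNIV) \<le> 3 ^ CARD('n) * w (k i)"
        by (simp add: mult.commute mult_left_mono)
    qed auto
    finally show "(\<integral>\<^sup>+ t. w (fst t) \<partial>count_space T) \<le> 3 ^ CARD('n) * (\<Sum>i. w (k i))" by simp
  qed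
qed

text \<open>Sets of diameter below \<open>\<eta>\<close> meet at most one of the layers, so cutting
  a sufficiently fine cover of \<open>E\<close> along the layers does not increase its cost. This
  yields additivity where subadditivity would point the wrong way.\<close>

lemma sum_layer_contents_le:
  fixes E :: "'a::metric_space set" and L :: "'a \<Rightarrow> nat"
  assumes \<phi>0: "\<phi> 0 = 0" and mono: "\<And>r s. 0 \<le> r \<Longrightarrow> r \<le> s \<Longrightarrow> \<phi> r \<le> \<phi> s"
    and I: "finite I" and \<sigma>: "\<And>q. 0 < \<sigma> q" and \<eta>: "0 < \<eta>"
    and sep: "\<And>x y. x \<in> E \<Longrightarrow> y \<in> E \<Longrightarrow> L x \<in> I \<Longrightarrow> L y \<in> I \<Longrightarrow> dist x y < \<eta> \<Longrightarrow> L x = L y"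
  shows "(\<Sum>q\<in>I. hausdorff_content \<phi> (ennreal (\<sigma> q)) {x \<in> E. L x = q}) \<le> hausdorff_measure \<phi> E"
proof -
  \<comment> \<open>A common mesh, finer than the separation and than every prescribed mesh;
    finiteness of \<open>I\<close> keeps it positive.\<close>
  define s where "s = Min (insert (\<eta> / 2) (\<sigma> ` I))"
  have s: "0 < s" "s < \<eta>" "\<And>q. q \<in> I \<Longrightarrow> s \<le> \<sigma> q"
    using I \<sigma> \<eta> by (auto simp: s_def Min_less_iff)
  have "(\<Sum>q\<in>I. hausdorff_content \<phi> (ennreal (\<sigma> q)) {x \<in> E. L x = q}) \<le> hausdorff_content \<phi> (ennreal s) E"
    unfolding hausdorff_content_def[of \<phi> "ennreal s" E]
  proof (rule INF_greatest)
    fix C :: "nat \<Rightarrow> 'a set"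
    assume "C \<in> {C. E \<subseteq> (\<Union>i. C i) \<and> (\<forall>i. bounded (C i) \<and> ennreal (diameter (C i)) \<le> ennreal s)}"
    then have C: "E \<subseteq> (\<Union>i. C i)" "\<And>i. bounded (C i)" "\<And>i. diameter (C i) \<le> s"
      using s by auto
    define D where "D q i = C i \<inter> {x \<in> E. L x = q}" for q i
    have Dsub: "diameter (D q i) \<le> diameter (C i)" for q i
      using C(2) by (intro diameter_subset) (auto simp: D_def)
    have "(\<Sum>q\<in>I. hausdorff_content \<phi> (ennreal (\<sigma> q)) {x \<in> E. L x = q}) \<le> (\<Sum>q\<in>I. \<Sum>i. ennreal (\<phi> (diameter (D q i))))"
    proof (intro sum_mono hausdorff_content_le)
      fix q assume q: "q \<in> I"
      show "{x \<in> E. L x = q} \<subseteq> (\<Union>i. D q i)" using C(1) by (auto simp: D_def)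
      show "bounded (D q i)" for i using C(2)[of i] by (rule bounded_subset) (auto simp: D_def)
      show "ennreal (diameter (D q i)) \<le> ennreal (\<sigma> q)" for i
        using Dsub[of q i] C(3)[of i] s(3)[OF q] by (intro ennreal_leI) linarith
    qed
    also have "\<dots> = (\<Sum>i. \<Sum>q\<in>I. ennreal (\<phi> (diameter (D q i))))"
      by (rule suminf_sum[symmetric]) auto
    also have "\<dots> \<le> (\<Sum>i. ennreal (\<phi> (diameter (C i))))"
    proof (intro suminf_le allI)
      fix i
      show "(\<Sum>q\<in>I. ennreal (\<phi> (diameter (D q i)))) \<le> ennreal (\<phi> (diameter (C i)))"
      proof (cases "\<exists>q\<in>I. D q i \<noteq> {}")
        case True
        then obtain q x where q: "q \<in> I" "x \<in> D q i" by blast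
        have "D q' i = {}" if "q' \<in> I - {q}" for q'
        proof (rule ccontr)
          assume "D q' i \<noteq> {}"
          then obtain y where y: "y \<in> D q' i" by blast
          have "dist x y \<le> diameter (C i)"
            using q y C(2)[of i] by (intro diameter_bounded_bound) (auto simp: D_def)
          then have "dist x y < \<eta>" using C(3)[of i] s(2) by linarith
          then have "L x = L y" using q y that by (intro sep) (auto simp: D_def)
          then show False using q y that by (auto simp: D_def)
        qed
        then have "(\<Sum>q\<in>I. ennreal (\<phi> (diameter (D q i)))) = ennreal (\<phi> (diameter (D q i)))"
          using I q(1) by (subst sum.remove[of I q]) (auto simp: \<phi>0 diameter_empty)
        also have "\<dots> \<le> ennreal (\<phi> (diameter (C i)))"
          using Dsub[of q i] C(2)[of i]
          by (intro ennreal_leI mono diameter_ge_0) (auto simp: D_def intro: bounded_subset)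
        finally show ?thesis .
      qed (auto simp: \<phi>0 diameter_empty)
    qed auto
    finally show "(\<Sum>q\<in>I. hausdorff_content \<phi> (ennreal (\<sigma> q)) {x \<in> E. L x = q}) \<le> (\<Sum>i. ennreal (\<phi> (diameter (C i))))" .
  qed
  also have "\<dots> \<le> hausdorff_measure \<phi> E"
    unfolding hausdorff_measure_def using s(1) by (intro SUP_upper) simp
  finally show ?thesis .
qed

text \<open>The mesh may depend on the layer, with infinitely many layers and no positive lower
  bound. Neighbouring layers can touch, but those of equal parity are separated, so even and odd
  layers each cost at most the measure of \<open>E\<close>.\<close>

lemma layered_cover:
  fixes E :: "'a::metric_space set" and L :: "'a \<Rightarrow> nat"
  assumes \<phi>0: "\<phi> 0 = 0" and mono: "\<And>r s. 0 \<le> r \<Longrightarrow> r \<le> s \<Longrightarrow> \<phi> r \<le> \<phi> s"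
    and \<sigma>: "\<And>q. 0 < \<sigma> q"
    and sep: "\<And>K. \<exists>\<eta>>0. \<forall>x\<in>E. \<forall>y\<in>E. L x < K \<longrightarrow> L y < K \<longrightarrow> dist x y < \<eta> \<longrightarrow> L x \<le> Suc (L y)"
    and small: "hausdorff_measure \<phi> E < ennreal \<delta>"
  obtains C :: "nat \<Rightarrow> 'a set" and q :: "nat \<Rightarrow> nat" where "E \<subseteq> (\<Union>i. C i)" "\<And>i. bounded (C i)" "\<And>i. diameter (C i) \<le> \<sigma> (q i)"
    "\<And>i x. x \<in> C i \<Longrightarrow> x \<in> E \<and> L x = q i" "(\<Sum>i. ennreal (\<phi> (diameter (C i)))) \<le> ennreal (4 * \<delta>)"
proof -
  have \<delta>: "0 < \<delta>" using small by (metis ennreal_neg not_less not_less_zero)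
  let ?h = "\<lambda>q. hausdorff_content \<phi> (ennreal (\<sigma> q)) {x \<in> E. L x = q}"
  have fin: "(\<Sum>q<K. ?h q) \<le> 2 * hausdorff_measure \<phi> E" for K
  proof -
    obtain \<eta> where \<eta>: "0 < \<eta>" "\<forall>x\<in>E. \<forall>y\<in>E. L x < K \<longrightarrow> L y < K \<longrightarrow> dist x y < \<eta> \<longrightarrow> L x \<le> Suc (L y)"
      using sep by blast
    have par: "(\<Sum>q\<in>{q\<in>{..<K}. even q = p}. ?h q) \<le> hausdorff_measure \<phi> E" for p
    proof (rule sum_layer_contents_le[of \<phi> "{q\<in>{..<K}. even q = p}" \<sigma> \<eta> E L, OF \<phi>0 mono _ \<sigma> \<eta>(1)])
      fix x y assume *: "x \<in> E" "y \<in> E" "L x \<in> {q\<in>{..<K}. even q = p}" "L y \<in> {q\<in>{..<K}. even q = p}" "dist x y < \<eta>"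
      then have "L x \<le> Suc (L y)" "L y \<le> Suc (L x)"
        using \<eta>(2) by (auto simp: dist_commute)
      then show "L x = L y" using *(3,4) by (metis (mono_tags, lifting) even_Suc le_Suc_eq le_antisym mem_Collect_eq)
    qed simp_all
    have "(\<Sum>q<K. ?h q) = (\<Sum>q\<in>{q\<in>{..<K}. even q = True} \<union> {q\<in>{..<K}. even q = False}. ?h q)"
      by (intro sum.cong) auto
    also have "\<dots> = (\<Sum>q\<in>{q\<in>{..<K}. even q = True}. ?h q) + (\<Sum>q\<in>{q\<in>{..<K}. even q = False}. ?h q)"
      by (intro sum.union_disjoint) auto
    also have "\<dots> \<le> hausdorff_measure \<phi> E + hausdorff_measure \<phi> E" by (intro add_mono par)
    finally show ?thesis by (simp add: mult_2)
  qed
  then have tot: "(\<Sum>q. ?h q) \<le> 2 * hausdorff_measure \<phi> E" by (intro suminf_le_const) auto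
  have hfin: "?h q < \<infinity>" for q
  proof -
    have "?h q \<le> (\<Sum>q<Suc q. ?h q)" by simp
    also have "\<dots> \<le> 2 * hausdorff_measure \<phi> E" by (rule fin)
    also have "\<dots> < \<infinity>" using small by (simp add: ennreal_mult_less_top order.strict_trans)
    finally show ?thesis .
  qed
  \<comment> \<open>The error budget \<open>\<delta>\<close> is distributed geometrically over the
    layers. In total the cost is at most \<open>2 * \<delta> + \<delta>\<close>, rounded up to
    \<open>4 * \<delta>\<close>.\<close>
  have ex: "\<exists>C. {x \<in> E. L x = q} \<subseteq> (\<Union>i. C i) \<and> (\<forall>i. bounded (C i) \<and> ennreal (diameter (C i)) \<le> ennreal (\<sigma> q)) \<and>
     (\<Sum>i. ennreal (\<phi> (diameter (C i)))) \<le> ?h q + ennreal (\<delta> * (1 / 2) ^ Suc q)" for q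
  proof -
    have "?h q < ?h q + ennreal (\<delta> * (1 / 2) ^ Suc q)"
      using ennreal_add_left_cancel_less[of "?h q" 0 "ennreal (\<delta> * (1 / 2) ^ Suc q)"] hfin[of q] \<delta> by simp
    then show ?thesis unfolding hausdorff_content_def[of \<phi> "ennreal (\<sigma> q)"] INF_less_iff
      by (auto intro: less_imp_le)
  qed
  obtain C where C': "\<forall>q. {x \<in> E. L x = q} \<subseteq> (\<Union>i. C q i) \<and>
     (\<forall>i. bounded (C q i) \<and> ennreal (diameter (C q i)) \<le> ennreal (\<sigma> q)) \<and>
     (\<Sum>i. ennreal (\<phi> (diameter (C q i)))) \<le> ?h q + ennreal (\<delta> * (1 / 2) ^ Suc q)"
    using choice[OF allI, OF ex] by (rule exE)
  have C: "{x \<in> E. L x = q} \<subseteq> (\<Union>i. C q i)" "bounded (C q i)" "ennreal (diameter (C q i)) \<le> ennreal (\<sigma> q)"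
      "(\<Sum>i. ennreal (\<phi> (diameter (C q i)))) \<le> ?h q + ennreal (\<delta> * (1 / 2) ^ Suc q)" for q i
    using spec[OF C', of q] by auto
  define D where "D = (\<lambda>(q, i). C q i \<inter> {x \<in> E. L x = q})"
  have Dd: "diameter (D (q, i)) \<le> diameter (C q i)" for q i
    using C(2) by (intro diameter_subset) (auto simp: D_def)
  have Db: "bounded (D (q, i))" for q i using C(2)[of q i] by (rule bounded_subset) (auto simp: D_def)
  show ?thesis
  proof (rule that[of "\<lambda>i. D (prod_decode i)" "\<lambda>i. fst (prod_decode i)"])
    show "E \<subseteq> (\<Union>i. D (prod_decode i))"
    proof
      fix x assume "x \<in> E"
      then obtain i where "x \<in> C (L x) i" using C(1)[of "L x"] by blast
      then have "x \<in> D (prod_decode (prod_encode (L x, i)))" using \<open>x \<in> E\<close> by (simp add: D_def)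
      then show "x \<in> (\<Union>i. D (prod_decode i))" by blast
    qed
    fix i
    obtain q j where qj: "prod_decode i = (q, j)" by (cases "prod_decode i")
    show "bounded (D (prod_decode i))" unfolding qj by (rule Db)
    show "diameter (D (prod_decode i)) \<le> \<sigma> (fst (prod_decode i))"
      unfolding qj using Dd[of q j] C(3)[of q j] \<sigma>[of q] by (simp add: less_imp_le)
    show "x \<in> E \<and> L x = fst (prod_decode i)" if "x \<in> D (prod_decode i)" for x
      using that unfolding qj by (simp add: D_def)
  next
    have "(\<Sum>i. ennreal (\<phi> (diameter (D (prod_decode i))))) = (\<Sum>q. \<Sum>i. ennreal (\<phi> (diameter (D (q, i)))))"
      by (rule suminf_ennreal_2dimen) simp
    also have "\<dots> \<le> (\<Sum>q. ?h q + ennreal (\<delta> * (1 / 2) ^ Suc q))"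
    proof (intro suminf_le allI)
      fix q
      have "(\<Sum>i. ennreal (\<phi> (diameter (D (q, i))))) \<le> (\<Sum>i. ennreal (\<phi> (diameter (C q i))))"
        using Dd Db by (intro suminf_le allI ennreal_leI mono diameter_ge_0) auto
      then show "(\<Sum>i. ennreal (\<phi> (diameter (D (q, i))))) \<le> ?h q + ennreal (\<delta> * (1 / 2) ^ Suc q)"
        using C(4)[of q] by (rule order_trans)
    qed auto
    also have "\<dots> = (\<Sum>q. ?h q) + (\<Sum>q. ennreal (\<delta> * (1 / 2) ^ Suc q))"
      by (rule suminf_add[symmetric]) auto
    also have "(\<Sum>q. ennreal (\<delta> * (1 / 2) ^ Suc q)) = ennreal \<delta>"
      using sums_mult[OF power_half_series, of \<delta>] \<delta> by (intro suminf_ennreal_eq) auto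
    also have "(\<Sum>q. ?h q) + ennreal \<delta> \<le> 2 * ennreal \<delta> + ennreal \<delta>"
      using tot small by (intro add_right_mono) (meson less_imp_le mult_left_mono order_trans zero_le)
    also have "\<dots> = ennreal (2 * \<delta> + \<delta>)" using \<delta> by (subst ennreal_plus) (auto simp: ennreal_mult')
    also have "\<dots> \<le> ennreal (4 * \<delta>)" using \<delta> by (intro ennreal_leI) simp
    finally show "(\<Sum>i. ennreal (\<phi> (diameter (D (prod_decode i))))) \<le> ennreal (4 * \<delta>)" .
  qed
qed

section \<open>Images of small sets\<close>

definition dyadic_corner :: "nat \<Rightarrow> ('n \<Rightarrow> int) \<Rightarrow> real^'n" where
  "dyadic_corner k v = (\<chi> j. of_int (v j) / 2 ^ k)"

lemma mem_dyadic_cube: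
  "x \<in> dyadic_cube k v \<longleftrightarrow> (\<forall>j. dyadic_corner k v $ j \<le> x $ j \<and> x $ j < dyadic_corner k v $ j + 1 / 2 ^ k)"
proof -
  have "dyadic_code k x j = v j \<longleftrightarrow> dyadic_corner k v $ j \<le> x $ j \<and> x $ j < dyadic_corner k v $ j + 1 / 2 ^ k" for j
    unfolding dyadic_code_def dyadic_corner_def floor_eq_iff vec_lambda_beta add_divide_distrib[symmetric]
    by (simp add: pos_divide_le_eq pos_less_divide_eq mult.commute)
  then show ?thesis by (simp add: dyadic_cube_def fun_eq_iff)
qed

lemma dyadic_cube_subset: "dyadic_cube k v \<subseteq> cube (dyadic_corner k v) (1 / 2 ^ k)"
  by (auto simp: mem_dyadic_cube mem_cube less_imp_le)

lemma sets_dyadic_cube: "dyadic_cube k v \<in> sets lebesgue"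
proof -
  have "dyadic_cube k v = cube (dyadic_corner k v) (1 / 2 ^ k) \<inter> (\<Inter>j. {x. x $ j < dyadic_corner k v $ j + 1 / 2 ^ k})"
    by (auto simp: mem_dyadic_cube mem_cube less_imp_le)
  moreover have "{x :: real^'n. x $ j < c} \<in> sets lebesgue" for j c
    using borel_open[OF open_halfspace_component_lt_cart[of j c]] by simp
  ultimately show ?thesis by (auto intro!: sets.Int sets.finite_INT)
qed

text \<open>The two cubes differ only on finitely many hyperplanes. Closed cubes are needed for the
  oscillation estimate, half-open ones for disjointness.\<close>

lemma nn_integral_dyadic_cube:
  fixes v :: "'n::finite \<Rightarrow> int"
  shows "(\<integral>\<^sup>+ z\<in>cube (dyadic_corner k v) (1 / 2 ^ k). f z \<partial>lebesgue) = (\<integral>\<^sup>+ z\<in>dyadic_cube k v. f z \<partial>lebesgue)"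
proof (rule nn_integral_cong_AE)
  let ?c = "\<lambda>j. dyadic_corner k v $ j + 1 / 2 ^ k"
  have "AE z in lebesgue. z \<notin> {z :: real^'n. z $ j = ?c j}" for j
    using negligible_hyperplane[of "axis j (1::real)" "?c j"]
    by (intro AE_not_in) (simp add: negligible_iff_null_sets inner_axis')
  then have "AE z in lebesgue. \<forall>j\<in>UNIV. z \<notin> {z :: real^'n. z $ j = ?c j}" by (intro AE_finite_allI) auto
  then show "AE z in lebesgue. f z * indicator (cube (dyadic_corner k v) (1 / 2 ^ k)) z = f z * indicator (dyadic_cube k v) z"
  proof eventually_elim
    case (elim z)
    then have "z \<in> cube (dyadic_corner k v) (1 / 2 ^ k) \<longleftrightarrow> z \<in> dyadic_cube k v"
      by (auto simp: mem_cube mem_dyadic_cube less_le)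
    then show ?case by (simp add: indicator_def)
  qed
qed

section \<open>Rounding the diameters of a cover to dyadic scales\<close>

context young_gauge
begin

lemma phi_dyadic_small:
  assumes "0 < c" "0 < e"
  obtains N where "\<And>k. N \<le> k \<Longrightarrow> \<phi> (c * (1 / 2 ^ k)) \<le> e" "\<And>k. N \<le> k \<Longrightarrow> c * (1 / 2 ^ k) \<le> 1"
proof -
  have lim: "(\<lambda>k. c * (1 / 2) ^ k) \<longlonglongrightarrow> c * 0" by (intro tendsto_mult tendsto_const LIMSEQ_power_zero) simp
  then have lim0: "(\<lambda>k. c * (1 / 2) ^ k) \<longlonglongrightarrow> 0" by simp
  have "(\<lambda>k. \<phi> (c * (1 / 2) ^ k)) \<longlonglongrightarrow> \<phi> 0"
    by (rule continuous_on_tendsto_compose[OF phi_cont lim0]) (use assms in auto)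
  then have "\<forall>\<^sub>F k in sequentially. \<phi> (c * (1 / 2) ^ k) < e"
    using assms phi_0 by (intro order_tendstoD(2)) auto
  moreover have "\<forall>\<^sub>F k in sequentially. c * (1 / 2) ^ k < 1"
    using lim0 by (rule order_tendstoD(2)) simp
  ultimately have "\<forall>\<^sub>F k in sequentially. \<phi> (c * (1 / 2) ^ k) < e \<and> c * (1 / 2) ^ k < 1"
    by (rule eventually_conj)
  then obtain N where N: "\<And>k. N \<le> k \<Longrightarrow> \<phi> (c * (1 / 2) ^ k) < e \<and> c * (1 / 2) ^ k < 1"
    by (auto simp: eventually_sequentially)
  show ?thesis by (rule that[of N]) (use N in \<open>auto simp: power_one_over less_imp_le\<close>)
qed

text \<open>The smallest dyadic scale not below \<open>d\<close> is at most \<open>2 * d\<close>, so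
  \<open>\<phi>\<close> grows by at most \<open>2 ^ n\<close>. For \<open>d = 0\<close> no such
  scale exists; a deep level with \<open>\<phi>\<close> below \<open>e\<close> is taken, which
  explains the additive error.\<close>

lemma dyadic_level:
  assumes d: "0 \<le> d" "d \<le> 1 / 2 ^ N" and e: "0 < e"
  shows "\<exists>k\<ge>N. d \<le> 1 / 2 ^ k \<and> \<phi> (1 / 2 ^ k) \<le> 2 ^ n * \<phi> d + e"
proof (cases "d = 0")
  case True
  obtain K where "\<And>k. K \<le> k \<Longrightarrow> \<phi> (1 * (1 / 2 ^ k)) \<le> e" using phi_dyadic_small[of 1 e] e by auto
  then have "\<phi> (1 / 2 ^ max K N) \<le> e" by (metis max.cobounded1 mult_1)
  then show ?thesis using True phi_0 by (intro exI[of _ "max K N"]) auto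
next
  case False
  then have d0: "0 < d" using d by simp
  then obtain k0 where k0: "(1 / 2 :: real) ^ k0 < d" using real_arch_pow_inv[of d "1 / 2"] by auto
  define k1 where "k1 = (LEAST k. (1 / 2 :: real) ^ k < d)"
  have k1: "(1 / 2) ^ k1 < d" unfolding k1_def using k0 by (rule LeastI)
  have "N < k1"
  proof (rule ccontr)
    assume "\<not> N < k1"
    then have "(1 / 2 :: real) ^ N \<le> (1 / 2) ^ k1" by (intro power_decreasing) auto
    then show False using k1 d by (simp add: power_one_over)
  qed
  then obtain k where k: "k1 = Suc k" by (cases k1) auto
  have "\<not> (1 / 2 :: real) ^ k < d" using not_less_Least[of k "\<lambda>k. (1 / 2 :: real) ^ k < d"] k unfolding k1_def by simp
  then have dk: "d \<le> 1 / 2 ^ k" by (simp add: power_one_over)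
  have "1 / 2 ^ k \<le> 2 * d" using k1 k by (simp add: power_one_over)
  then have "\<phi> (1 / 2 ^ k) \<le> \<phi> (2 * d)" by (intro phi_mono) auto
  also have "\<dots> \<le> 2 ^ n * \<phi> d" using d by (intro phi_scale) auto
  finally show ?thesis using dk k \<open>N < k1\<close> e by (intro exI[of _ k]) auto
qed

lemma dyadic_levels:
  fixes C :: "nat \<Rightarrow> 'b::metric_space set"
  assumes C: "\<And>i. bounded (C i)" "\<And>i. diameter (C i) \<le> 1 / 2 ^ N i"
    and S: "(\<Sum>i. ennreal (\<phi> (diameter (C i)))) \<le> ennreal s" "0 \<le> s" and e: "0 < e"
  obtains k where "\<And>i. N i \<le> k i" "\<And>i. diameter (C i) \<le> 1 / 2 ^ k i"
    "(\<Sum>i. ennreal (\<phi> (1 / 2 ^ k i))) \<le> ennreal (2 ^ n * s + e)"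
proof -
  have ex: "\<exists>k\<ge>N i. diameter (C i) \<le> 1 / 2 ^ k \<and> \<phi> (1 / 2 ^ k) \<le> 2 ^ n * \<phi> (diameter (C i)) + e * (1 / 2) ^ Suc i" for i
    using C e by (intro dyadic_level diameter_ge_0) auto
  obtain k where k: "\<forall>i. N i \<le> k i \<and> diameter (C i) \<le> 1 / 2 ^ k i \<and> \<phi> (1 / 2 ^ k i) \<le> 2 ^ n * \<phi> (diameter (C i)) + e * (1 / 2) ^ Suc i"
    using choice[OF allI, OF ex] by (rule exE)
  show ?thesis
  proof (rule that[of k])
    have nn: "0 \<le> \<phi> (diameter (C i))" for i using C by (intro phi_nonneg diameter_ge_0)
    have "(\<Sum>i. ennreal (\<phi> (1 / 2 ^ k i))) \<le> (\<Sum>i. ennreal (2 ^ n) * ennreal (\<phi> (diameter (C i))) + ennreal (e * (1 / 2) ^ Suc i))"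
    proof (intro suminf_le allI)
      fix i
      have "ennreal (\<phi> (1 / 2 ^ k i)) \<le> ennreal (2 ^ n * \<phi> (diameter (C i)) + e * (1 / 2) ^ Suc i)"
        using k by (intro ennreal_leI) blast
      also have "\<dots> = ennreal (2 ^ n) * ennreal (\<phi> (diameter (C i))) + ennreal (e * (1 / 2) ^ Suc i)"
        using nn[of i] e by (subst ennreal_plus) (auto simp: ennreal_mult simp del: ennreal_numeral)
      finally show "ennreal (\<phi> (1 / 2 ^ k i)) \<le> ennreal (2 ^ n) * ennreal (\<phi> (diameter (C i))) + ennreal (e * (1 / 2) ^ Suc i)" .
    qed auto
    also have "\<dots> = (\<Sum>i. ennreal (2 ^ n) * ennreal (\<phi> (diameter (C i)))) + (\<Sum>i. ennreal (e * (1 / 2) ^ Suc i))"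
      by (rule suminf_add[symmetric]) auto
    also have "(\<Sum>i. ennreal (e * (1 / 2) ^ Suc i)) = ennreal e"
      using sums_mult[OF power_half_series, of e] e by (intro suminf_ennreal_eq) auto
    also have "(\<Sum>i. ennreal (2 ^ n) * ennreal (\<phi> (diameter (C i)))) = ennreal (2 ^ n) * (\<Sum>i. ennreal (\<phi> (diameter (C i))))"
      by (rule ennreal_suminf_cmult)
    also have "ennreal (2 ^ n) * (\<Sum>i. ennreal (\<phi> (diameter (C i)))) + ennreal e \<le> ennreal (2 ^ n) * ennreal s + ennreal e"
      by (intro add_right_mono mult_left_mono S) simp
    also have "\<dots> = ennreal (2 ^ n * s + e)"
      using S e by (subst ennreal_plus) (auto simp: ennreal_mult)
    finally show "(\<Sum>i. ennreal (\<phi> (1 / 2 ^ k i))) \<le> ennreal (2 ^ n * s + e)" .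
  qed (use k in auto)
qed

end

section \<open>The energy measure and the images of dyadic covers\<close>

locale sobolev_gauge = sobolev_map \<Omega> u G + young_gauge "CARD('n)" A \<phi>
  for \<Omega> :: "(real^'n) set" and u :: "real^'n \<Rightarrow> real^'m" and G :: "real^'n \<Rightarrow> real^'n^'m" and A \<phi> :: "real \<Rightarrow> real" +
  fixes l :: real
  assumes op: "open \<Omega>" and l: "0 < l"
    and meas: "(\<lambda>x. norm (G x)) \<in> borel_measurable (restrict_space lebesgue \<Omega>)"
    and modular: "(\<integral>\<^sup>+ x\<in>\<Omega>. ennreal (A (\<bar>norm (G x)\<bar> / l)) \<partial>lebesgue) \<le> 1"
begin

text \<open>Extended by 0 outside \<open>\<Omega>\<close>, so that it is a density on the whole
  space and \<open>mass\<close> makes sense for cubes that are not contained in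
  \<open>\<Omega>\<close>.\<close>

definition energy :: "real^'n \<Rightarrow> ennreal" where
  "energy z = ennreal (A (norm (G z) / l)) * indicator \<Omega> z"

abbreviation "mass Q \<equiv> (\<integral>\<^sup>+ z\<in>Q. energy z \<partial>lebesgue)"

lemma energy_measurable [measurable]: "energy \<in> borel_measurable lebesgue"
proof -
  have \<Omega>: "\<Omega> \<inter> space lebesgue \<in> sets lebesgue" using op by simp
  have "(\<lambda>x. A (max 0 (norm (G x) / l))) \<in> borel_measurable (restrict_space lebesgue \<Omega>)"
    using meas by (intro measurable_compose[OF _ young_fun_measurable[OF A]]) simp
  then have "(\<lambda>x. ennreal (A (norm (G x) / l))) \<in> borel_measurable (restrict_space lebesgue \<Omega>)"
    using l by (simp add: max_absorb2)
  then show ?thesis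
    unfolding energy_def[abs_def] by (rule borel_measurable_restrict_space_iff_ennreal[OF \<Omega>, THEN iffD1])
qed

lemma energy_total: "(\<integral>\<^sup>+ z. energy z \<partial>lebesgue) \<le> 1"
  using modular by (simp add: energy_def)

lemma energy_finite_on: "mass Q < \<infinity>"
proof -
  have "mass Q \<le> (\<integral>\<^sup>+ z. energy z \<partial>lebesgue)"
    by (intro nn_integral_mono) (auto split: split_indicator)
  also have "\<dots> \<le> 1" by (rule energy_total)
  finally show ?thesis by (rule le_less_trans) simp
qed

text \<open>The last clause concerns the dyadic cubes that replace the covering sets: those selected
  by points of \<open>E\<close> have to lie in \<open>\<Omega>\<close>, where the oscillation
  estimate holds.\<close>

definition dyadic_cover :: "(real^'n) set \<Rightarrow> (nat \<Rightarrow> (real^'n) set) \<Rightarrow> (nat \<Rightarrow> nat) \<Rightarrow> bool" where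
  "dyadic_cover E S k \<longleftrightarrow> E \<subseteq> (\<Union>i. S i) \<and> (\<forall>i. bounded (S i) \<and> diameter (S i) \<le> 1 / 2 ^ k i) \<and>
     (\<forall>i. \<forall>y\<in>S i \<inter> E. cube (dyadic_corner (k i) (dyadic_code (k i) y)) (1 / 2 ^ k i) \<subseteq> \<Omega>)"

text \<open>The factor 2 in \<open>c = 2 * C\<close> converts the bound on the oscillation into a
  ball of radius \<open>J R / 2\<close>, whose diameter is \<open>J R\<close>. The bound by
  \<open>M\<close> records that \<open>R\<close> stays in the range where \<open>J\<close> is
  controlled.\<close>

lemma cube_image_in_cball:
  assumes C: "morrey_constant A l C"
    and Q: "0 < r" "cube a r \<subseteq> \<Omega>" "ennreal ((2 * C) ^ CARD('n)) * mass (cube a r) \<le> ennreal M"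
    and r: "2 * C * r \<le> 1" "\<phi> (2 * C * r) \<le> M" and M: "M \<le> \<phi> 1"
  shows "\<exists>R\<ge>0. \<exists>y. \<phi> R \<le> M \<and> u ` cube a r \<subseteq> cball y (J R / 2) \<and>
    ennreal (\<phi> R) \<le> ennreal ((2 * C) ^ CARD('n)) * mass (cube a r) + ennreal ((2 * C) ^ CARD('n)) * ennreal (\<phi> r)"
proof -
  define c where "c = 2 * C"
  have c: "1 \<le> c" using C by (simp add: c_def morrey_constant_def)
  define m where "m = enn2real (mass (cube a r))"
  have m: "mass (cube a r) = ennreal m" "0 \<le> m"
    using energy_finite_on[of "cube a r"] by (auto simp: m_def)
  have mA: "(\<integral>\<^sup>+ z\<in>cube a r. ennreal (A (norm (G z) / l)) \<partial>lebesgue) = ennreal m"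
    unfolding m(1)[symmetric] using Q(2) by (auto intro!: nn_integral_cong simp: energy_def split: split_indicator)
  have M0: "0 \<le> M" using phi_nonneg[of "c * r"] r c Q(1) by (simp add: c_def)
  have "c ^ CARD('n) * m \<le> M" using Q(3) m(2) c M0 by (simp add: m(1) c_def[symmetric] ennreal_mult[symmetric])
  then have "\<phi> (c * r) \<le> max (c ^ CARD('n) * m) (\<phi> (c * r))" "max (c ^ CARD('n) * m) (\<phi> (c * r)) \<le> \<phi> 1"
    using r M by (auto simp: c_def)
  \<comment> \<open>The intermediate value theorem on the interval from \<open>c * r\<close> to 1;
    both terms of the maximum are at most \<open>M \<le> \<phi> 1\<close>.\<close>
  then obtain R where R: "c * r \<le> R" "R \<le> 1" "\<phi> R = max (c ^ CARD('n) * m) (\<phi> (c * r))"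
    using IVT'[of \<phi> "c * r" "max (c ^ CARD('n) * m) (\<phi> (c * r))" 1] r c Q(1) continuous_on_subset[OF phi_cont, of "{c * r..1}"]
    by (auto simp: c_def)
  have R0: "0 \<le> R" using R(1) c Q(1) by (smt (verit) mult_nonneg_nonneg)
  have HJ: "c * (r * b (m / r ^ CARD('n))) \<le> J R"
    using R by (intro scaled_b_le_J m Q c) auto
  have "a \<in> cube a r" using Q(1) by (simp add: mem_cube)
  then have "u x \<in> cball (u a) (J R / 2)" if "x \<in> cube a r" for x
    using C[unfolded morrey_constant_def, THEN conjunct2, rule_format, OF Q(1,2) m(2) mA, of a x] that HJ
    by (simp add: dist_norm c_def)
  then have sub: "u ` cube a r \<subseteq> cball (u a) (J R / 2)" by blast
  have "\<phi> R \<le> c ^ CARD('n) * m + \<phi> (c * r)"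
    using R(3) m(2) c phi_nonneg[of "c * r"] Q(1) by auto
  also have "\<dots> \<le> c ^ CARD('n) * m + c ^ CARD('n) * \<phi> r"
    using phi_scale[OF c, of r] Q(1) by simp
  finally have "ennreal (\<phi> R) \<le> ennreal (c ^ CARD('n) * m + c ^ CARD('n) * \<phi> r)" by (rule ennreal_leI)
  also have "\<dots> = ennreal (c ^ CARD('n)) * ennreal m + ennreal (c ^ CARD('n)) * ennreal (\<phi> r)"
    using c m(2) phi_nonneg[of r] Q(1) by (subst ennreal_plus) (auto simp: ennreal_mult)
  finally show ?thesis
    using R0 R(3) sub r(2) \<open>c ^ CARD('n) * m \<le> M\<close> unfolding m(1) c_def by (intro exI[of _ R] conjI exI[of _ "u a"]) auto
qed

text \<open>The images of the cubes are covered by balls of diameter exactly \<^term>\<open>J R\<close>, so that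
  \<^term>\<open>\<psi> (J R) = \<phi> R\<close> applies and only the injectivity of \<^term>\<open>J\<close> is needed.\<close>
lemma content_image_le:
  assumes C: "morrey_constant A l C"
    and cover: "dyadic_cover E S k"
    and Q: "\<And>i a. ennreal ((2 * C) ^ CARD('n)) * mass (cube a (1 / 2 ^ k i)) \<le> ennreal M"
    and k: "\<And>i. 2 * C * (1 / 2 ^ k i) \<le> 1" "\<And>i. \<phi> (2 * C * (1 / 2 ^ k i)) \<le> M"
    and M: "M \<le> \<phi> 1" "\<And>R. 0 \<le> R \<Longrightarrow> \<phi> R \<le> M \<Longrightarrow> ennreal (J R) \<le> \<sigma>"
  shows "\<exists>U\<in>sets lebesgue. emeasure lebesgue U \<le> 3 ^ CARD('n) * (\<Sum>i. ennreal ((1 / 2 ^ k i) ^ CARD('n))) \<and>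
    hausdorff_content \<psi> \<sigma> (u ` E) \<le> ennreal ((2 * C) ^ CARD('n)) * mass U +
      ennreal ((2 * C) ^ CARD('n)) * (3 ^ CARD('n) * (\<Sum>i. ennreal (\<phi> (1 / 2 ^ k i))))"
proof -
  let ?c = "ennreal ((2 * C) ^ CARD('n))"
  have E: "E \<subseteq> (\<Union>i. S i)" and S: "\<And>i. bounded (S i)" "\<And>i. diameter (S i) \<le> 1 / 2 ^ k i"
    using cover by (auto simp: dyadic_cover_def)
  obtain T where T: "E \<subseteq> (\<Union>(l, v)\<in>T. dyadic_cube l v)"
    "\<And>l v l' v'. (l, v) \<in> T \<Longrightarrow> (l', v') \<in> T \<Longrightarrow> (l, v) \<noteq> (l', v') \<Longrightarrow> dyadic_cube l v \<inter> dyadic_cube l' v' = {}"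
    "\<And>l v. (l, v) \<in> T \<Longrightarrow> \<exists>i. \<exists>y\<in>S i \<inter> E. l = k i \<and> v = dyadic_code l y"
    "\<And>w. (\<integral>\<^sup>+ t. w (fst t) \<partial>count_space T) \<le> 3 ^ CARD('n) * (\<Sum>i. w (k i))"
    using dyadic_disjoint_cover[OF E S] by blast
  have cT: "countable T" by (rule countableI_type)
  let ?D = "\<lambda>t. dyadic_cube (fst t) (snd t)"
  have ex: "\<forall>t\<in>T. \<exists>p. 0 \<le> fst p \<and> \<phi> (fst p) \<le> M \<and> u ` ?D t \<subseteq> cball (snd p) (J (fst p) / 2) \<and>
     ennreal (\<phi> (fst p)) \<le> ?c * mass (?D t) + ?c * ennreal (\<phi> (1 / 2 ^ fst t))"
  proof
    fix t assume "t \<in> T"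
    then obtain i y where y: "y \<in> S i \<inter> E" "fst t = k i" "snd t = dyadic_code (fst t) y"
      using T(3)[of "fst t" "snd t"] by auto
    let ?a = "dyadic_corner (fst t) (snd t)" and ?r = "1 / 2 ^ fst t :: real"
    have "\<exists>R\<ge>0. \<exists>y. \<phi> R \<le> M \<and> u ` cube ?a ?r \<subseteq> cball y (J R / 2) \<and>
      ennreal (\<phi> R) \<le> ?c * mass (cube ?a ?r) + ?c * ennreal (\<phi> ?r)"
      using cover y(1) Q[where i = i] k[of i] M(1) y(2,3) unfolding dyadic_cover_def
      by (intro cube_image_in_cball[OF C]) auto
    then obtain R w where "0 \<le> R" "\<phi> R \<le> M" "u ` cube ?a ?r \<subseteq> cball w (J R / 2)"
      "ennreal (\<phi> R) \<le> ?c * mass (cube ?a ?r) + ?c * ennreal (\<phi> ?r)" by blast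
    then show "\<exists>p. 0 \<le> fst p \<and> \<phi> (fst p) \<le> M \<and> u ` ?D t \<subseteq> cball (snd p) (J (fst p) / 2) \<and>
     ennreal (\<phi> (fst p)) \<le> ?c * mass (?D t) + ?c * ennreal (\<phi> (1 / 2 ^ fst t))"
      using dyadic_cube_subset[of "fst t" "snd t"] unfolding nn_integral_dyadic_cube
      by (intro exI[of _ "(R, w)"]) auto
  qed
  obtain p where p: "\<forall>t\<in>T. 0 \<le> fst (p t) \<and> \<phi> (fst (p t)) \<le> M \<and> u ` ?D t \<subseteq> cball (snd (p t)) (J (fst (p t)) / 2) \<and>
     ennreal (\<phi> (fst (p t))) \<le> ?c * mass (?D t) + ?c * ennreal (\<phi> (1 / 2 ^ fst t))"
    using bchoice[OF ex] by blast
  have diam: "diameter (cball (snd (p t)) (J (fst (p t)) / 2)) = J (fst (p t))" if "t \<in> T" for t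
    using p that J_nonneg[of "fst (p t)"] by simp
  \<comment> \<open>The disjoint union of the chosen cubes. Keeping the energy on \<open>U\<close>
    rather than estimating it here leaves absolute continuity to the caller.\<close>
  define U where "U = (\<Union>t\<in>T. ?D t)"
  have disj: "disjoint_family_on ?D T"
    unfolding disjoint_family_on_def using T(2) by (metis prod.collapse)
  have U: "U \<in> sets lebesgue" unfolding U_def using cT by (intro sets.countable_UN'') (auto simp: sets_dyadic_cube)
  have "emeasure lebesgue U = (\<integral>\<^sup>+ t. emeasure lebesgue (?D t) \<partial>count_space T)"
    unfolding U_def by (intro emeasure_UN_countable cT disj) (simp add: sets_dyadic_cube)
  also have "\<dots> \<le> (\<integral>\<^sup>+ t. ennreal ((1 / 2 ^ fst t) ^ CARD('n)) \<partial>count_space T)"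
  proof (rule nn_integral_mono)
    fix t :: "nat \<times> ('n \<Rightarrow> int)"
    have "emeasure lebesgue (?D t) \<le> emeasure lebesgue (cube (dyadic_corner (fst t) (snd t)) (1 / 2 ^ fst t))"
      by (intro emeasure_mono dyadic_cube_subset sets_cube)
    then show "emeasure lebesgue (?D t) \<le> ennreal ((1 / 2 ^ fst t) ^ CARD('n))"
      by (subst (asm) emeasure_cube) auto
  qed
  also have "\<dots> \<le> 3 ^ CARD('n) * (\<Sum>i. ennreal ((1 / 2 ^ k i) ^ CARD('n)))" by (rule T(4))
  finally have eU: "emeasure lebesgue U \<le> 3 ^ CARD('n) * (\<Sum>i. ennreal ((1 / 2 ^ k i) ^ CARD('n)))" .
  have "hausdorff_content \<psi> \<sigma> (u ` E) \<le> (\<integral>\<^sup>+ t. ennreal (\<psi> (diameter (cball (snd (p t)) (J (fst (p t)) / 2)))) \<partial>count_space T)"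
  proof (rule hausdorff_content_le_countable[OF cT])
    show "u ` E \<subseteq> (\<Union>t\<in>T. cball (snd (p t)) (J (fst (p t)) / 2))"
    proof
      fix w assume "w \<in> u ` E"
      then obtain x where x: "x \<in> E" "w = u x" by blast
      then obtain t where t: "t \<in> T" "x \<in> ?D t" using T(1) by fastforce
      then have "w \<in> u ` ?D t" using x by blast
      then show "w \<in> (\<Union>t\<in>T. cball (snd (p t)) (J (fst (p t)) / 2))" using p t(1) by blast
    qed
    show "ennreal (diameter (cball (snd (p t)) (J (fst (p t)) / 2))) \<le> \<sigma>" if "t \<in> T" for t
      unfolding diam[OF that] using p that by (intro M(2)) auto
    show "\<psi> 0 = 0" by (rule psi_0)
  qed auto
  also have "\<dots> = (\<integral>\<^sup>+ t. ennreal (\<phi> (fst (p t))) \<partial>count_space T)"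
  proof (rule nn_integral_cong)
    fix t assume "t \<in> space (count_space T)"
    then have "t \<in> T" by simp
    then show "ennreal (\<psi> (diameter (cball (snd (p t)) (J (fst (p t)) / 2)))) = ennreal (\<phi> (fst (p t)))"
      unfolding diam[OF \<open>t \<in> T\<close>] using p by (simp add: psi_J)
  qed
  also have "\<dots> \<le> (\<integral>\<^sup>+ t. ?c * mass (?D t) + ?c * ennreal (\<phi> (1 / 2 ^ fst t)) \<partial>count_space T)"
    using p by (intro nn_integral_mono) auto
  also have "\<dots> = ?c * (\<integral>\<^sup>+ t. mass (?D t) \<partial>count_space T) + ?c * (\<integral>\<^sup>+ t. ennreal (\<phi> (1 / 2 ^ fst t)) \<partial>count_space T)"
    by (subst nn_integral_add) (auto simp: nn_integral_cmult)
  also have "(\<integral>\<^sup>+ t. mass (?D t) \<partial>count_space T) = (\<integral>\<^sup>+ t. emeasure (density lebesgue energy) (?D t) \<partial>count_space T)"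
    by (intro nn_integral_cong) (simp add: emeasure_density sets_dyadic_cube)
  also have "\<dots> = emeasure (density lebesgue energy) U"
    unfolding U_def by (intro emeasure_UN_countable[symmetric] cT disj) (simp add: sets_dyadic_cube)
  also have "\<dots> = mass U" by (rule emeasure_density) (auto simp: U)
  also have "?c * mass U + ?c * (\<integral>\<^sup>+ t. ennreal (\<phi> (1 / 2 ^ fst t)) \<partial>count_space T)
     \<le> ?c * mass U + ?c * (3 ^ CARD('n) * (\<Sum>i. ennreal (\<phi> (1 / 2 ^ k i))))"
    by (intro add_left_mono mult_left_mono T(4)) simp
  finally show ?thesis using U eU by blast
qed

text \<open>The level \<^term>\<open>K\<close> depends on \<^term>\<open>\<sigma>\<close>, but \<^term>\<open>\<delta>\<close> does not.\<close>
lemma content_image_small: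
  assumes \<epsilon>: "0 < \<epsilon>"
  obtains \<delta> where "0 < \<delta>" "\<And>M \<sigma>. \<lbrakk>0 < M; M \<le> \<phi> 1; \<And>R. 0 \<le> R \<Longrightarrow> \<phi> R \<le> M \<Longrightarrow> ennreal (J R) \<le> \<sigma>\<rbrakk> \<Longrightarrow>
    \<exists>K. \<forall>E S k. dyadic_cover E S k \<longrightarrow> (\<forall>i. K \<le> k i) \<longrightarrow>
      (\<Sum>i. ennreal (\<phi> (1 / 2 ^ k i))) \<le> ennreal \<delta> \<longrightarrow> hausdorff_content \<psi> \<sigma> (u ` E) \<le> ennreal \<epsilon>"
proof -
  obtain C where C: "morrey_constant A l C"
    using morrey_constant_exists[OF A C1 C2 l] by blast
  then have C1': "1 \<le> C" by (simp add: morrey_constant_def)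
  define c where "c = (2 * C) ^ CARD('n)"
  have c: "1 \<le> c" unfolding c_def using C1' by (intro one_le_power) simp
  have tot: "(\<integral>\<^sup>+ z. energy z \<partial>lebesgue) < \<infinity>" using energy_total by (rule le_less_trans) simp
  have p1: "0 < \<phi> 1" by (rule phi_pos) simp
  \<comment> \<open>The volume threshold for the whole union; it depends on
    \<open>\<epsilon>\<close> only and enters \<open>\<delta>\<close>.\<close>
  obtain d where d: "0 < d" "\<And>U. U \<in> sets lebesgue \<Longrightarrow> emeasure lebesgue U \<le> ennreal d \<Longrightarrow> mass U \<le> ennreal (\<epsilon> / (2 * c))"
    using nn_integral_absolutely_continuous[OF energy_measurable tot, of "\<epsilon> / (2 * c)"] \<epsilon> c by auto
  \<comment> \<open>The first entry forces the volume of \<open>U\<close> below \<open>d\<close>,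
    the second bounds the contribution of the \<open>\<phi>\<close>-sum by
    \<open>\<epsilon> / 2\<close>.\<close>
  define \<delta> where "\<delta> = min (d * \<phi> 1 / 3 ^ CARD('n)) (\<epsilon> / (2 * c * 3 ^ CARD('n)))"
  have \<delta>: "0 < \<delta>" using d(1) p1 \<epsilon> c by (simp add: \<delta>_def)
  have \<delta>1: "3 ^ CARD('n) * (\<delta> / \<phi> 1) \<le> d"
  proof -
    have "3 ^ CARD('n) * (\<delta> / \<phi> 1) \<le> 3 ^ CARD('n) * ((d * \<phi> 1 / 3 ^ CARD('n)) / \<phi> 1)"
      using p1 by (intro mult_left_mono divide_right_mono) (auto simp: \<delta>_def)
    then show ?thesis using p1 by simp
  qed
  have \<delta>2: "c * (3 ^ CARD('n) * \<delta>) \<le> \<epsilon> / 2"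
  proof -
    have "c * (3 ^ CARD('n) * \<delta>) \<le> c * (3 ^ CARD('n) * (\<epsilon> / (2 * c * 3 ^ CARD('n))))"
      using c by (intro mult_left_mono) (auto simp: \<delta>_def)
    then show ?thesis using c by simp
  qed
  have three: "(3 :: ennreal) ^ CARD('n) = ennreal (3 ^ CARD('n))" by (simp add: ennreal_power[symmetric])
  show ?thesis
  proof (rule that[OF \<delta>])
    fix M :: real and \<sigma> :: ennreal assume M: "0 < M" "M \<le> \<phi> 1" "\<And>R. 0 \<le> R \<Longrightarrow> \<phi> R \<le> M \<Longrightarrow> ennreal (J R) \<le> \<sigma>"
    \<comment> \<open>The volume threshold for one cube. It depends on \<open>M\<close>, hence
      possibly on \<open>\<sigma>\<close>, and so may affect the level \<open>K\<close> but not
      \<open>\<delta>\<close>.\<close>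
    obtain d' where d': "0 < d'" "\<And>U. U \<in> sets lebesgue \<Longrightarrow> emeasure lebesgue U \<le> ennreal d' \<Longrightarrow> mass U \<le> ennreal (M / c)"
      using nn_integral_absolutely_continuous[OF energy_measurable tot, of "M / c"] M c by auto
    obtain K1 where K1: "\<And>k. K1 \<le> k \<Longrightarrow> \<phi> (2 * C * (1 / 2 ^ k)) \<le> M" "\<And>k. K1 \<le> k \<Longrightarrow> 2 * C * (1 / 2 ^ k) \<le> 1"
      using phi_dyadic_small[of "2 * C" M] C1' M(1) by auto
    obtain K2 where K2: "(1 / 2 :: real) ^ K2 < d'" using real_arch_pow_inv[of d' "1 / 2"] d'(1) by auto
    show "\<exists>K. \<forall>E S k. dyadic_cover E S k \<longrightarrow> (\<forall>i. K \<le> k i) \<longrightarrow>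
      (\<Sum>i. ennreal (\<phi> (1 / 2 ^ k i))) \<le> ennreal \<delta> \<longrightarrow> hausdorff_content \<psi> \<sigma> (u ` E) \<le> ennreal \<epsilon>"
    proof (intro exI[of _ "max K1 K2"] allI impI)
      fix E S and k :: "nat \<Rightarrow> nat"
      assume E: "dyadic_cover E S k" and S: "\<forall>i. max K1 K2 \<le> k i"
        and sum: "(\<Sum>i. ennreal (\<phi> (1 / 2 ^ k i))) \<le> ennreal \<delta>"
      have small: "ennreal ((2 * C) ^ CARD('n)) * mass (cube a (1 / 2 ^ k i)) \<le> ennreal M" for i a
      proof -
        have "(1 / 2 ^ k i) ^ CARD('n) \<le> (1 / 2 ^ k i :: real)"
          using power_decreasing[of 1 "CARD('n)" "1 / 2 ^ k i :: real"] n by simp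
        also have "\<dots> \<le> (1 / 2) ^ K2"
          using S power_decreasing[of K2 "k i" "1 / 2 :: real"] by (simp add: power_one_over)
        also have "\<dots> \<le> d'" using K2 by simp
        finally have "emeasure lebesgue (cube a (1 / 2 ^ k i)) \<le> ennreal d'"
          by (subst emeasure_cube) (auto intro: ennreal_leI)
        then have "mass (cube a (1 / 2 ^ k i)) \<le> ennreal (M / c)" by (intro d'(2) sets_cube)
        then have "ennreal c * mass (cube a (1 / 2 ^ k i)) \<le> ennreal c * ennreal (M / c)"
          by (intro mult_left_mono) auto
        also have "\<dots> = ennreal M" using c M(1) by (simp add: ennreal_mult[symmetric])
        finally show ?thesis by (simp add: c_def)
      qed
      have "\<exists>U\<in>sets lebesgue. emeasure lebesgue U \<le> 3 ^ CARD('n) * (\<Sum>i. ennreal ((1 / 2 ^ k i) ^ CARD('n))) \<and>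
        hausdorff_content \<psi> \<sigma> (u ` E) \<le> ennreal ((2 * C) ^ CARD('n)) * mass U +
          ennreal ((2 * C) ^ CARD('n)) * (3 ^ CARD('n) * (\<Sum>i. ennreal (\<phi> (1 / 2 ^ k i))))"
        using S small K1 M by (intro content_image_le[OF C E]) auto
      then obtain U where U: "U \<in> sets lebesgue" "emeasure lebesgue U \<le> 3 ^ CARD('n) * (\<Sum>i. ennreal ((1 / 2 ^ k i) ^ CARD('n)))"
        "hausdorff_content \<psi> \<sigma> (u ` E) \<le> ennreal c * mass U +
          ennreal c * (3 ^ CARD('n) * (\<Sum>i. ennreal (\<phi> (1 / 2 ^ k i))))" unfolding c_def by blast
      have "(\<Sum>i. ennreal ((1 / 2 ^ k i) ^ CARD('n))) \<le> (\<Sum>i. ennreal (1 / \<phi> 1) * ennreal (\<phi> (1 / 2 ^ k i)))"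
      proof (intro suminf_le allI)
        fix i
        let ?r = "1 / 2 ^ k i :: real"
        \<comment> \<open>Comparison with radius 1: monotonicity of \<open>\<phi> r / r ^ n\<close>
          bounds the volume of each cube by \<open>\<phi> r / \<phi> 1\<close>.\<close>
        have "\<phi> 1 / 1 ^ CARD('n) \<le> \<phi> ?r / ?r ^ CARD('n)" by (rule phi_ratio) auto
        then have "\<phi> 1 * ?r ^ CARD('n) \<le> \<phi> ?r" by (simp only: power_one div_by_1) (simp add: pos_le_divide_eq)
        then have "?r ^ CARD('n) \<le> (1 / \<phi> 1) * \<phi> ?r" using p1 by (simp add: pos_le_divide_eq mult.commute)
        then have "ennreal (?r ^ CARD('n)) \<le> ennreal ((1 / \<phi> 1) * \<phi> ?r)" by (rule ennreal_leI)
        also have "\<dots> = ennreal (1 / \<phi> 1) * ennreal (\<phi> ?r)" using p1 by (intro ennreal_mult') simp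
        finally show "ennreal (?r ^ CARD('n)) \<le> ennreal (1 / \<phi> 1) * ennreal (\<phi> ?r)" .
      qed auto
      also have "\<dots> = ennreal (1 / \<phi> 1) * (\<Sum>i. ennreal (\<phi> (1 / 2 ^ k i)))" by (rule ennreal_suminf_cmult)
      also have "\<dots> \<le> ennreal (1 / \<phi> 1) * ennreal \<delta>" by (intro mult_left_mono sum) simp
      also have "\<dots> = ennreal (\<delta> / \<phi> 1)" using p1 \<delta> by (simp add: ennreal_mult[symmetric])
      finally have "3 ^ CARD('n) * (\<Sum>i. ennreal ((1 / 2 ^ k i) ^ CARD('n))) \<le> ennreal (3 ^ CARD('n)) * ennreal (\<delta> / \<phi> 1)"
        unfolding three by (intro mult_left_mono) auto
      also have "\<dots> = ennreal (3 ^ CARD('n) * (\<delta> / \<phi> 1))" by (rule ennreal_mult'[symmetric]) simp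
      also have "\<dots> \<le> ennreal d" by (intro ennreal_leI \<delta>1)
      finally have "emeasure lebesgue U \<le> ennreal d" using U(2) by (rule order_trans[rotated])
      then have "mass U \<le> ennreal (\<epsilon> / (2 * c))" by (intro d(2) U(1))
      then have "ennreal c * mass U \<le> ennreal c * ennreal (\<epsilon> / (2 * c))"
        by (intro mult_left_mono) auto
      also have "\<dots> = ennreal (\<epsilon> / 2)" using c \<epsilon> by (simp add: ennreal_mult[symmetric])
      finally have e1: "ennreal c * mass U \<le> ennreal (\<epsilon> / 2)" .
      have "ennreal c * (3 ^ CARD('n) * (\<Sum>i. ennreal (\<phi> (1 / 2 ^ k i)))) \<le> ennreal c * (ennreal (3 ^ CARD('n)) * ennreal \<delta>)"
        unfolding three by (intro mult_left_mono sum) auto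
      also have "\<dots> = ennreal (c * (3 ^ CARD('n) * \<delta>))" using c \<delta> by (simp only: ennreal_mult' less_imp_le zero_le_power zero_le_numeral order_trans[OF zero_le_one])
      also have "\<dots> \<le> ennreal (\<epsilon> / 2)" by (intro ennreal_leI \<delta>2)
      finally have "hausdorff_content \<psi> \<sigma> (u ` E) \<le> ennreal (\<epsilon> / 2) + ennreal (\<epsilon> / 2)"
        using U(3) e1 by (meson add_mono order_trans)
      also have "\<dots> = ennreal \<epsilon>" using \<epsilon> by (simp add: ennreal_plus[symmetric] del: ennreal_plus)
      finally show "hausdorff_content \<psi> \<sigma> (u ` E) \<le> ennreal \<epsilon>" .
    qed
  qed
qed

end

section \<open>From dyadic covers to contents on the whole space and measures on open sets\<close>

context sobolev_gauge
begin

text \<open>The content puts no restriction on diameters, but each term of an almost optimal cover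
  is below \<open>\<delta>\<close>, and \<open>\<delta> \<le> \<phi> (1 / 2 ^ K)\<close> forces each
  diameter to be at most \<open>1 / 2 ^ K\<close>. The image may be covered at any scale, so
  \<open>M = \<phi> 1\<close> is allowed.\<close>

lemma content_image_small_UNIV:
  assumes UNIV: "\<Omega> = UNIV" and \<epsilon>: "0 < \<epsilon>"
  shows "\<exists>\<delta>>0. \<forall>E. hausdorff_content \<phi> \<infinity> E < ennreal \<delta> \<longrightarrow> hausdorff_content \<psi> \<infinity> (u ` E) \<le> ennreal \<epsilon>"
proof -
  obtain \<delta>' where \<delta>': "0 < \<delta>'" and main: "\<And>M \<sigma>. \<lbrakk>0 < M; M \<le> \<phi> 1; \<And>R. 0 \<le> R \<Longrightarrow> \<phi> R \<le> M \<Longrightarrow> ennreal (J R) \<le> \<sigma>\<rbrakk> \<Longrightarrow>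
    \<exists>K. \<forall>E S k. dyadic_cover E S k \<longrightarrow> (\<forall>i. K \<le> k i) \<longrightarrow>
      (\<Sum>i. ennreal (\<phi> (1 / 2 ^ k i))) \<le> ennreal \<delta>' \<longrightarrow> hausdorff_content \<psi> \<sigma> (u ` E) \<le> ennreal \<epsilon>"
    using content_image_small[OF \<epsilon>] by blast
  have p1: "0 < \<phi> 1" by (rule phi_pos) simp
  obtain K where K: "\<forall>E S k. dyadic_cover E S k \<longrightarrow> (\<forall>i. K \<le> k i) \<longrightarrow>
      (\<Sum>i. ennreal (\<phi> (1 / 2 ^ k i))) \<le> ennreal \<delta>' \<longrightarrow> hausdorff_content \<psi> \<infinity> (u ` E) \<le> ennreal \<epsilon>"
    using main[OF p1 order_refl, of \<infinity>] by auto
  \<comment> \<open>The factor from rounding to dyadic scales, plus 1 for the additive error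
    \<open>\<delta>\<close>.\<close>
  define c where "c = (2::real) ^ CARD('n) + 1"
  have c: "0 < c" by (simp add: c_def add_pos_pos)
  define \<delta> where "\<delta> = min (\<delta>' / c) (\<phi> (1 / 2 ^ K))"
  have \<delta>: "0 < \<delta>" using \<delta>' c phi_pos[of "1 / 2 ^ K"] by (simp add: \<delta>_def)
  show ?thesis
  proof (intro exI[of _ \<delta>] conjI allI impI \<delta>)
    fix E :: "(real^'n) set" assume "hausdorff_content \<phi> \<infinity> E < ennreal \<delta>"
    then obtain S where S: "E \<subseteq> (\<Union>i. S i)" "\<And>i. bounded (S i)" "(\<Sum>i. ennreal (\<phi> (diameter (S i)))) < ennreal \<delta>"
      unfolding hausdorff_content_def INF_less_iff by auto
    have diam: "diameter (S i) \<le> 1 / 2 ^ K" for i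
    proof (rule ccontr)
      assume "\<not> diameter (S i) \<le> 1 / 2 ^ K"
      then have "\<delta> \<le> \<phi> (diameter (S i))" using phi_mono[of "1 / 2 ^ K" "diameter (S i)"] by (simp add: \<delta>_def)
      then have "ennreal \<delta> \<le> (\<Sum>i\<in>{i}. ennreal (\<phi> (diameter (S i))))" by (simp add: ennreal_leI)
      also have "\<dots> \<le> (\<Sum>i. ennreal (\<phi> (diameter (S i))))" by (rule sum_le_suminf) auto
      finally show False using S(3) by simp
    qed
    obtain k where k: "\<And>i. K \<le> k i" "\<And>i. diameter (S i) \<le> 1 / 2 ^ k i"
      "(\<Sum>i. ennreal (\<phi> (1 / 2 ^ k i))) \<le> ennreal (2 ^ CARD('n) * \<delta> + \<delta>)"
      using dyadic_levels[of S "\<lambda>_. K", OF S(2) diam less_imp_le[OF S(3)] less_imp_le[OF \<delta>] \<delta>] by blast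
    have "2 ^ CARD('n) * \<delta> + \<delta> = c * \<delta>" by (simp add: c_def algebra_simps)
    also have "\<dots> \<le> c * (\<delta>' / c)" using c by (intro mult_left_mono) (auto simp: \<delta>_def)
    also have "\<dots> = \<delta>'" using c by simp
    finally have "(\<Sum>i. ennreal (\<phi> (1 / 2 ^ k i))) \<le> ennreal \<delta>'"
      using k(3) by (meson ennreal_leI order_trans)
    moreover have "dyadic_cover E S k" unfolding dyadic_cover_def using S k UNIV by auto
    ultimately show "hausdorff_content \<psi> \<infinity> (u ` E) \<le> ennreal \<epsilon>"
      using k(1) by (intro K[rule_format])
  qed
qed

text \<open>Points of \<^term>\<open>\<Omega>\<close> are sorted into layers by their distance to the complement. Layers whose
  indices differ by at least two are at positive distance from each other.\<close>
lemma measure_image_small: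
  assumes \<epsilon>: "0 < \<epsilon>"
  shows "\<exists>\<delta>>0. \<forall>E. E \<subseteq> \<Omega> \<longrightarrow> hausdorff_measure \<phi> E < ennreal \<delta> \<longrightarrow> hausdorff_measure \<psi> (u ` E) \<le> ennreal \<epsilon>"
proof -
  obtain \<delta>' where \<delta>': "0 < \<delta>'" and main: "\<And>M \<sigma>. \<lbrakk>0 < M; M \<le> \<phi> 1; \<And>R. 0 \<le> R \<Longrightarrow> \<phi> R \<le> M \<Longrightarrow> ennreal (J R) \<le> \<sigma>\<rbrakk> \<Longrightarrow>
    \<exists>K. \<forall>E S k. dyadic_cover E S k \<longrightarrow> (\<forall>i. K \<le> k i) \<longrightarrow>
      (\<Sum>i. ennreal (\<phi> (1 / 2 ^ k i))) \<le> ennreal \<delta>' \<longrightarrow> hausdorff_content \<psi> \<sigma> (u ` E) \<le> ennreal \<epsilon>"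
    using content_image_small[OF \<epsilon>] by blast
  have p1: "0 < \<phi> 1" by (rule phi_pos) simp
  \<comment> \<open>\<open>infdist\<close> to the empty set is 0, so the whole space needs a
    positive default value.\<close>
  define D where "D x = (if \<Omega> = UNIV then 1 else infdist x (- \<Omega>))" for x
  have D_lip: "\<bar>D x - D y\<bar> \<le> dist x y" for x y
    using infdist_triangle_abs[of x "- \<Omega>" y] by (simp add: D_def)
  have D_pos: "0 < D x" if "x \<in> \<Omega>" for x
    using that op in_closed_iff_infdist_zero[of "- \<Omega>" x] infdist_nonneg[of x "- \<Omega>"] by (auto simp: D_def less_le)
  have D_in: "y \<in> \<Omega>" if "dist x y < D x" for x y
    using that infdist_le[of y "- \<Omega>" x] by (auto simp: D_def split: if_splits)
  define L where "L x = nat \<lceil>1 / D x\<rceil>" for x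
  have L_ge: "1 / D x \<le> real (L x)" for x unfolding L_def by linarith
  \<comment> \<open>The \<open>4\<close> comes from the layered cover, \<open>2 ^ n\<close> from
    rounding to dyadic scales and \<open>1\<close> from its additive error.\<close>
  define c where "c = 4 * (2::real) ^ CARD('n) + 1"
  have c: "0 < c" by (simp add: c_def add_pos_pos)
  define \<delta> where "\<delta> = \<delta>' / c"
  have \<delta>: "0 < \<delta>" using \<delta>' c by (simp add: \<delta>_def)
  show ?thesis
  proof (intro exI[of _ \<delta>] conjI allI impI \<delta>)
    fix E :: "(real^'n) set" assume E: "E \<subseteq> \<Omega>" "hausdorff_measure \<phi> E < ennreal \<delta>"
    have sep: "\<exists>\<eta>>0. \<forall>x\<in>E. \<forall>y\<in>E. L x < K \<longrightarrow> L y < K \<longrightarrow> dist x y < \<eta> \<longrightarrow> L x \<le> Suc (L y)" for K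
    \<comment> \<open>Below layer \<open>K\<close> both distances \<open>D\<close> are at least
      \<open>1 / (K + 1)\<close>, so points this close have reciprocals \<open>1 / D\<close>
      differing by at most 1, and the ceilings then differ by at most 1.\<close>
    proof (intro exI[of _ "1 / (real K + 1)\<^sup>2"] conjI ballI impI)
      show "0 < 1 / (real K + 1)\<^sup>2" by (intro divide_pos_pos zero_less_power) auto
    next
      fix x y assume xy: "x \<in> E" "y \<in> E" "L x < K" "L y < K" "dist x y < 1 / (real K + 1)\<^sup>2"
      have Dxy: "0 < D x" "0 < D y" using xy E D_pos by auto
      have K0: "0 < real K + 1" using xy by simp
      have DK: "1 \<le> (real K + 1) * D z" if "z \<in> {x, y}" for z
      proof -
        have "1 / D z \<le> real K + 1" using L_ge[of z] xy that by fastforce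
        then show ?thesis using Dxy that by (auto simp: pos_divide_le_eq)
      qed
      have "1 / D x - 1 / D y = (D y - D x) / (D x * D y)" using Dxy by (simp add: field_simps)
      also have "\<dots> \<le> 1"
      proof -
        have "D y - D x \<le> dist x y" using D_lip[of x y] by linarith
        also have "\<dots> \<le> 1 / (real K + 1)\<^sup>2" using xy by simp
        also have "\<dots> \<le> D x * D y"
        proof -
          have "1 * 1 \<le> ((real K + 1) * D x) * ((real K + 1) * D y)" using DK Dxy by (intro mult_mono) auto
          also have "\<dots> = (D x * D y) * (real K + 1)\<^sup>2" by (simp only: power2_eq_square mult_ac)
          finally show ?thesis using K0 by (simp add: pos_divide_le_eq)
        qed
        finally show ?thesis using Dxy by simp
      qed
      finally have "1 / D x \<le> 1 / D y + 1" by simp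
      then show "L x \<le> Suc (L y)" unfolding L_def by linarith
    qed
    have "hausdorff_content \<psi> (ennreal \<tau>) (u ` E) \<le> ennreal \<epsilon>" if \<tau>: "0 < \<tau>" for \<tau>
    proof -
      obtain \<eta> where \<eta>: "0 < \<eta>" "\<And>R. 0 \<le> R \<Longrightarrow> \<phi> R < \<eta> \<Longrightarrow> J R \<le> \<tau>" using J_small[OF \<tau>] by blast
      define M where "M = min (\<phi> 1) (\<eta> / 2)"
      have M: "0 < M" "M \<le> \<phi> 1" "M < \<eta>" using \<eta>(1) p1 by (auto simp: M_def)
      have "ennreal (J R) \<le> ennreal \<tau>" if "0 \<le> R" "\<phi> R \<le> M" for R
        using \<eta>(2)[of R] that M by (intro ennreal_leI) simp
      from main[OF M(1,2) this] obtain K where K: "\<forall>E S k. dyadic_cover E S k \<longrightarrow> (\<forall>i. K \<le> k i) \<longrightarrow>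
        (\<Sum>i. ennreal (\<phi> (1 / 2 ^ k i))) \<le> ennreal \<delta>' \<longrightarrow> hausdorff_content \<psi> (ennreal \<tau>) (u ` E) \<le> ennreal \<epsilon>" by blast
      \<comment> \<open>A point of layer \<open>q\<close> has distance at least
        \<open>1 / (q + 1)\<close> to the complement, up to the convention for the whole space. The
        level \<open>N\<close> makes the diameter bound of the dyadic cubes smaller than
        that.\<close>
      have "\<exists>N. real CARD('n) * (1 / 2 ^ N) * (real q + 1) < 1" for q :: nat
      proof -
        obtain N where "(1 / 2 :: real) ^ N < 1 / (real CARD('n) * (real q + 1))"
          using real_arch_pow_inv[of "1 / (real CARD('n) * (real q + 1))" "1 / 2"] by auto
        then have "(1 / 2 :: real) ^ N * (real CARD('n) * (real q + 1)) < 1"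
          by (subst (asm) pos_less_divide_eq) auto
        then show ?thesis by (intro exI[of _ N]) (simp add: power_one_over)
      qed
      then obtain N where N: "\<And>q. real CARD('n) * (1 / 2 ^ N q) * (real q + 1) < 1" by metis
      obtain S :: "nat \<Rightarrow> (real^'n) set" and q :: "nat \<Rightarrow> nat" where S: "E \<subseteq> (\<Union>i. S i)" "\<And>i. bounded (S i)"
        "\<And>i. diameter (S i) \<le> 1 / 2 ^ max K (N (q i))" "\<And>i x. x \<in> S i \<Longrightarrow> x \<in> E \<and> L x = q i"
        "(\<Sum>i. ennreal (\<phi> (diameter (S i)))) \<le> ennreal (4 * \<delta>)"
        using layered_cover[of \<phi> "\<lambda>q. 1 / 2 ^ max K (N q)" E L \<delta>, OF phi_0 phi_mono _ sep E(2)] by auto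
      obtain k where k: "\<And>i. max K (N (q i)) \<le> k i" "\<And>i. diameter (S i) \<le> 1 / 2 ^ k i"
        "(\<Sum>i. ennreal (\<phi> (1 / 2 ^ k i))) \<le> ennreal (2 ^ CARD('n) * (4 * \<delta>) + \<delta>)"
        using dyadic_levels[of S "\<lambda>i. max K (N (q i))", OF S(2,3,5) _ \<delta>] \<delta> by auto
      have "2 ^ CARD('n) * (4 * \<delta>) + \<delta> = c * \<delta>" by (simp add: c_def algebra_simps)
      also have "\<dots> = \<delta>'" using c by (simp add: \<delta>_def)
      finally have sum: "(\<Sum>i. ennreal (\<phi> (1 / 2 ^ k i))) \<le> ennreal \<delta>'" using k(3) by simp
      have "cube (dyadic_corner (k i) (dyadic_code (k i) y)) (1 / 2 ^ k i) \<subseteq> \<Omega>" if y: "y \<in> S i \<inter> E" for i y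
      proof
        fix z assume z: "z \<in> cube (dyadic_corner (k i) (dyadic_code (k i) y)) (1 / 2 ^ k i)"
        have "y \<in> dyadic_cube (k i) (dyadic_code (k i) y)" by (simp add: dyadic_cube_def)
        then have "dist y z \<le> real CARD('n) * (1 / 2 ^ k i)"
          using dist_cube_le[OF _ z, of y] dyadic_cube_subset by blast
        also have "\<dots> \<le> real CARD('n) * (1 / 2 ^ N (q i))"
          using k(1)[of i] by (intro mult_left_mono divide_left_mono power_increasing) auto
        also have "\<dots> < D y"
        proof -
          have Dy: "0 < D y" using y E D_pos by auto
          have "1 / D y \<le> real (q i) + 1" using L_ge[of y] S(4)[of y i] y by auto
          then have "1 \<le> (real (q i) + 1) * D y" using Dy by (simp add: pos_divide_le_eq)
          moreover have "real CARD('n) * (1 / 2 ^ N (q i)) * ((real (q i) + 1) * D y) < D y"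
            using mult_strict_right_mono[OF N[of "q i"] Dy] by (simp add: mult.assoc)
          moreover have "real CARD('n) * (1 / 2 ^ N (q i)) * 1 \<le> real CARD('n) * (1 / 2 ^ N (q i)) * ((real (q i) + 1) * D y)"
            using calculation(1) by (intro mult_left_mono) auto
          ultimately show ?thesis by linarith
        qed
        finally show "z \<in> \<Omega>" by (rule D_in)
      qed
      then show ?thesis using S(1,2) k(1,2) sum by (intro K[rule_format, of E S k]) (auto simp: dyadic_cover_def)
    qed
    then show "hausdorff_measure \<psi> (u ` E) \<le> ennreal \<epsilon>"
      unfolding hausdorff_measure_def by (intro SUP_least) auto
  qed
qed

end

lemma sobolev_gauge_of_V1A:
  fixes \<Omega> :: "(real^'n) set" and u :: "real^'n \<Rightarrow> real^'m"
  assumes "open \<Omega>" "young_fun A" "cond_C1 CARD('n) A" "cond_C2 A" "cond_C3 CARD('n) A" "gauge_fun CARD('n) \<phi>"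
    and u: "V1A A \<Omega> u" "continuous_on \<Omega> u"
  obtains G l where "sobolev_gauge \<Omega> u G A \<phi> l"
proof -
  obtain G where G: "weak_gradient \<Omega> u G" "orlicz_space A \<Omega> (\<lambda>x. norm (G x))" using u(1) by (auto simp: V1A_def)
  then obtain l where "0 < l" "(\<integral>\<^sup>+ x\<in>\<Omega>. ennreal (A (\<bar>norm (G x)\<bar> / l)) \<partial>lebesgue) \<le> 1"
    "(\<lambda>x. norm (G x)) \<in> borel_measurable (restrict_space lebesgue \<Omega>)"
    by (auto simp: orlicz_space_def)
  then have "sobolev_gauge \<Omega> u G A \<phi> l"
    using assms G by unfold_locales (auto simp: Suc_leI)
  then show ?thesis by (rule that)
qed

theorem theorem3p1:
  fixes \<Omega> :: "(real^'n) set" and A \<phi> :: "real \<Rightarrow> real"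
  assumes "open \<Omega>"
    and "young_fun A" and "cond_C1 CARD('n) A" and "cond_C2 A" and "cond_C3 CARD('n) A"
    and "gauge_fun CARD('n) \<phi>"
  shows "(\<forall>u :: real^'n \<Rightarrow> real^'m. V1A A \<Omega> u \<and> continuous_on \<Omega> u \<longrightarrow>
            (\<forall>\<epsilon>>0. \<exists>\<delta>>0. \<forall>E. E \<subseteq> \<Omega> \<longrightarrow> hausdorff_measure \<phi> E < ennreal \<delta> \<longrightarrow>
               hausdorff_measure (gauge_psi CARD('n) A \<phi>) (u ` E) < ennreal \<epsilon>))
       \<and> (\<forall>u :: real^'n \<Rightarrow> real^'m. V1A A UNIV u \<and> continuous_on UNIV u \<longrightarrow>
            (\<forall>\<epsilon>>0. \<exists>\<delta>>0. \<forall>E. hausdorff_content \<phi> \<infinity> E < ennreal \<delta> \<longrightarrow>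
               hausdorff_content (gauge_psi CARD('n) A \<phi>) \<infinity> (u ` E) < ennreal \<epsilon>))"
proof (intro conjI allI impI)
  fix u :: "real^'n \<Rightarrow> real^'m" and \<epsilon> :: real
  assume u: "V1A A \<Omega> u \<and> continuous_on \<Omega> u" and \<epsilon>: "0 < \<epsilon>"
  then obtain G l where "sobolev_gauge \<Omega> u G A \<phi> l" using sobolev_gauge_of_V1A[OF assms] by blast
  then interpret sobolev_gauge \<Omega> u G A \<phi> l .
  \<comment> \<open>Half of \<open>\<epsilon>\<close> is used, because the estimates end in a weak
    inequality and the claim is strict.\<close>
  obtain \<delta> where \<delta>: "0 < \<delta>" "\<And>E. E \<subseteq> \<Omega> \<Longrightarrow> hausdorff_measure \<phi> E < ennreal \<delta> \<Longrightarrow> hausdorff_measure \<psi> (u ` E) \<le> ennreal (\<epsilon> / 2)"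
    using measure_image_small[of "\<epsilon> / 2"] \<epsilon> by auto
  have "ennreal (\<epsilon> / 2) < ennreal \<epsilon>" using \<epsilon> by (intro ennreal_lessI) auto
  then show "\<exists>\<delta>>0. \<forall>E. E \<subseteq> \<Omega> \<longrightarrow> hausdorff_measure \<phi> E < ennreal \<delta> \<longrightarrow> hausdorff_measure \<psi> (u ` E) < ennreal \<epsilon>"
    using \<delta> by (meson le_less_trans)
next
  fix u :: "real^'n \<Rightarrow> real^'m" and \<epsilon> :: real
  assume u: "V1A A UNIV u \<and> continuous_on UNIV u" and \<epsilon>: "0 < \<epsilon>"
  then obtain G l where "sobolev_gauge UNIV u G A \<phi> l" using sobolev_gauge_of_V1A[OF open_UNIV assms(2-)] by blast
  then interpret sobolev_gauge UNIV u G A \<phi> l .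
  obtain \<delta> where \<delta>: "0 < \<delta>" "\<And>E. hausdorff_content \<phi> \<infinity> E < ennreal \<delta> \<Longrightarrow> hausdorff_content \<psi> \<infinity> (u ` E) \<le> ennreal (\<epsilon> / 2)"
    using content_image_small_UNIV[OF refl, of "\<epsilon> / 2"] \<epsilon> by auto
  have "ennreal (\<epsilon> / 2) < ennreal \<epsilon>" using \<epsilon> by (intro ennreal_lessI) auto
  then show "\<exists>\<delta>>0. \<forall>E. hausdorff_content \<phi> \<infinity> E < ennreal \<delta> \<longrightarrow> hausdorff_content \<psi> \<infinity> (u ` E) < ennreal \<epsilon>"
    using \<delta> by (meson le_less_trans)
qed

end
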